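(* Let $p>1$, $\alpha\ge0$, $\beta>0$, let $(x_i,y_i)_{i=1}^N\subset\mathbb R^{d+1}\times\mathbb R$ be data, let $\mu^*\in\mathcal M_p(\Theta)$, and suppose $L(y,w)=\ell(y-w)$, where $\ell:\mathbb R\to\mathbb R$ is convex, coercive and lower semicontinuous. Then there exists a solution $\mu_{\min}$ of $$\inf_{\mu\in\mathrm{KRu}(\Theta)}\ \frac1N\sum_{i=1}^N L(y_i,f_\mu(x_i))+\alpha\|\mu-\mu^*\|_{\mathrm{KRu}}+\beta\int_\Theta\bigl(1+\mathrm{dist}(\theta,e)^p\bigr)\,\mathrm d|\mu-\mu^*|(\theta)$$ that can be written as $$\mu_{\min}=\sum_{i=1}^N c_i(\delta_{\theta_i}-\delta_{\eta_i})+(\mu_{\min}-\mu^* )(\Theta)\,\delta_e+\mu^*,\qquad \theta_i,\eta_i\in\Theta,\ c_i\in\mathbb R.$$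
   Context: $\Theta\subset\mathbb R^{d+1}$ is a set of weights equipped with a metric $\mathrm{dist}$ and base point $e\in\Theta$, so that $(\Theta,\mathrm{dist})$ is a complete, separable, locally compact, geodesic pointed metric space. $\mathcal M(\Theta)$ is the space of bounded (finite signed) Borel measures, $|\mu|$ the total variation measure, $\delta_\theta$ the Dirac measure at $\theta$, and $\mathcal M_p(\Theta)=\{\mu\in\mathcal M(\Theta):\int_\Theta \mathrm{dist}(\theta,e)^p\,\mathrm d|\mu|(\theta)<\infty\}$. For $f:\Theta\to\mathbb R$ let $L(f)$ denote its Lipschitz constant with respect to $\mathrm{dist}$ (not to be confused with the two-variable loss $L(y,w)$). On $\mathcal M_1(\Theta)$ define $$\|\mu\|_{\mathrm{KRu}}=|\mu(\Theta)|+\sup\left\{\int_\Theta f\,\mathrm d\mu:\ f(e)=0,\ L(f)\le 1\right\},$$ and let $\mathrm{KRu}(\Theta)$ be the completion of $\mathcal M_1(\Theta)$ in this norm. For a Lipschitz function $\varphi$ on $\Theta$, $\langle\mu,\varphi\rangle$ denotes the continuous extension to $\mathrm{KRu}(\Theta)$ of $\mu\mapsto\int_\Theta\varphi\,\mathrm d\mu$. $\sigma:\mathbb R\to\mathbb R$ is a Lipschitz activation function such that $\theta\mapsto\sigma(\langle\theta,x\rangle)$ is Lipschitz on $(\Theta,\mathrm{dist})$ for each $x\in\mathbb R^{d+1}$ (automatic for the Euclidean metric), and $f_\mu(x)=\langle\mu,\sigma(\langle\cdot,x\rangle)\rangle$. The integral term in the objective is understood as $+\infty$ (and hence so is the objective)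 if $\mu-\mu^*\notin\mathcal M_p(\Theta)$. Coercive means $\ell(t)\to+\infty$ as $|t|\to\infty$. *)

theory Defs
  imports "HOL-Analysis.Analysis"
begin

section \<open>Metric notions\<close>

definition geodesic_metric :: "'a metric \<Rightarrow> bool" where
  "geodesic_metric X \<longleftrightarrow>
     (\<forall>x\<in>mspace X. \<forall>y\<in>mspace X. \<exists>\<gamma>::real \<Rightarrow> 'a.
        \<gamma> ` {0..1} \<subseteq> mspace X \<and> \<gamma> 0 = x \<and> \<gamma> 1 = y \<and>
        (\<forall>s\<in>{0..1}. \<forall>t\<in>{0..1}. mdist X (\<gamma> s) (\<gamma> t) = \<bar>s - t\<bar> * mdist X x y))"

definition lip_const :: "'a metric \<Rightarrow> ('a \<Rightarrow> real) \<Rightarrow> ennreal" where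
  "lip_const X f =
     (SUP (x, y) \<in> {(x, y). x \<in> mspace X \<and> y \<in> mspace X \<and> x \<noteq> y}.
        ennreal (\<bar>f x - f y\<bar> / mdist X x y))"

lemma lip_const_le_iff:
  assumes "0 \<le> C"
  shows "lip_const X f \<le> ennreal C \<longleftrightarrow>
    (\<forall>x\<in>mspace X. \<forall>y\<in>mspace X. \<bar>f x - f y\<bar> \<le> C * mdist X x y)"
proof -
  interpret Metric_space "mspace X" "mdist X"
    by simp
  have "\<bar>f x - f y\<bar> \<le> C * mdist X x y \<longleftrightarrow>
      (x \<noteq> y \<longrightarrow> ennreal (\<bar>f x - f y\<bar> / mdist X x y) \<le> ennreal C)"
    if "x \<in> mspace X" "y \<in> mspace X" for x y
  proof (cases "x = y")
    case False
    then have "0 < mdist X x y"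
      using that mdist_pos_eq by blast
    then show ?thesis
      using False assms by (simp add: divide_simps)
  qed (use assms in simp)
  then show ?thesis
    unfolding lip_const_def by (auto simp: SUP_le_iff)
qed

section \<open>Finite signed Borel measures\<close>

text \<open>Only the space and the sigma-algebra of this measure space are used.\<close>

definition mborel :: "'a metric \<Rightarrow> 'a measure" where
  "mborel X = sigma (mspace X) {U. openin (mtopology_of X) U}"

text \<open>A finite signed measure is a real-valued countably additive function on the Borel sets.
  The value 0 off the Borel sets makes equality of set functions agree with equality of measures.\<close>

definition signed_measures :: "'a metric \<Rightarrow> ('a set \<Rightarrow> real) set" where
  "signed_measures X =
     {\<mu>. (\<forall>A::nat \<Rightarrow> 'a set. range A \<subseteq> sets (mborel X) \<longrightarrow> disjoint_family A \<longrightarrow>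
            (\<lambda>i. \<mu> (A i)) sums \<mu> (\<Union>i. A i)) \<and>
         (\<forall>A. A \<notin> sets (mborel X) \<longrightarrow> \<mu> A = 0)}"

definition dirac :: "'a metric \<Rightarrow> 'a \<Rightarrow> 'a set \<Rightarrow> real" where
  "dirac X \<theta> A = (if A \<in> sets (mborel X) \<and> \<theta> \<in> A then 1 else 0)"

text \<open>Jordan decomposition: the positive part of \<open>\<mu>\<close> is \<open>A \<mapsto> sup {\<mu> B | B \<subseteq> A Borel}\<close>,
  the negative part is the positive part of \<open>-\<mu>\<close>.\<close>

definition jordan_pos :: "'a metric \<Rightarrow> ('a set \<Rightarrow> real) \<Rightarrow> 'a measure" where
  "jordan_pos X \<mu> = measure_of (mspace X) (sets (mborel X))
     (\<lambda>A. SUP B \<in> {B \<in> sets (mborel X). B \<subseteq> A}. ennreal (\<mu> B))"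

definition jordan_neg :: "'a metric \<Rightarrow> ('a set \<Rightarrow> real) \<Rightarrow> 'a measure" where
  "jordan_neg X \<mu> = jordan_pos X (\<lambda>A. - \<mu> A)"

definition total_variation :: "'a metric \<Rightarrow> ('a set \<Rightarrow> real) \<Rightarrow> 'a measure" where
  "total_variation X \<mu> = measure_of (mspace X) (sets (mborel X))
     (\<lambda>A. emeasure (jordan_pos X \<mu>) A + emeasure (jordan_neg X \<mu>) A)"

definition signed_integral :: "'a metric \<Rightarrow> ('a set \<Rightarrow> real) \<Rightarrow> ('a \<Rightarrow> real) \<Rightarrow> real" where
  "signed_integral X \<mu> f = (LINT \<theta>|jordan_pos X \<mu>. f \<theta>) - (LINT \<theta>|jordan_neg X \<mu>. f \<theta>)"

definition moment_measures :: "'a metric \<Rightarrow> 'a \<Rightarrow> real \<Rightarrow> ('a set \<Rightarrow> real) set" where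
  "moment_measures X e p =
     {\<mu> \<in> signed_measures X.
        (\<integral>\<^sup>+\<theta>. ennreal (mdist X \<theta> e powr p) \<partial>total_variation X \<mu>) < \<infinity>}"

section \<open>The Kantorovich-Rubinstein norm and the completion\<close>

text \<open>For \<open>\<mu>\<close> with finite first moment the supremum is over a nonempty bounded set of reals.\<close>

definition KRu_norm_meas :: "'a metric \<Rightarrow> 'a \<Rightarrow> ('a set \<Rightarrow> real) \<Rightarrow> real" where
  "KRu_norm_meas X e \<mu> =
     \<bar>\<mu> (mspace X)\<bar> + (SUP f \<in> {f. f e = 0 \<and> lip_const X f \<le> 1}. signed_integral X \<mu> f)"

text \<open>The completion consists of the classes of Cauchy sequences in the space of measures with
  finite first moment, modulo differences tending to zero in norm.\<close>

definition KRu_Cauchy :: "'a metric \<Rightarrow> 'a \<Rightarrow> (nat \<Rightarrow> 'a set \<Rightarrow> real) set" where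
  "KRu_Cauchy X e =
     {s. (\<forall>n. s n \<in> moment_measures X e 1) \<and>
         (\<forall>\<epsilon>>0. \<exists>n0. \<forall>m\<ge>n0. \<forall>n\<ge>n0. KRu_norm_meas X e (\<lambda>A. s m A - s n A) < \<epsilon>)}"

definition KRu_rel ::
    "'a metric \<Rightarrow> 'a \<Rightarrow> ((nat \<Rightarrow> 'a set \<Rightarrow> real) \<times> (nat \<Rightarrow> 'a set \<Rightarrow> real)) set" where
  "KRu_rel X e =
     {(s, t). s \<in> KRu_Cauchy X e \<and> t \<in> KRu_Cauchy X e \<and>
        (\<lambda>n. KRu_norm_meas X e (\<lambda>A. s n A - t n A)) \<longlonglongrightarrow> 0}"

definition KRu :: "'a metric \<Rightarrow> 'a \<Rightarrow> (nat \<Rightarrow> 'a set \<Rightarrow> real) set set" where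
  "KRu X e = KRu_Cauchy X e // KRu_rel X e"

definition KRu_embed ::
    "'a metric \<Rightarrow> 'a \<Rightarrow> ('a set \<Rightarrow> real) \<Rightarrow> (nat \<Rightarrow> 'a set \<Rightarrow> real) set" where
  "KRu_embed X e \<mu> = KRu_rel X e `` {\<lambda>n. \<mu>}"

definition KRu_diff ::
    "'a metric \<Rightarrow> 'a \<Rightarrow> (nat \<Rightarrow> 'a set \<Rightarrow> real) set \<Rightarrow> (nat \<Rightarrow> 'a set \<Rightarrow> real) set
      \<Rightarrow> (nat \<Rightarrow> 'a set \<Rightarrow> real) set" where
  "KRu_diff X e u v = (\<Union>s\<in>u. \<Union>t\<in>v. KRu_rel X e `` {\<lambda>n A. s n A - t n A})"

text \<open>Continuous extension to the completion of a real function \<open>F\<close> of measures; well defined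
  when \<open>F\<close> is uniformly continuous in the norm, as in the three uses below.\<close>

definition KRu_extend ::
    "(('a set \<Rightarrow> real) \<Rightarrow> real) \<Rightarrow> (nat \<Rightarrow> 'a set \<Rightarrow> real) set \<Rightarrow> real" where
  "KRu_extend F u = (THE r. \<forall>s\<in>u. (\<lambda>n. F (s n)) \<longlonglongrightarrow> r)"

definition KRu_norm :: "'a metric \<Rightarrow> 'a \<Rightarrow> (nat \<Rightarrow> 'a set \<Rightarrow> real) set \<Rightarrow> real" where
  "KRu_norm X e u = KRu_extend (KRu_norm_meas X e) u"

definition KRu_mass :: "'a metric \<Rightarrow> (nat \<Rightarrow> 'a set \<Rightarrow> real) set \<Rightarrow> real" where
  "KRu_mass X u = KRu_extend (\<lambda>\<mu>. \<mu> (mspace X)) u"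

definition KRu_pairing ::
    "'a metric \<Rightarrow> (nat \<Rightarrow> 'a set \<Rightarrow> real) set \<Rightarrow> ('a \<Rightarrow> real) \<Rightarrow> real" where
  "KRu_pairing X u \<phi> = KRu_extend (\<lambda>\<mu>. signed_integral X \<mu> \<phi>) u"

section \<open>Networks and the objective\<close>

definition network ::
    "('v::real_inner) metric \<Rightarrow> (real \<Rightarrow> real) \<Rightarrow> (nat \<Rightarrow> 'v set \<Rightarrow> real) set \<Rightarrow> 'v \<Rightarrow> real" where
  "network X \<sigma> u x = KRu_pairing X u (\<lambda>\<theta>. \<sigma> (\<theta> \<bullet> x))"

text \<open>The integral of \<open>1 + dist(\<cdot>, e)\<^sup>p\<close> against the total variation, set to \<open>\<infinity>\<close> on elements
  of the completion that are not given by a measure with finite \<open>p\<close>-th moment.\<close>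

definition moment_penalty ::
    "'a metric \<Rightarrow> 'a \<Rightarrow> real \<Rightarrow> (nat \<Rightarrow> 'a set \<Rightarrow> real) set \<Rightarrow> ennreal" where
  "moment_penalty X e p u =
     (if \<exists>\<nu>\<in>moment_measures X e p. u = KRu_embed X e \<nu>
      then \<integral>\<^sup>+\<theta>. ennreal (1 + mdist X \<theta> e powr p)
             \<partial>total_variation X (THE \<nu>. \<nu> \<in> moment_measures X e p \<and> u = KRu_embed X e \<nu>)
      else \<infinity>)"

definition objective ::
    "('v::real_inner) metric \<Rightarrow> 'v \<Rightarrow> (real \<Rightarrow> real) \<Rightarrow> (real \<Rightarrow> real \<Rightarrow> real) \<Rightarrow>
      nat \<Rightarrow> (nat \<Rightarrow> 'v) \<Rightarrow> (nat \<Rightarrow> real) \<Rightarrow> real \<Rightarrow> real \<Rightarrow> real \<Rightarrow>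
      ('v set \<Rightarrow> real) \<Rightarrow> (nat \<Rightarrow> 'v set \<Rightarrow> real) set \<Rightarrow> ereal" where
  "objective X e \<sigma> L N x y p \<alpha> \<beta> \<mu>s u =
     ereal (1 / real N * (\<Sum>i = 1..N. L (y i) (network X \<sigma> u (x i)))
            + \<alpha> * KRu_norm X e (KRu_diff X e u (KRu_embed X e \<mu>s)))
     + ereal \<beta> * enn2ereal (moment_penalty X e p (KRu_diff X e u (KRu_embed X e \<mu>s)))"

definition lower_semicontinuous :: "('a::topological_space \<Rightarrow> real) \<Rightarrow> bool" where
  "lower_semicontinuous f \<longleftrightarrow> (\<forall>t. ereal (f t) \<le> Liminf (at t) (\<lambda>s. ereal (f s)))"

end

theory Submission
  imports Defs
begin

text \<open>Write \<open>\<mu> = \<nu> + \<mu>\<^sup>*\<close>. The objective then becomes \<open>F(w) + R(\<nu>)\<close>, where \<open>w\<close> is the vector of the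
  \<open>N\<close> numbers \<open>\<integral> \<phi>\<^sub>i d\<nu>\<close> with \<open>\<phi>\<^sub>i(\<theta>) = \<sigma>\<langle>\<theta>, x\<^sub>i\<rangle>\<close>, the function \<open>F\<close> is continuous and bounded below, and
  \<open>R\<close> is the sum of the two penalties. The functional \<open>R\<close> behaves like the gauge generated by the
  atoms \<open>\<delta>\<^sub>x\<close>, \<open>-\<delta>\<^sub>y\<close> and \<open>\<delta>\<^sub>x - \<delta>\<^sub>y\<close>, each with an explicit cost, and this is what makes the
  problem finite-dimensional. Let \<open>T\<close> be the convex hull of 0 and of the moment vectors of all atoms,
  each divided by the cost of its atom.

  \<^item> A finite combination of atoms costs at most the sum of the costs of its terms
    (\<open>regularizer_atomic_le\<close>), so every \<open>r d\<close> with \<open>r \<ge> 0\<close> and \<open>d \<in> T\<close> is the moment vector of an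
    atomic measure with \<open>R \<le> r\<close>. By the conic form of Caratheodory's theorem \<open>N\<close> atoms are enough
    (\<open>hull_realized_by_atoms\<close>).

  \<^item> Conversely the moment vector of every \<open>\<nu>\<close> lies in \<open>R(\<nu>) T\<close> (\<open>moments_in_hull\<close>). Otherwise a linear
    functional \<open>b\<close> would separate it from this compact convex set, and \<open>\<psi> = \<Sum>\<^sub>i b\<^sub>i \<phi>\<^sub>i\<close> would have an
    integral larger than its bounds on the atoms allow. A McShane-type infimum \<open>h\<close> splits \<open>\<psi>\<close> into a
    Lipschitz part, paid for by the Kantorovich--Rubinstein norm, and a remainder, paid for by the
    moment term (\<open>signed_integral_le_regularizer\<close>). No optimal transport plan occurs.

  \<^item> The set \<open>T\<close> is compact. Closed balls of \<open>\<Theta>\<close> are compact by the Hopf--Rinow theorem, and atoms far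
    away contribute only small vectors since their cost grows like the \<open>p\<close>-th power of the distance
    with \<open>p > 1\<close>, whereas the \<open>\<phi>\<^sub>i\<close> grow linearly (\<open>compact_atom_directions\<close>).

  Hence minimising the objective is the same as minimising \<open>F(r d) + r\<close> over \<open>r \<ge> 0\<close> and \<open>d \<in> T\<close>.
  Coercivity in \<open>r\<close> and compactness of \<open>T\<close> give a minimiser, and an atomic measure with at most \<open>N\<close>
  atoms realises it. An atom \<open>\<delta>\<^sub>x\<close> is the dipole \<open>\<delta>\<^sub>x - \<delta>\<^sub>e\<close> together with a unit mass at \<open>e\<close>, which
  gives the stated form.

  In the completion only classes of measures matter, because the moment term is infinite elsewhere.
  On such classes all continuous extensions reduce to their values on the measure
  (\<open>KRu_extend_embed\<close>), once it is known that Lipschitz functions separate signed measures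
  (\<open>KRu_norm_meas_eq_0D\<close>).\<close>

section \<open>Convex combinations in finitely many coordinates\<close>

text \<open>Elimination: an equation with a nonzero coefficient expresses one unknown by the others, and
  \<open>w'\<close> below is the system left for those.\<close>

lemma homogeneous_system_nontrivial_solution:
  fixes w :: "'i \<Rightarrow> 'a \<Rightarrow> real"
  assumes "finite I" "finite S" "card I < card S"
  shows "\<exists>s. (\<exists>a\<in>S. s a \<noteq> 0) \<and> (\<forall>i\<in>I. (\<Sum>a\<in>S. s a * w i a) = 0)"
  using assms
proof (induction I arbitrary: S w rule: finite_induct)
  case empty
  then obtain a where "a \<in> S" by fastforce
  then show ?case by (intro exI[of _ "\<lambda>_. 1"]) auto
next
  case (insert k I)
  show ?case
  proof (cases "\<forall>a\<in>S. w k a = 0")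
    case True
    obtain s where "\<exists>a\<in>S. s a \<noteq> 0" "\<forall>i\<in>I. (\<Sum>a\<in>S. s a * w i a) = 0"
      using insert by (metis card_insert_disjoint Suc_lessD)
    then show ?thesis using True by (intro exI[of _ s]) auto
  next
    case False
    then obtain a0 where a0: "a0 \<in> S" "w k a0 \<noteq> 0" by blast
    define S' where "S' = S - {a0}"
    have S: "finite S'" "a0 \<notin> S'" "S = insert a0 S'" "card I < card S'"
      using a0 insert by (auto simp: S'_def)
    define w' where "w' i a = w i a - w i a0 * (w k a / w k a0)" for i a
    obtain s where s: "\<exists>a\<in>S'. s a \<noteq> 0" "\<forall>i\<in>I. (\<Sum>a\<in>S'. s a * w' i a) = 0"
      using insert.IH[OF S(1,4), of w'] by blast
    define c where "c = - (\<Sum>a\<in>S'. s a * (w k a / w k a0))"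
    define r where "r = s(a0 := c)"
    have sum: "(\<Sum>a\<in>S. r a * w i a) = c * w i a0 + (\<Sum>a\<in>S'. s a * w i a)" for i
      unfolding S(3) using S(1,2) by (auto simp: r_def intro!: sum.cong)
    have "(\<Sum>a\<in>S. r a * w k a) = 0"
      unfolding sum c_def using a0(2) by (simp add: sum_distrib_right)
    moreover have "(\<Sum>a\<in>S. r a * w i a) = 0" if "i \<in> I" for i
    proof -
      have "(\<Sum>a\<in>S'. s a * w' i a) = (\<Sum>a\<in>S'. s a * w i a) + c * w i a0"
        unfolding c_def mult_minus_left sum_distrib_right add_uminus_conv_diff sum_subtractf[symmetric]
        by (intro sum.cong refl) (simp add: w'_def algebra_simps)
      then show ?thesis using s(2) that unfolding sum by simp
    qed
    moreover have "\<exists>a\<in>S. r a \<noteq> 0" using s(1) S by (auto simp: r_def)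
    ultimately show ?thesis by (intro exI[of _ r]) auto
  qed
qed

text \<open>A linear relation among more than \<open>card I\<close> columns may be taken with nonnegative coefficient
  sum, after a change of sign. Subtracting the multiple of it that first makes some weight vanish
  removes a column, preserves all coordinates and does not increase the total weight.\<close>

lemma conic_caratheodory:
  fixes w :: "'i \<Rightarrow> 'a \<Rightarrow> real"
  assumes "finite I" "finite S" "\<And>a. a \<in> S \<Longrightarrow> 0 \<le> t a"
  shows "\<exists>S' t'. S' \<subseteq> S \<and> card S' \<le> card I \<and> (\<forall>a\<in>S'. 0 \<le> t' a) \<and>
     (\<forall>i\<in>I. (\<Sum>a\<in>S'. t' a * w i a) = (\<Sum>a\<in>S. t a * w i a)) \<and>
     (\<Sum>a\<in>S'. t' a) \<le> (\<Sum>a\<in>S. t a)"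
  using assms(2,3)
proof (induction "card S" arbitrary: S t rule: less_induct)
  case less
  show ?case
  proof (cases "card S \<le> card I")
    case True
    then show ?thesis using less by (intro exI[of _ S] exI[of _ t]) auto
  next
    case False
    then obtain s0 where s0: "\<exists>a\<in>S. s0 a \<noteq> 0" "\<forall>i\<in>I. (\<Sum>a\<in>S. s0 a * w i a) = 0"
      using homogeneous_system_nontrivial_solution[of I S w] assms(1) less by auto
    define s where "s = (if (\<Sum>a\<in>S. s0 a) \<ge> 0 then s0 else (\<lambda>a. - s0 a))"
    have s: "\<exists>a\<in>S. s a \<noteq> 0" "\<forall>i\<in>I. (\<Sum>a\<in>S. s a * w i a) = 0" "(\<Sum>a\<in>S. s a) \<ge> 0"
      using s0 by (auto simp: s_def sum_negf)
    define P where "P = {a\<in>S. 0 < s a}"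
    have "P \<noteq> {}"
    proof
      assume "P = {}"
      then have np: "\<And>a. a \<in> S \<Longrightarrow> s a \<le> 0" by (force simp: P_def)
      then have "(\<Sum>a\<in>S. s a) = 0" using s(3) by (simp add: order_antisym sum_nonpos)
      then have "\<forall>a\<in>S. s a = 0"
        using sum_nonneg_eq_0_iff[of S "\<lambda>a. - s a"] np less.prems(1) by (auto simp: sum_negf)
      then show False using s(1) by blast
    qed
    moreover have "finite P" using less.prems(1) by (simp add: P_def)
    ultimately obtain m where m: "m \<in> P" "\<And>a. a \<in> P \<Longrightarrow> t m / s m \<le> t a / s a"
      using ex_min_if_finite[of "(\<lambda>a. t a / s a) ` P"] by (force simp: not_less)
    define \<tau> where "\<tau> = t m / s m"
    define t' where "t' a = t a - \<tau> * s a" for a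
    have mS: "m \<in> S" "0 < s m" using m(1) by (auto simp: P_def)
    have \<tau>0: "0 \<le> \<tau>" using mS less.prems(2)[of m] by (simp add: \<tau>_def)
    have t'0: "t' m = 0" using mS by (simp add: t'_def \<tau>_def)
    have t'nn: "0 \<le> t' a" if "a \<in> S" for a
    proof (cases "0 < s a")
      case True
      then show ?thesis using m(2)[of a] that by (simp add: t'_def \<tau>_def[symmetric] P_def pos_le_divide_eq)
    next
      case False
      then have "\<tau> * s a \<le> 0" using \<tau>0 by (simp add: mult_nonneg_nonpos)
      then show ?thesis using less.prems(2)[OF that] by (simp add: t'_def)
    qed
    let ?S = "S - {m}"
    have drop: "(\<Sum>a\<in>?S. t' a * v a) = (\<Sum>a\<in>S. t a * v a) - \<tau> * (\<Sum>a\<in>S. s a * v a)" for v :: "'a \<Rightarrow> real"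
    proof -
      have "(\<Sum>a\<in>?S. t' a * v a) = (\<Sum>a\<in>S. t' a * v a)"
        using less.prems(1) mS t'0 by (simp add: sum.remove)
      also have "\<dots> = (\<Sum>a\<in>S. t a * v a) - \<tau> * (\<Sum>a\<in>S. s a * v a)"
        unfolding sum_distrib_left sum_subtractf[symmetric]
        by (intro sum.cong refl) (simp add: t'_def algebra_simps)
      finally show ?thesis .
    qed
    have "card ?S < card S" using less.prems(1) mS(1) by (rule card_Diff1_less)
    then obtain S' u where u: "S' \<subseteq> ?S" "card S' \<le> card I" "\<forall>a\<in>S'. 0 \<le> u a"
       "\<forall>i\<in>I. (\<Sum>a\<in>S'. u a * w i a) = (\<Sum>a\<in>?S. t' a * w i a)" "(\<Sum>a\<in>S'. u a) \<le> (\<Sum>a\<in>?S. t' a)"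
      using less.hyps[of ?S t'] t'nn less.prems(1) by auto
    have "(\<Sum>a\<in>?S. t' a) \<le> (\<Sum>a\<in>S. t a)"
      using drop[of "\<lambda>_. 1"] \<tau>0 s(3) by simp
    then show ?thesis
      using u s(2) by (intro exI[of _ S'] exI[of _ u]) (auto simp: drop)
  qed
qed

text \<open>If \<open>K\<close> is nonempty and its points vanish off an index set with \<open>N\<close> elements, this is the
  convex hull of \<open>K \<union> {0}\<close>. Points are functions on an index type so that the number of coordinates
  can be a variable.\<close>

definition subconvex_combinations :: "nat \<Rightarrow> ('i \<Rightarrow> real) set \<Rightarrow> ('i \<Rightarrow> real) set" where
  "subconvex_combinations N K = {z. \<exists>t k. (\<forall>j<N. 0 \<le> t j \<and> k j \<in> K) \<and> (\<Sum>j<N. t j) \<le> 1 \<and>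
      z = (\<lambda>i. \<Sum>j<N. t j * k j i)}"

text \<open>The set is a continuous image of a closed set of weights in a product of unit intervals,
  times a power of \<open>K\<close>; infinitely many factors are harmless by Tychonoff's theorem.\<close>

lemma compact_subconvex_combinations:
  fixes K :: "('i \<Rightarrow> real) set"
  assumes "compact K" "K \<noteq> {}"
  shows "compact (subconvex_combinations N K)"
proof -
  obtain k0 where k0: "k0 \<in> K" using assms(2) by blast
  define P where "P = PiE UNIV (\<lambda>_::nat. {0..1::real}) \<inter> {t. (\<Sum>j<N. t j) \<le> 1}"
  define Q where "Q = PiE UNIV (\<lambda>_::nat. K)"
  define h :: "(nat \<Rightarrow> real) \<times> (nat \<Rightarrow> 'i \<Rightarrow> real) \<Rightarrow> 'i \<Rightarrow> real"
    where "h = (\<lambda>(t, k) i. \<Sum>j<N. t j * k j i)"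
  have coord: "continuous_on UNIV (\<lambda>t::nat \<Rightarrow> real. t j)" for j
    by (rule continuous_on_product_coordinates)
  have "closed {t::nat \<Rightarrow> real. (\<Sum>j<N. t j) \<le> 1}"
    by (intro closed_Collect_le continuous_on_sum coord continuous_on_const)
  moreover have "compact (PiE UNIV (\<lambda>_::nat. {0..1::real}))"
    using compactin_PiE[of "\<lambda>_::nat. euclideanreal" UNIV "\<lambda>_. {0..1}"]
    by (simp add: euclidean_product_topology)
  ultimately have P: "compact P" unfolding P_def by (intro compact_Int_closed)
  have Q: "compact Q" unfolding Q_def
    using compactin_PiE[of "\<lambda>_::nat. euclidean" UNIV "\<lambda>_. K"] assms
    by (simp add: euclidean_product_topology)
  have "continuous_on (P \<times> Q) (\<lambda>p. fst p j)" for j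
    by (rule continuous_on_product_then_coordinatewise[OF continuous_on_fst[OF continuous_on_id]])
  moreover have "continuous_on (P \<times> Q) (\<lambda>p. snd p j i)" for j i
    by (rule continuous_on_product_then_coordinatewise[OF
          continuous_on_product_then_coordinatewise[OF continuous_on_snd[OF continuous_on_id]]])
  ultimately have "continuous_on (P \<times> Q) (\<lambda>p. \<Sum>j<N. fst p j * snd p j i)" for i
    by (intro continuous_on_sum continuous_on_mult)
  then have "continuous_on (P \<times> Q) h"
    unfolding h_def by (intro continuous_on_coordinatewise_then_product) (simp add: case_prod_beta)
  then have "compact (h ` (P \<times> Q))"
    using P Q by (intro compact_continuous_image compact_Times)
  also have "h ` (P \<times> Q) = subconvex_combinations N K"
  proof (intro equalityI subsetI)
    fix z assume "z \<in> h ` (P \<times> Q)"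
    then obtain t k where "t \<in> P" "k \<in> Q" "z = h (t, k)" by auto
    then show "z \<in> subconvex_combinations N K"
      unfolding subconvex_combinations_def P_def Q_def h_def
      by (auto simp: PiE_iff intro!: exI[of _ t] exI[of _ k])
  next
    fix z assume "z \<in> subconvex_combinations N K"
    then obtain t k where tk: "\<forall>j<N. 0 \<le> t j \<and> k j \<in> K" "(\<Sum>j<N. t j) \<le> 1"
      "z = (\<lambda>i. \<Sum>j<N. t j * k j i)"
      unfolding subconvex_combinations_def by blast
    define t' where "t' j = (if j < N then t j else 0)" for j
    define k' where "k' j = (if j < N then k j else k0)" for j
    have "t j \<le> 1" if "j < N" for j
      using member_le_sum[of j "{..<N}" t] tk(1,2) that by auto
    then have "t' \<in> P" "k' \<in> Q" using tk k0 by (auto simp: P_def Q_def t'_def k'_def)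
    moreover have "z = h (t', k')" by (simp add: tk(3) h_def t'_def k'_def)
    ultimately show "z \<in> h ` (P \<times> Q)" by blast
  qed
  finally show ?thesis .
qed

text \<open>Conic Caratheodory reduces the number of terms to the number of coordinates; the reduced
  combination is then renumbered and padded with zero weights.\<close>

lemma finite_combination_in_subconvex_combinations:
  fixes k :: "'a \<Rightarrow> 'i \<Rightarrow> real"
  assumes "finite I" "card I = N" and supp: "\<And>v i. v \<in> K \<Longrightarrow> i \<notin> I \<Longrightarrow> v i = 0"
    and "K \<noteq> {}"
    and S: "finite S" "\<And>a. a \<in> S \<Longrightarrow> 0 \<le> t a" "\<And>a. a \<in> S \<Longrightarrow> k a \<in> K" "(\<Sum>a\<in>S. t a) \<le> 1"
  shows "(\<lambda>i. \<Sum>a\<in>S. t a * k a i) \<in> subconvex_combinations N K"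
proof -
  obtain S' t' where S': "S' \<subseteq> S" "card S' \<le> N" "\<forall>a\<in>S'. 0 \<le> t' a"
     "\<forall>i\<in>I. (\<Sum>a\<in>S'. t' a * k a i) = (\<Sum>a\<in>S. t a * k a i)"
     "(\<Sum>a\<in>S'. t' a) \<le> (\<Sum>a\<in>S. t a)"
    using conic_caratheodory[of I S t "\<lambda>i a. k a i"] assms(1,2) S by metis
  have fin: "finite S'" using S'(1) S(1) finite_subset by blast
  obtain k0 where "k0 \<in> K" using assms(4) by blast
  obtain h where h: "bij_betw h {..<card S'} S'"
    using ex_bij_betw_nat_finite[OF fin] by (auto simp: atLeast0LessThan)
  define r where "r j = (if j < card S' then t' (h j) else 0)" for j
  define l where "l j = (if j < card S' then k (h j) else k0)" for j
  have hS: "h j \<in> S'" if "j < card S'" for j using h that by (auto simp: bij_betw_def)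
  have sum: "(\<Sum>j<N. r j * f (h j)) = (\<Sum>a\<in>S'. t' a * f a)" for f :: "'a \<Rightarrow> real"
  proof -
    have "(\<Sum>j<N. r j * f (h j)) = (\<Sum>j<card S'. r j * f (h j))"
      using S'(2) by (intro sum.mono_neutral_right) (auto simp: r_def)
    also have "\<dots> = (\<Sum>j<card S'. t' (h j) * f (h j))" by (simp add: r_def)
    also have "\<dots> = (\<Sum>a\<in>S'. t' a * f a)" using h by (rule sum.reindex_bij_betw)
    finally show ?thesis .
  qed
  have "(\<Sum>a\<in>S. t a * k a i) = (\<Sum>j<N. r j * l j i)" for i
  proof -
    have "(\<Sum>j<N. r j * l j i) = (\<Sum>j<N. r j * k (h j) i)"
      by (intro sum.cong) (auto simp: r_def l_def)
    also have "\<dots> = (\<Sum>a\<in>S'. t' a * k a i)" by (rule sum)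
    also have "\<dots> = (\<Sum>a\<in>S. t a * k a i)"
    proof (cases "i \<in> I")
      case False
      then have "k a i = 0" if "a \<in> S" for a using supp S(3) that by blast
      then show ?thesis using S'(1) by (simp add: subset_iff)
    qed (use S'(4) in simp)
    finally show ?thesis by simp
  qed
  moreover have "\<forall>j<N. 0 \<le> r j \<and> l j \<in> K"
    using hS S'(1,3) S(3) \<open>k0 \<in> K\<close> by (auto simp: r_def l_def)
  moreover have "(\<Sum>j<N. r j) \<le> 1"
    using sum[of "\<lambda>_. 1"] S'(5) S(4) by simp
  ultimately show ?thesis
    unfolding subconvex_combinations_def by (auto intro!: exI[of _ r] exI[of _ l])
qed

text \<open>A convex combination of two combinations with \<open>N\<close> terms has \<open>2 * N\<close> terms, indexed by a
  disjoint sum, and can be shortened again.\<close>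

lemma subconvex_combinations_convex:
  fixes K :: "('i \<Rightarrow> real) set"
  assumes "finite I" "card I = N" and supp: "\<And>v i. v \<in> K \<Longrightarrow> i \<notin> I \<Longrightarrow> v i = 0"
    and "K \<noteq> {}"
    and z: "z \<in> subconvex_combinations N K" "z' \<in> subconvex_combinations N K" and u: "0 \<le> u" "u \<le> 1"
  shows "(\<lambda>i. (1 - u) * z i + u * z' i) \<in> subconvex_combinations N K"
proof -
  obtain t k where tk: "\<forall>j<N. 0 \<le> t j \<and> k j \<in> K" "(\<Sum>j<N. t j) \<le> 1"
      "z = (\<lambda>i. \<Sum>j<N. t j * k j i)"
    using z(1) unfolding subconvex_combinations_def by blast
  obtain t' k' where tk': "\<forall>j<N. 0 \<le> t' j \<and> k' j \<in> K" "(\<Sum>j<N. t' j) \<le> 1"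
      "z' = (\<lambda>i. \<Sum>j<N. t' j * k' j i)"
    using z(2) unfolding subconvex_combinations_def by blast
  define S :: "(nat + nat) set" where "S = {..<N} <+> {..<N}"
  define r where "r = case_sum (\<lambda>j. (1 - u) * t j) (\<lambda>j. u * t' j)"
  define l where "l = case_sum k k'"
  have sum: "(\<Sum>a\<in>S. r a * f a) = (1 - u) * (\<Sum>j<N. t j * f (Inl j)) + u * (\<Sum>j<N. t' j * f (Inr j))"
    for f :: "nat + nat \<Rightarrow> real"
    by (simp add: S_def r_def sum.Plus sum_distrib_left mult.assoc)
  have "(\<lambda>i. \<Sum>a\<in>S. r a * l a i) \<in> subconvex_combinations N K"
  proof (rule finite_combination_in_subconvex_combinations[where I = I and K = K])
    show "(\<Sum>a\<in>S. r a) \<le> 1"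
      using sum[of "\<lambda>_. 1"] convex_bound_le[OF tk(2) tk'(2), of "1 - u" u] u by simp
    show "v i = 0" if "v \<in> K" "i \<notin> I" for v i
      using supp that by blast
  qed (use assms(1,2,4) tk tk' u in \<open>auto simp: S_def r_def l_def\<close>)
  then show ?thesis unfolding sum by (simp add: l_def tk tk')
qed

text \<open>The functional that separates a point from a compact convex set is the
  difference between the point and its nearest point in the set.\<close>

lemma separate_point_compact_convex:
  fixes T :: "('i::countable \<Rightarrow> real) set"
  assumes "finite I" "compact T" "T \<noteq> {}"
    and conv: "\<And>c d u. c \<in> T \<Longrightarrow> d \<in> T \<Longrightarrow> 0 \<le> u \<Longrightarrow> u \<le> 1 \<Longrightarrow> (\<lambda>i. (1 - u) * c i + u * d i) \<in> T"
    and supp: "\<And>v i. v \<in> insert z T \<Longrightarrow> i \<notin> I \<Longrightarrow> v i = 0"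
    and z: "z \<notin> T"
  shows "\<exists>b. \<forall>d\<in>T. (\<Sum>i\<in>I. b i * d i) < (\<Sum>i\<in>I. b i * z i)"
proof -
  define Q where "Q c = (\<Sum>i\<in>I. (z i - c i)\<^sup>2)" for c
  have "continuous_on T (\<lambda>c. c i)" for i
    by (rule continuous_on_product_then_coordinatewise[OF continuous_on_id])
  then have "continuous_on T Q" unfolding Q_def
    by (intro continuous_on_sum continuous_on_power continuous_on_diff continuous_on_const)
  then obtain c where c: "c \<in> T" "\<And>d. d \<in> T \<Longrightarrow> Q c \<le> Q d"
    using continuous_attains_inf[OF assms(2,3)] by blast
  define b where "b i = z i - c i" for i
  have "\<exists>i\<in>I. b i \<noteq> 0"
  proof (rule ccontr)
    assume "\<not> ?thesis"
    then have "z = c" using supp c(1) by (auto simp: b_def fun_eq_iff) (metis)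
    then show False using c(1) z by simp
  qed
  then have bpos: "0 < (\<Sum>i\<in>I. b i * b i)"
    using assms(1) by (auto intro!: sum_pos2[where f = "\<lambda>i. b i * b i"] simp: zero_less_mult_iff)
  have le: "(\<Sum>i\<in>I. b i * (d i - c i)) \<le> 0" if d: "d \<in> T" for d
  proof (rule ccontr)
    define B where "B = (\<Sum>i\<in>I. b i * (d i - c i))"
    define D where "D = (\<Sum>i\<in>I. (d i - c i)\<^sup>2)"
    assume "\<not> ?thesis"
    then have B: "0 < B" by (simp add: B_def)
    have D: "0 \<le> D" by (simp add: D_def sum_nonneg)
    \<comment> \<open>A step of relative length \<open>u\<close> with \<open>u * D < 2 * B\<close> from \<open>c\<close> towards \<open>d\<close> would come closer to \<open>z\<close>.\<close>
    define u where "u = min 1 (B / (D + 1))"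
    have u: "0 < u" "u \<le> 1" using B D by (auto simp: u_def)
    have "u * D \<le> B / (D + 1) * D" using D by (intro mult_right_mono) (auto simp: u_def)
    also have "\<dots> < B * 2" using B D mult_nonneg_nonneg[of B D] by (simp add: field_simps add_nonneg_pos)
    finally have uD: "u * D < 2 * B" by simp
    have "Q c \<le> Q (\<lambda>i. (1 - u) * c i + u * d i)"
      using c(2)[OF conv[OF c(1) d]] u by simp
    also have "\<dots> = (\<Sum>i\<in>I. (b i)\<^sup>2 - 2 * u * (b i * (d i - c i)) + u\<^sup>2 * (d i - c i)\<^sup>2)"
      unfolding Q_def by (intro sum.cong refl) (simp add: b_def power2_eq_square algebra_simps)
    also have "\<dots> = Q c - 2 * u * B + u\<^sup>2 * D"
      by (simp add: Q_def b_def B_def D_def sum.distrib sum_subtractf sum_distrib_left)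
    finally have "2 * u * B \<le> u * (u * D)" by (simp add: power2_eq_square mult.assoc)
    then show False using u uD by (simp add: mult.assoc)
  qed
  have "(\<Sum>i\<in>I. b i * d i) < (\<Sum>i\<in>I. b i * z i)" if "d \<in> T" for d
  proof -
    have "(\<Sum>i\<in>I. b i * z i) - (\<Sum>i\<in>I. b i * d i) = (\<Sum>i\<in>I. b i * b i) - (\<Sum>i\<in>I. b i * (d i - c i))"
      unfolding sum_subtractf[symmetric] by (intro sum.cong refl) (simp add: b_def algebra_simps)
    then show ?thesis using bpos le[OF that] by simp
  qed
  then show ?thesis by blast
qed

text \<open>A set that is compact outside every neighbourhood of a point becomes compact when this point
  is added.\<close>

lemma compact_insert_limit:
  assumes "\<And>U. open U \<Longrightarrow> l \<in> U \<Longrightarrow> \<exists>C. compact C \<and> C \<subseteq> S \<and> S \<subseteq> U \<union> C"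
  shows "compact (insert l S)"
proof (rule compactI)
  fix \<C> assume op: "\<forall>t\<in>\<C>. open t" and cov: "insert l S \<subseteq> \<Union>\<C>"
  then obtain U where U: "U \<in> \<C>" "l \<in> U" by auto
  then obtain C where C: "compact C" "C \<subseteq> S" "S \<subseteq> U \<union> C" using assms op by metis
  then obtain D where "D \<subseteq> \<C>" "finite D" "C \<subseteq> \<Union>D"
    using compactE[of C \<C>] op cov by (metis insert_subset order_trans)
  then show "\<exists>\<C>'\<subseteq>\<C>. finite \<C>' \<and> insert l S \<subseteq> \<Union>\<C>'"
    using U C by (intro exI[of _ "insert U D"]) auto
qed

section \<open>Closed balls of the parameter space are compact\<close>

lemma geodesic_point_at_distance:
  assumes "geodesic_metric X" "x \<in> mspace X" "y \<in> mspace X" "0 \<le> s" "s \<le> mdist X x y"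
  obtains z where "z \<in> mspace X" "mdist X x z = s" "mdist X z y = mdist X x y - s"
proof -
  interpret Metric_space "mspace X" "mdist X" by simp
  obtain \<gamma> :: "real \<Rightarrow> 'a" where \<gamma>: "\<gamma> ` {0..1} \<subseteq> mspace X" "\<gamma> 0 = x" "\<gamma> 1 = y"
    and iso: "\<And>s t. s \<in> {0..1} \<Longrightarrow> t \<in> {0..1} \<Longrightarrow> mdist X (\<gamma> s) (\<gamma> t) = \<bar>s - t\<bar> * mdist X x y"
    using assms(1-3) unfolding geodesic_metric_def by metis
  show ?thesis
  proof (cases "mdist X x y = 0")
    case True
    then show ?thesis using that[of x] assms by auto
  next
    case False
    then have pos: "0 < mdist X x y" by (metis mdist_nonneg less_eq_real_def)
    define u where "u = s / mdist X x y"
    have u: "u \<in> {0..1}" "u * mdist X x y = s"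
      using pos assms(4,5) by (auto simp: u_def divide_simps)
    have "mdist X x (\<gamma> u) = s"
      using iso[of 0 u] u \<gamma>(2) by auto
    moreover have "mdist X (\<gamma> u) y = mdist X x y - s"
      using iso[of u 1] u \<gamma>(3) by (auto simp: algebra_simps)
    ultimately show ?thesis using that[of "\<gamma> u"] image_subset_iff[THEN iffD1, OF \<gamma>(1)] u(1) by blast
  qed
qed

text \<open>Finitely many relatively compact open sets cover the compact ball. By Lebesgue's number lemma
  their union contains a uniform neighbourhood of the ball, hence a larger ball, since a geodesic
  from the centre to a point of the larger ball passes through the smaller one.\<close>

lemma compactin_mcball_enlarge:
  assumes "locally_compact_space (mtopology_of X)" "geodesic_metric X"
    and e: "e \<in> mspace X" and "0 \<le> r" and K: "compactin (mtopology_of X) (mcball_of X e r)"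
  shows "\<exists>\<delta>>0. compactin (mtopology_of X) (mcball_of X e (r + \<delta>))"
proof -
  interpret Metric_space "mspace X" "mdist X" by simp
  have top: "mtopology_of X = mtopology" by (simp add: mtopology_of_def)
  have ball: "mcball_of X = mcball" by (simp add: mcball_of_def fun_eq_iff)
  let ?K = "mcball e r"
  have "\<forall>x\<in>mspace X. \<exists>U C. openin mtopology U \<and> compactin mtopology C \<and> x \<in> U \<and> U \<subseteq> C"
    using assms(1) unfolding locally_compact_space_def top by simp
  then obtain U C where UC: "\<And>x. x \<in> mspace X \<Longrightarrow>
      openin mtopology (U x) \<and> compactin mtopology (C x) \<and> x \<in> U x \<and> U x \<subseteq> C x"
    by metis
  have "?K \<subseteq> \<Union>(U ` ?K)" "\<And>V. V \<in> U ` ?K \<Longrightarrow> openin mtopology V"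
    using UC by auto
  then have "\<exists>F. finite F \<and> F \<subseteq> U ` ?K \<and> ?K \<subseteq> \<Union>F"
    using compactinD[OF K[unfolded top ball], of "U ` ?K"] by blast
  then obtain F where F: "finite F" "F \<subseteq> ?K" "?K \<subseteq> (\<Union>x\<in>F. U x)"
    by (metis finite_subset_image)
  define W where "W = (\<Union>x\<in>F. U x)"
  have W: "openin mtopology W" "W \<subseteq> (\<Union>x\<in>F. C x)"
    unfolding W_def subgoal using F(2) UC by (intro openin_Union) auto
    subgoal using F(2) UC by fastforce
    done
  have CC: "compactin mtopology (\<Union>x\<in>F. C x)"
    using F(1,2) UC by (intro compactin_Union) auto
  obtain \<epsilon> where \<epsilon>: "\<epsilon> > 0" "\<And>x. x \<in> ?K \<Longrightarrow> mball x \<epsilon> \<subseteq> W"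
    using lebesgue_number[of ?K "{W}"] K[unfolded top ball] F(3) W(1) W_def by auto
  have "mcball e (r + \<epsilon>/2) \<subseteq> W"
  proof
    fix y assume y: "y \<in> mcball e (r + \<epsilon>/2)"
    show "y \<in> W"
    proof (cases "mdist X e y \<le> r")
      case True
      then show ?thesis using \<epsilon> y by (meson centre_in_mball_iff in_mcball subsetD)
    next
      case False
      obtain z where z: "z \<in> mspace X" "mdist X e z = r" "mdist X z y = mdist X e y - r"
        using geodesic_point_at_distance[OF assms(2) e, of y r] y False \<open>0 \<le> r\<close> by auto
      then have "y \<in> mball z \<epsilon>" using y \<epsilon>(1) by auto
      then show ?thesis using \<epsilon>(2)[of z] z e by auto
    qed
  qed
  then have "compactin mtopology (mcball e (r + \<epsilon>/2))"
    using closed_compactin[OF CC] W(2) by (meson closedin_mcball order_trans)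
  then show ?thesis
    unfolding top ball using \<epsilon>(1) by (intro exI[of _ "\<epsilon>/2"]) auto
qed

text \<open>Every point of the ball is close to a point of a slightly smaller ball, again along a geodesic,
  so total boundedness passes to the limit radius, and completeness turns it into compactness.\<close>

lemma compactin_mcball_limit:
  assumes "mcomplete_of X" "geodesic_metric X"
    and e: "e \<in> mspace X" and "0 < r"
    and K: "\<And>s. 0 \<le> s \<Longrightarrow> s < r \<Longrightarrow> compactin (mtopology_of X) (mcball_of X e s)"
  shows "compactin (mtopology_of X) (mcball_of X e r)"
proof -
  interpret Metric_space "mspace X" "mdist X" by simp
  have top: "mtopology_of X = mtopology" by (simp add: mtopology_of_def)
  have ball: "mcball_of X = mcball" by (simp add: mcball_of_def fun_eq_iff)
  have compl: mcomplete using assms(1) by (simp add: mcomplete_of_def)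
  have "mtotally_bounded (mcball e r)"
    unfolding mtotally_bounded_def
  proof (intro allI impI)
    fix \<epsilon> :: real assume \<epsilon>: "\<epsilon> > 0"
    define s where "s = max 0 (r - \<epsilon>/2)"
    have s: "0 \<le> s" "s < r" "r - \<epsilon>/2 \<le> s" using \<epsilon> \<open>0 < r\<close> by (auto simp: s_def)
    have "mtotally_bounded (mcball e s)"
      using K[OF s(1,2)] compactin_imp_mtotally_bounded by (simp add: top ball)
    then obtain F where F: "finite F" "F \<subseteq> mcball e s" "mcball e s \<subseteq> (\<Union>x\<in>F. mball x (\<epsilon>/2))"
      unfolding mtotally_bounded_def using \<epsilon> half_gt_zero by metis
    have "mcball e r \<subseteq> (\<Union>x\<in>F. mball x \<epsilon>)"
    proof
      fix y assume y: "y \<in> mcball e r"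
      have "\<exists>z\<in>mcball e s. mdist X z y \<le> \<epsilon>/2"
      proof (cases "mdist X e y \<le> s")
        case True
        then show ?thesis using y \<epsilon> by (intro bexI[of _ y]) auto
      next
        case False
        obtain z where z: "z \<in> mspace X" "mdist X e z = s" "mdist X z y = mdist X e y - s"
          using geodesic_point_at_distance[OF assms(2) e, of y s] y False s by auto
        then show ?thesis using y s e by (intro bexI[of _ z]) auto
      qed
      then obtain z where z: "z \<in> mcball e s" "mdist X z y \<le> \<epsilon>/2" by blast
      then obtain x where x: "x \<in> F" "z \<in> mball x (\<epsilon>/2)" using F by blast
      have "mdist X x y \<le> mdist X x z + mdist X z y"
        using x y z by (intro triangle) auto
      then have "y \<in> mball x \<epsilon>" using x y z by auto
      then show "y \<in> (\<Union>x\<in>F. mball x \<epsilon>)" using x by blast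
    qed
    moreover have "F \<subseteq> mcball e r" using F(2) s by auto
    ultimately show "\<exists>K. finite K \<and> K \<subseteq> mcball e r \<and> mcball e r \<subseteq> (\<Union>x\<in>K. mball x \<epsilon>)"
      using F(1) by blast
  qed
  then have "compactin mtopology (mtopology closure_of mcball e r)"
    using mtotally_bounded_eq_compact_closure_of[OF compl] by blast
  then show ?thesis
    by (simp add: top ball closure_of_closedin)
qed

text \<open>The Hopf--Rinow theorem. The radii of compact balls form an interval that is
  closed by completeness and open by local compactness; geodesics are what compares a ball with
  a slightly smaller one.\<close>

theorem hopf_rinow_compactin_mcball:
  assumes "mcomplete_of X" "locally_compact_space (mtopology_of X)" "geodesic_metric X"
    and e: "e \<in> mspace X"
  shows "compactin (mtopology_of X) (mcball_of X e r)"
proof (rule ccontr)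
  interpret Metric_space "mspace X" "mdist X" by simp
  have top: "mtopology_of X = mtopology" by (simp add: mtopology_of_def)
  have ball: "mcball_of X = mcball" by (simp add: mcball_of_def fun_eq_iff)
  have mono: "compactin mtopology (mcball e s)" if "compactin mtopology (mcball e t)" "s \<le> t" for s t
    using closed_compactin[OF that(1)] that(2) by (meson closedin_mcball mcball_subset_concentric)
  assume n: "\<not> ?thesis"
  define S where "S = {t. 0 \<le> t \<and> compactin mtopology (mcball e t)}"
  have ub: "t \<le> r" if "t \<in> S" for t
    using that n mono[of t r] unfolding S_def top ball by force
  have "mcball e 0 = {e}" using e by (auto, metis antisym nonneg zero)
  then have 0: "0 \<in> S" using e by (simp add: S_def)
  have bdd: "bdd_above S" using ub by (auto simp: bdd_above_def)
  define R where "R = Sup S"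
  have R0: "0 \<le> R" unfolding R_def using 0 bdd by (rule cSup_upper)
  have RS: "R \<in> S"
  proof (cases "R = 0")
    case False
    have "compactin mtopology (mcball e s)" if s: "0 \<le> s" "s < R" for s
    proof -
      obtain t where "t \<in> S" "s < t"
        using s(2) less_cSup_iff[of S s] 0 bdd by (auto simp: R_def)
      then show ?thesis using mono[of t s] s by (auto simp: S_def)
    qed
    then have "compactin mtopology (mcball e R)"
      using compactin_mcball_limit[OF assms(1,3) e, of R] False R0 unfolding top ball by simp
    then show ?thesis using R0 by (simp add: S_def)
  qed (use 0 in simp)
  then obtain \<delta> where "\<delta> > 0" "compactin mtopology (mcball e (R + \<delta>))"
    using compactin_mcball_enlarge[OF assms(2,3) e R0] unfolding top ball S_def by auto
  then have "R + \<delta> \<in> S" using R0 by (simp add: S_def)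
  then have "R + \<delta> \<le> R" unfolding R_def using bdd by (intro cSup_upper)
  then show False using \<open>\<delta> > 0\<close> by simp
qed

section \<open>Sums of measures\<close>

definition measure_plus :: "'a measure \<Rightarrow> 'a measure \<Rightarrow> 'a measure" where
  "measure_plus M N = measure_of (space M) (sets M) (\<lambda>A. emeasure M A + emeasure N A)"

lemma sets_measure_plus [simp, measurable_cong]: "sets (measure_plus M N) = sets M"
  by (simp add: measure_plus_def)

lemma space_measure_plus [simp]: "space (measure_plus M N) = space M"
  by (simp add: measure_plus_def)

lemma emeasure_measure_plus:
  assumes "sets N = sets M" "A \<in> sets M"
  shows "emeasure (measure_plus M N) A = emeasure M A + emeasure N A"
proof (rule emeasure_measure_of[OF measure_plus_def])
  show "sets M \<subseteq> Pow (space M)" by (rule sets.space_closed)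
  show "A \<in> sets (measure_plus M N)" using assms by simp
  show "positive (sets (measure_plus M N)) (\<lambda>A. emeasure M A + emeasure N A)"
    by (simp add: positive_def)
  show "countably_additive (sets (measure_plus M N)) (\<lambda>A. emeasure M A + emeasure N A)"
    using assms(1) by (auto simp: countably_additive_def suminf_add[symmetric] suminf_emeasure)
qed

lemma finite_measure_measure_plus:
  assumes "sets N = sets M" "finite_measure M" "finite_measure N"
  shows "finite_measure (measure_plus M N)"
proof
  have "space N = space M" using assms(1) by (rule sets_eq_imp_space_eq)
  then show "emeasure (measure_plus M N) (space (measure_plus M N)) \<noteq> \<infinity>"
    using finite_measure.emeasure_finite[OF assms(2)] finite_measure.emeasure_finite[OF assms(3)]
    by (simp add: emeasure_measure_plus[OF assms(1)])
qed

lemma nn_integral_measure_plus: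
  assumes sets: "sets N = sets M" and "f \<in> borel_measurable M"
  shows "(\<integral>\<^sup>+x. f x \<partial>measure_plus M N) = (\<integral>\<^sup>+x. f x \<partial>M) + (\<integral>\<^sup>+x. f x \<partial>N)"
proof -
  have meas: "measurable N borel = measurable M (borel :: ennreal measure)"
    "measurable (measure_plus M N) borel = measurable M (borel :: ennreal measure)"
    by (rule measurable_cong_sets[OF sets refl], rule measurable_cong_sets[OF sets_measure_plus refl])
  from assms(2) show ?thesis
  proof (induction rule: borel_measurable_induct)
    case (cong f g)
    have "space N = space M" using sets by (rule sets_eq_imp_space_eq)
    then have "integral\<^sup>N K f = integral\<^sup>N K g" if "K \<in> {M, N, measure_plus M N}" for K
      using cong(3) that by (intro nn_integral_cong) auto
    then show ?case using cong by simp
  next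
    case (set A)
    then show ?case using sets by (simp add: emeasure_measure_plus)
  next
    case (mult u c)
    then have [measurable]: "u \<in> borel_measurable M" "u \<in> borel_measurable N" "u \<in> borel_measurable (measure_plus M N)"
      by (auto simp: meas)
    show ?case using mult by (simp add: nn_integral_cmult distrib_left)
  next
    case (add u v)
    then have [measurable]: "u \<in> borel_measurable N" "u \<in> borel_measurable (measure_plus M N)"
       "v \<in> borel_measurable N" "v \<in> borel_measurable (measure_plus M N)"
      by (auto simp: meas)
    show ?case using add by (simp add: nn_integral_add ac_simps)
  next
    case (seq U)
    then have m: "\<And>i. U i \<in> borel_measurable N" "\<And>i. U i \<in> borel_measurable (measure_plus M N)"
      by (auto simp: meas)
    have inc: "incseq (\<lambda>i. integral\<^sup>N M' (U i))" for M' :: "'a measure"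
      using seq(3) by (auto simp: incseq_def le_fun_def intro!: nn_integral_mono)
    have "(\<integral>\<^sup>+x. (SUP i. U i) x \<partial>M') = (SUP i. integral\<^sup>N M' (U i))"
      if "\<And>i. U i \<in> borel_measurable M'" for M'
      using nn_integral_monotone_convergence_SUP[OF seq(3)] that by (simp add: image_comp)
    then show ?case
      using seq m ennreal_SUP_add[OF inc[of M] inc[of N]] by simp
  qed
qed

lemma integrable_measure_plus_iff:
  fixes f :: "'a \<Rightarrow> real"
  assumes "sets N = sets M"
  shows "integrable (measure_plus M N) f \<longleftrightarrow> integrable M f \<and> integrable N f"
proof -
  have "f \<in> borel_measurable N \<longleftrightarrow> f \<in> borel_measurable M"
    "f \<in> borel_measurable (measure_plus M N) \<longleftrightarrow> f \<in> borel_measurable M"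
    using assms measurable_cong_sets[of N M borel borel]
      measurable_cong_sets[of "measure_plus M N" M borel borel] by auto
  then show ?thesis
    by (auto simp: integrable_iff_bounded nn_integral_measure_plus[OF assms])
qed

lemma integral_measure_plus:
  fixes f :: "'a \<Rightarrow> real"
  assumes sets: "sets N = sets M" and M: "integrable M f" and N: "integrable N f"
  shows "(LINT x|measure_plus M N. f x) = (LINT x|M. f x) + (LINT x|N. f x)"
proof -
  have m: "f \<in> borel_measurable M" using M by simp
  have fin: "(\<integral>\<^sup>+x. ennreal (g x) \<partial>K) < \<infinity>"
    if "integrable K f" "g = f \<or> g = (\<lambda>x. - f x)" for g K
  proof -
    have "(\<integral>\<^sup>+x. ennreal (g x) \<partial>K) \<le> (\<integral>\<^sup>+x. ennreal (norm (f x)) \<partial>K)"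
      using that(2) by (intro nn_integral_mono) (auto intro!: ennreal_leI)
    then show ?thesis using that(1) by (auto simp: integrable_iff_bounded)
  qed
  have "enn2real (\<integral>\<^sup>+x. ennreal (g x) \<partial>measure_plus M N)
      = enn2real (\<integral>\<^sup>+x. ennreal (g x) \<partial>M) + enn2real (\<integral>\<^sup>+x. ennreal (g x) \<partial>N)"
    if g: "g = f \<or> g = (\<lambda>x. - f x)" for g
    using m g fin[OF M g] fin[OF N g]
    by (subst nn_integral_measure_plus[OF sets]) (auto intro!: enn2real_plus)
  then show ?thesis
    using M N integrable_measure_plus_iff[OF sets] by (simp add: real_lebesgue_integral_def)
qed

section \<open>The Jordan decomposition\<close>

lemma space_mborel [simp]: "space (mborel X) = mspace X"
  unfolding mborel_def by (rule space_measure_of) (auto dest!: openin_subset)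

lemma openin_sets_mborel: "openin (mtopology_of X) U \<Longrightarrow> U \<in> sets (mborel X)"
  unfolding mborel_def by (subst sets_measure_of) (auto dest!: openin_subset)

lemma closedin_sets_mborel: "closedin (mtopology_of X) C \<Longrightarrow> C \<in> sets (mborel X)"
  using openin_sets_mborel[of X "mspace X - C"] sets.compl_sets[of "mspace X - C" "mborel X"]
  by (auto simp: closedin_def double_diff)

lemma continuous_map_borel_measurable:
  assumes "continuous_map (mtopology_of X) euclideanreal f"
  shows "f \<in> borel_measurable (mborel X)"
proof (rule borel_measurableI)
  fix S :: "real set" assume "open S"
  then have "openin (mtopology_of X) {x \<in> topspace (mtopology_of X). f x \<in> S}"
    using assms by (intro openin_continuous_map_preimage) auto
  also have "{x \<in> topspace (mtopology_of X). f x \<in> S} = f -` S \<inter> space (mborel X)" by auto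
  finally show "f -` S \<inter> space (mborel X) \<in> sets (mborel X)" by (rule openin_sets_mborel)
qed

lemma signed_measures_sums:
  "\<mu> \<in> signed_measures X \<Longrightarrow> range A \<subseteq> sets (mborel X) \<Longrightarrow> disjoint_family A \<Longrightarrow>
    (\<lambda>i::nat. \<mu> (A i)) sums \<mu> (\<Union>i. A i)"
  by (simp add: signed_measures_def)

lemma signed_measures_notin_sets:
  "\<mu> \<in> signed_measures X \<Longrightarrow> A \<notin> sets (mborel X) \<Longrightarrow> \<mu> A = 0"
  by (simp add: signed_measures_def)

lemma signed_measures_empty:
  assumes "\<mu> \<in> signed_measures X"
  shows "\<mu> {} = 0"
proof -
  have "(\<lambda>i::nat. \<mu> {}) sums \<mu> (\<Union>i::nat. {})"
    using signed_measures_sums[OF assms, of "\<lambda>_. {}"] by (simp add: disjoint_family_on_def)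
  then show ?thesis using summable_LIMSEQ_zero sums_summable LIMSEQ_const_iff by blast
qed

lemma signed_measures_Un:
  assumes "\<mu> \<in> signed_measures X" "A \<in> sets (mborel X)" "B \<in> sets (mborel X)" "A \<inter> B = {}"
  shows "\<mu> (A \<union> B) = \<mu> A + \<mu> B"
proof -
  have "(\<lambda>i. \<mu> (binaryset A B i)) sums \<mu> (\<Union>i. binaryset A B i)"
    using assms by (intro signed_measures_sums)
      (auto simp: range_binaryset_eq disjoint_family_on_def binaryset_def)
  then show ?thesis
    using sums_unique2 binaryset_sums[of \<mu> A B] signed_measures_empty[OF assms(1)]
    by (metis UN_binaryset_eq)
qed

lemma signed_measures_Int_Diff:
  assumes "\<mu> \<in> signed_measures X" "A \<in> sets (mborel X)" "B \<in> sets (mborel X)"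
  shows "\<mu> A = \<mu> (A \<inter> B) + \<mu> (A - B)"
  using signed_measures_Un[OF assms(1), of "A \<inter> B" "A - B"] assms(2,3)
  by (simp add: Int_Diff_Un Int_Diff_disjoint)

text \<open>If values on subsets of a set were unbounded, one could split off a subset of measure
  larger than 1 in absolute value so that the values on the rest remain unbounded;
  countable additivity on the pieces obtained in this way would fail.\<close>

lemma signed_measures_bounded:
  assumes \<mu>: "\<mu> \<in> signed_measures X"
  shows "\<exists>c. \<forall>B\<in>sets (mborel X). \<bar>\<mu> B\<bar> \<le> c"
proof (rule ccontr)
  let ?S = "sets (mborel X)"
  define unb where "unb E \<longleftrightarrow> E \<in> ?S \<and> (\<forall>c. \<exists>B\<in>?S. B \<subseteq> E \<and> \<bar>\<mu> B\<bar> > c)" for E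
  assume "\<not> ?thesis"
  then have "\<forall>c. \<exists>B\<in>?S. \<bar>\<mu> B\<bar> > c" by (meson not_le)
  then have start: "unb (mspace X)"
    unfolding unb_def using sets.sets_into_space[of _ "mborel X"] sets.top[of "mborel X"]
    by (metis space_mborel)
  have split: "unb B \<or> unb (E - B)" if E: "unb E" and B: "B \<in> ?S" "B \<subseteq> E" for E B
  proof (rule ccontr)
    assume n: "\<not> ?thesis"
    have "E - B \<in> ?S" using E B by (auto simp: unb_def)
    then obtain c1 c2 where c: "\<And>C. C \<in> ?S \<Longrightarrow> C \<subseteq> B \<Longrightarrow> \<bar>\<mu> C\<bar> \<le> c1"
      "\<And>C. C \<in> ?S \<Longrightarrow> C \<subseteq> E - B \<Longrightarrow> \<bar>\<mu> C\<bar> \<le> c2"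
      using n B(1) unfolding unb_def by (metis not_le)
    have "\<bar>\<mu> C\<bar> \<le> c1 + c2" if C: "C \<in> ?S" "C \<subseteq> E" for C
    proof -
      have "\<bar>\<mu> (C \<inter> B)\<bar> \<le> c1" "\<bar>\<mu> (C - B)\<bar> \<le> c2"
        using c(1)[of "C \<inter> B"] c(2)[of "C - B"] C B by auto
      then show ?thesis using signed_measures_Int_Diff[OF \<mu> C(1) B(1)] by linarith
    qed
    then show False using E unfolding unb_def by (meson not_le)
  qed
  have step: "\<exists>F. unb F \<and> F \<subseteq> E \<and> 1 < \<bar>\<mu> (E - F)\<bar>" if E: "unb E" for E
  proof -
    obtain B where B: "B \<in> ?S" "B \<subseteq> E" "\<bar>\<mu> B\<bar> > 1 + \<bar>\<mu> E\<bar>" using E by (auto simp: unb_def)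
    have "\<mu> E = \<mu> B + \<mu> (E - B)"
      using signed_measures_Int_Diff[OF \<mu>, of E B] E B by (auto simp: unb_def Int_absorb1)
    then have "1 < \<bar>\<mu> (E - B)\<bar>" "1 < \<bar>\<mu> (E - (E - B))\<bar>"
      using B by (auto simp: double_diff)
    then show ?thesis using split[OF E B(1,2)] B(2) by blast
  qed
  obtain E where E: "\<And>n. unb (E n)" "\<And>n. E (Suc n) \<subseteq> E n \<and> 1 < \<bar>\<mu> (E n - E (Suc n))\<bar>"
    using dependent_nat_choice[of "\<lambda>n. unb" "\<lambda>n E F. F \<subseteq> E \<and> 1 < \<bar>\<mu> (E - F)\<bar>"] start step by metis
  have dec: "E m \<subseteq> E n" if "n \<le> m" for n m
    using that E(2) by (metis lift_Suc_antimono_le)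
  have "disjoint_family (\<lambda>n. E n - E (Suc n))"
    unfolding disjoint_family_on_def
  proof (intro ballI impI)
    fix m n :: nat assume "m \<noteq> n"
    then have "Suc m \<le> n \<or> Suc n \<le> m" by linarith
    then show "(E m - E (Suc m)) \<inter> (E n - E (Suc n)) = {}" using dec by blast
  qed
  then have "(\<lambda>n. \<mu> (E n - E (Suc n))) sums \<mu> (\<Union>n. E n - E (Suc n))"
    using E(1) by (intro signed_measures_sums[OF \<mu>]) (auto simp: unb_def)
  then have "(\<lambda>n. \<mu> (E n - E (Suc n))) \<longlonglongrightarrow> 0" using summable_LIMSEQ_zero sums_summable by blast
  then have "\<forall>\<^sub>F n in sequentially. \<bar>\<mu> (E n - E (Suc n))\<bar> < 1"
    by (auto simp: tendsto_iff dist_real_def dest: spec[of _ 1])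
  then show False using E(2) by (meson eventually_sequentially le_refl less_asym)
qed

lemma uminus_signed_measures: "\<mu> \<in> signed_measures X \<Longrightarrow> (\<lambda>A. - \<mu> A) \<in> signed_measures X"
  by (auto simp: signed_measures_def intro: sums_minus)

text \<open>The terms may be negative, in which case they count as 0 on the right.\<close>

lemma ennreal_le_suminf_of_sums:
  assumes "f sums (s::real)"
  shows "ennreal s \<le> (\<Sum>i. ennreal (f i))"
proof (rule LIMSEQ_le_const2)
  show "(\<lambda>n. ennreal (\<Sum>i<n. f i)) \<longlonglongrightarrow> ennreal s"
    using assms by (intro tendsto_ennrealI) (simp add: sums_def)
  have "ennreal (\<Sum>i<n. f i) \<le> (\<Sum>i. ennreal (f i))" for n
  proof -
    have "ennreal (\<Sum>i<n. f i) \<le> ennreal (\<Sum>i<n. max 0 (f i))"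
      by (intro ennreal_leI sum_mono) simp
    also have "\<dots> = (\<Sum>i<n. ennreal (f i))"
      by (subst sum_ennreal[symmetric]) (auto simp: max_def ennreal_neg simp del: sum_ennreal intro!: sum.cong)
    also have "\<dots> \<le> (\<Sum>i. ennreal (f i))" by (intro sum_le_suminf) auto
    finally show ?thesis .
  qed
  then show "\<exists>N. \<forall>n\<ge>N. ennreal (\<Sum>i<n. f i) \<le> (\<Sum>i. ennreal (f i))" by blast
qed

lemma sets_jordan_pos [simp, measurable_cong]: "sets (jordan_pos X \<mu>) = sets (mborel X)"
  unfolding jordan_pos_def by (metis sets.sets_measure_of_eq space_mborel)

lemma space_jordan_pos [simp]: "space (jordan_pos X \<mu>) = mspace X"
  unfolding jordan_pos_def by (metis sets.space_measure_of_eq space_mborel)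

lemma sets_jordan_neg [simp, measurable_cong]: "sets (jordan_neg X \<mu>) = sets (mborel X)"
  by (simp add: jordan_neg_def)

lemma space_jordan_neg [simp]: "space (jordan_neg X \<mu>) = mspace X"
  by (simp add: jordan_neg_def)

text \<open>The supremum is superadditive on disjoint sets, since subsets of two disjoint sets can be united
  (a subset of negative measure is replaced by the empty set), and countably subadditive, since a
  subset of a union is cut into its traces on the pieces.\<close>

lemma emeasure_jordan_pos:
  assumes \<mu>: "\<mu> \<in> signed_measures X" and A: "A \<in> sets (mborel X)"
  shows "emeasure (jordan_pos X \<mu>) A = (SUP B \<in> {B \<in> sets (mborel X). B \<subseteq> A}. ennreal (\<mu> B))"
proof (rule emeasure_measure_of[OF jordan_pos_def])
  let ?S = "sets (mborel X)"
  let ?V = "\<lambda>A. SUP B \<in> {B \<in> ?S. B \<subseteq> A}. ennreal (\<mu> B)"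
  show "?S \<subseteq> Pow (mspace X)" using sets.space_closed[of "mborel X"] by simp
  show "A \<in> sets (jordan_pos X \<mu>)" using A by simp
  have "?V {} = (SUP B \<in> {{}}. ennreal (\<mu> B))" by (rule SUP_cong) auto
  then show "positive (sets (jordan_pos X \<mu>)) ?V"
    using signed_measures_empty[OF \<mu>] by (simp add: positive_def)
  have add: "?V A + ?V B \<le> ?V (A \<union> B)" if AB: "A \<inter> B = {}" for A B
  proof -
    have ne: "{C \<in> ?S. C \<subseteq> A} \<noteq> {}" "{D \<in> ?S. D \<subseteq> B} \<noteq> {}" by auto
    have "ennreal (\<mu> C) + ennreal (\<mu> D) \<le> ?V (A \<union> B)"
      if C: "C \<in> ?S" "C \<subseteq> A" and D: "D \<in> ?S" "D \<subseteq> B" for C D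
    proof (cases "0 \<le> \<mu> C \<and> 0 \<le> \<mu> D")
      case True
      have "\<mu> (C \<union> D) = \<mu> C + \<mu> D" using C D AB by (intro signed_measures_Un[OF \<mu>]) auto
      then have "ennreal (\<mu> C) + ennreal (\<mu> D) = ennreal (\<mu> (C \<union> D))"
        using True by simp
      also have "\<dots> \<le> ?V (A \<union> B)" using C D by (intro SUP_upper) auto
      finally show ?thesis .
    next
      case False
      then have "ennreal (\<mu> C) + ennreal (\<mu> D) = ennreal (\<mu> C) \<or>
          ennreal (\<mu> C) + ennreal (\<mu> D) = ennreal (\<mu> D)"
        by (auto simp: ennreal_neg)
      moreover have "ennreal (\<mu> C) \<le> ?V (A \<union> B)" "ennreal (\<mu> D) \<le> ?V (A \<union> B)"
        using C D by (auto intro!: SUP_upper)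
      ultimately show ?thesis by auto
    qed
    then show ?thesis
      unfolding ennreal_SUP_add_left[OF ne(1), symmetric] ennreal_SUP_add_right[OF ne(2)]
      by (intro SUP_least) auto
  qed
  show "countably_additive (sets (jordan_pos X \<mu>)) ?V"
    unfolding countably_additive_def sets_jordan_pos
  proof (intro allI impI antisym)
    fix A :: "nat \<Rightarrow> 'a set"
    assume A: "range A \<subseteq> ?S" "disjoint_family A" "(\<Union>i. A i) \<in> ?S"
    have disj: "(\<Union>i<n. A i) \<inter> A n = {}" for n
    proof -
      have "A i \<inter> A n = {}" if "i < n" for i
        using A(2) that by (simp add: disjoint_family_on_def)
      then show ?thesis by blast
    qed
    have part: "(\<Sum>i<n. ?V (A i)) \<le> ?V (\<Union>i<n. A i)" for n
    proof (induction n)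
      case (Suc n)
      have "(\<Sum>i<Suc n. ?V (A i)) \<le> ?V (\<Union>i<n. A i) + ?V (A n)"
        using Suc by (simp add: add_right_mono)
      also have "\<dots> \<le> ?V ((\<Union>i<n. A i) \<union> A n)"
        using disj by (rule add)
      also have "(\<Union>i<n. A i) \<union> A n = (\<Union>i<Suc n. A i)" by (auto simp: lessThan_Suc)
      finally show ?case .
    qed simp
    have "?V (\<Union>i<n. A i) \<le> ?V (\<Union>i. A i)" for n
      by (rule SUP_subset_mono) auto
    then have "(\<Sum>i<n. ?V (A i)) \<le> ?V (\<Union>i. A i)" for n
      using part[of n] by (rule order_trans[rotated])
    then show "(\<Sum>i. ?V (A i)) \<le> ?V (\<Union>i. A i)"
      by (intro suminf_le_const) auto
    show "?V (\<Union>i. A i) \<le> (\<Sum>i. ?V (A i))"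
    proof (intro SUP_least)
      fix B assume "B \<in> {B \<in> ?S. B \<subseteq> (\<Union>i. A i)}"
      then have B: "B \<in> ?S" "B = (\<Union>i. B \<inter> A i)" by auto
      have "(\<lambda>i. \<mu> (B \<inter> A i)) sums \<mu> (\<Union>i. B \<inter> A i)"
        using A(1,2) B(1) by (intro signed_measures_sums[OF \<mu>]) (auto simp: disjoint_family_on_def)
      then have "ennreal (\<mu> B) \<le> (\<Sum>i. ennreal (\<mu> (B \<inter> A i)))"
        using ennreal_le_suminf_of_sums B(2) by metis
      also have "\<dots> \<le> (\<Sum>i. ?V (A i))"
        using A(1) B(1) by (intro suminf_le SUP_upper) auto
      finally show "ennreal (\<mu> B) \<le> (\<Sum>i. ?V (A i))" .
    qed
  qed
qed

lemma finite_measure_jordan_pos: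
  assumes \<mu>: "\<mu> \<in> signed_measures X"
  shows "finite_measure (jordan_pos X \<mu>)"
proof
  obtain c where c: "\<And>B. B \<in> sets (mborel X) \<Longrightarrow> \<bar>\<mu> B\<bar> \<le> c"
    using signed_measures_bounded[OF \<mu>] by blast
  have "mspace X \<in> sets (mborel X)" using sets.top[of "mborel X"] by simp
  have "emeasure (jordan_pos X \<mu>) (mspace X) \<le> ennreal c"
    using c unfolding emeasure_jordan_pos[OF \<mu> \<open>mspace X \<in> _\<close>] by (intro SUP_least ennreal_leI) (auto simp: abs_le_iff)
  then show "emeasure (jordan_pos X \<mu>) (space (jordan_pos X \<mu>)) \<noteq> \<infinity>"
    using neq_top_trans[OF ennreal_neq_top] by auto
qed

lemma finite_measure_jordan_neg:
  "\<mu> \<in> signed_measures X \<Longrightarrow> finite_measure (jordan_neg X \<mu>)"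
  unfolding jordan_neg_def by (intro finite_measure_jordan_pos uminus_signed_measures)

lemma jordan_pos_upper:
  assumes "\<mu> \<in> signed_measures X" "A \<in> sets (mborel X)" "B \<in> sets (mborel X)" "B \<subseteq> A"
  shows "\<mu> B \<le> measure (jordan_pos X \<mu>) A"
proof -
  have "ennreal (\<mu> B) \<le> ennreal (measure (jordan_pos X \<mu>) A)"
    unfolding finite_measure.emeasure_eq_measure[OF finite_measure_jordan_pos[OF assms(1)], symmetric]
      emeasure_jordan_pos[OF assms(1,2)] using assms(3,4) by (intro SUP_upper) auto
  then show ?thesis by simp
qed

lemma jordan_pos_least:
  assumes "\<mu> \<in> signed_measures X" "A \<in> sets (mborel X)" "0 \<le> c"
    "\<And>B. B \<in> sets (mborel X) \<Longrightarrow> B \<subseteq> A \<Longrightarrow> \<mu> B \<le> c"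
  shows "measure (jordan_pos X \<mu>) A \<le> c"
proof -
  have "ennreal (measure (jordan_pos X \<mu>) A) \<le> ennreal c"
    unfolding finite_measure.emeasure_eq_measure[OF finite_measure_jordan_pos[OF assms(1)], symmetric]
      emeasure_jordan_pos[OF assms(1,2)] using assms(4) by (intro SUP_least ennreal_leI) auto
  then show ?thesis using assms(3) by simp
qed

text \<open>Passing from a subset \<open>B\<close> to \<open>A - B\<close> exchanges the two suprema up to the constant \<open>\<mu> A\<close>.\<close>

lemma jordan_decomposition:
  assumes \<mu>: "\<mu> \<in> signed_measures X" and A: "A \<in> sets (mborel X)"
  shows "\<mu> A = measure (jordan_pos X \<mu>) A - measure (jordan_neg X \<mu>) A"
proof -
  have half: "measure (jordan_pos X \<nu>) A \<le> \<nu> A + measure (jordan_neg X \<nu>) A"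
    if \<nu>: "\<nu> \<in> signed_measures X" for \<nu>
  proof (rule jordan_pos_least[OF \<nu> A])
    note up = jordan_pos_upper[OF uminus_signed_measures[OF \<nu>] A, folded jordan_neg_def]
    show "0 \<le> \<nu> A + measure (jordan_neg X \<nu>) A" using up[OF A] by simp
    fix B assume B: "B \<in> sets (mborel X)" "B \<subseteq> A"
    have "\<nu> A = \<nu> B + \<nu> (A - B)"
      using signed_measures_Int_Diff[OF \<nu> A B(1)] B(2) by (simp add: Int_absorb1)
    then show "\<nu> B \<le> \<nu> A + measure (jordan_neg X \<nu>) A"
      using up[of "A - B"] A B by auto
  qed
  show ?thesis
    using half[OF \<mu>] half[OF uminus_signed_measures[OF \<mu>]] by (simp add: jordan_neg_def)
qed

section \<open>Total variation and integrals\<close>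

lemma jordan_pos_minimal:
  assumes \<mu>: "\<mu> \<in> signed_measures X"
    and M: "finite_measure M1" "finite_measure M2" "sets M1 = sets (mborel X)" "sets M2 = sets (mborel X)"
    and eq: "\<And>A. A \<in> sets (mborel X) \<Longrightarrow> \<mu> A = measure M1 A - measure M2 A"
    and A: "A \<in> sets (mborel X)"
  shows "emeasure (jordan_pos X \<mu>) A \<le> emeasure M1 A"
proof -
  have "measure (jordan_pos X \<mu>) A \<le> measure M1 A"
  proof (rule jordan_pos_least[OF \<mu> A])
    fix B assume B: "B \<in> sets (mborel X)" "B \<subseteq> A"
    have "\<mu> B \<le> measure M1 B" using eq[OF B(1)] by simp
    also have "\<dots> \<le> measure M1 A"
      using M A B by (intro finite_measure.finite_measure_mono) auto
    finally show "\<mu> B \<le> measure M1 A" .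
  qed simp
  then show ?thesis
    using finite_measure.emeasure_eq_measure[OF finite_measure_jordan_pos[OF \<mu>]]
      finite_measure.emeasure_eq_measure[OF M(1)] by (simp add: ennreal_leI)
qed

lemma nn_integral_mono_emeasure:
  assumes "sets M = sets N" "\<And>A. A \<in> sets M \<Longrightarrow> emeasure M A \<le> emeasure N A"
  shows "(\<integral>\<^sup>+x. f x \<partial>M) \<le> (\<integral>\<^sup>+x. f x \<partial>N)"
  using assms by (intro nn_integral_mono_measure) (auto simp: le_measure)

lemma total_variation_eq: "total_variation X \<mu> = measure_plus (jordan_pos X \<mu>) (jordan_neg X \<mu>)"
  by (simp add: total_variation_def measure_plus_def)

lemma sets_total_variation [simp, measurable_cong]: "sets (total_variation X \<mu>) = sets (mborel X)"
  by (simp add: total_variation_eq)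

lemma space_total_variation [simp]: "space (total_variation X \<mu>) = mspace X"
  by (simp add: total_variation_eq)

lemma finite_measure_total_variation:
  "\<mu> \<in> signed_measures X \<Longrightarrow> finite_measure (total_variation X \<mu>)"
  unfolding total_variation_eq
  by (intro finite_measure_measure_plus finite_measure_jordan_pos finite_measure_jordan_neg) auto

lemma nn_integral_total_variation:
  assumes "f \<in> borel_measurable (mborel X)"
  shows "(\<integral>\<^sup>+x. f x \<partial>total_variation X \<mu>)
    = (\<integral>\<^sup>+x. f x \<partial>jordan_pos X \<mu>) + (\<integral>\<^sup>+x. f x \<partial>jordan_neg X \<mu>)"
  unfolding total_variation_eq using assms
  by (intro nn_integral_measure_plus) (auto cong: measurable_cong_sets)

lemma integrable_total_variation_iff:
  fixes f :: "'a \<Rightarrow> real"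
  shows "integrable (total_variation X \<mu>) f \<longleftrightarrow>
    integrable (jordan_pos X \<mu>) f \<and> integrable (jordan_neg X \<mu>) f"
  unfolding total_variation_eq by (intro integrable_measure_plus_iff) simp

text \<open>The Jordan decomposition is the smallest way of writing a signed measure as a difference
  of two measures; every other one bounds the total variation and computes the same integrals.\<close>

lemma nn_integral_total_variation_le:
  assumes \<mu>: "\<mu> \<in> signed_measures X"
    and M: "finite_measure M1" "finite_measure M2" "sets M1 = sets (mborel X)" "sets M2 = sets (mborel X)"
    and eq: "\<And>A. A \<in> sets (mborel X) \<Longrightarrow> \<mu> A = measure M1 A - measure M2 A"
    and f: "f \<in> borel_measurable (mborel X)"
  shows "(\<integral>\<^sup>+x. f x \<partial>total_variation X \<mu>) \<le> (\<integral>\<^sup>+x. f x \<partial>M1) + (\<integral>\<^sup>+x. f x \<partial>M2)"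
  unfolding nn_integral_total_variation[OF f]
proof (intro add_mono nn_integral_mono_emeasure)
  fix A assume A: "A \<in> sets (jordan_pos X \<mu>)"
  then show "emeasure (jordan_pos X \<mu>) A \<le> emeasure M1 A"
    using jordan_pos_minimal[OF \<mu> M eq] by simp
next
  fix A assume A: "A \<in> sets (jordan_neg X \<mu>)"
  then show "emeasure (jordan_neg X \<mu>) A \<le> emeasure M2 A"
    unfolding jordan_neg_def
    using jordan_pos_minimal[OF uminus_signed_measures[OF \<mu>] M(2,1,4,3)] eq by simp
qed (use M in simp_all)

text \<open>If \<open>P - N = M1 - M2\<close> for finite measures, then \<open>P + M2 = M1 + N\<close> as measures, and integrals over
  sums of measures add.\<close>

lemma signed_integral_eq_diff:
  assumes \<mu>: "\<mu> \<in> signed_measures X"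
    and M: "finite_measure M1" "finite_measure M2" "sets M1 = sets (mborel X)" "sets M2 = sets (mborel X)"
    and eq: "\<And>A. A \<in> sets (mborel X) \<Longrightarrow> \<mu> A = measure M1 A - measure M2 A"
    and f: "integrable M1 f" "integrable M2 f"
  shows "integrable (total_variation X \<mu>) f"
    and "signed_integral X \<mu> f = (LINT x|M1. f x) - (LINT x|M2. f x)"
proof -
  have fm: "f \<in> borel_measurable (mborel X)"
    using f(1) measurable_cong_sets[OF M(3) refl] by auto
  then have nm: "(\<lambda>x. ennreal (norm (f x))) \<in> borel_measurable (mborel X)" by simp
  have "(\<integral>\<^sup>+x. ennreal (norm (f x)) \<partial>total_variation X \<mu>) < \<infinity>"
    using nn_integral_total_variation_le[OF \<mu> M eq nm] f
    by (auto simp: integrable_iff_bounded order_le_less_trans)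
  then show int: "integrable (total_variation X \<mu>) f"
    using fm by (auto simp: integrable_iff_bounded cong: measurable_cong_sets)
  let ?P = "jordan_pos X \<mu>" and ?N = "jordan_neg X \<mu>"
  have PN: "integrable ?P f" "integrable ?N f"
    using int by (auto simp: integrable_total_variation_iff)
  have "measure_plus ?P M2 = measure_plus M1 ?N"
  proof (rule measure_eqI)
    fix A assume "A \<in> sets (measure_plus ?P M2)"
    then have A: "A \<in> sets (mborel X)" by simp
    have "measure ?P A + measure M2 A = measure M1 A + measure ?N A"
      using jordan_decomposition[OF \<mu> A] eq[OF A] by simp
    then show "emeasure (measure_plus ?P M2) A = emeasure (measure_plus M1 ?N) A"
      using A M finite_measure.emeasure_eq_measure[OF finite_measure_jordan_pos[OF \<mu>]]
        finite_measure.emeasure_eq_measure[OF finite_measure_jordan_neg[OF \<mu>]]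
        finite_measure.emeasure_eq_measure[OF M(1)] finite_measure.emeasure_eq_measure[OF M(2)]
      by (simp add: emeasure_measure_plus flip: ennreal_plus)
  qed (use M in simp)
  then have "(LINT x|?P. f x) + (LINT x|M2. f x) = (LINT x|M1. f x) + (LINT x|?N. f x)"
    using integral_measure_plus[of M2 ?P f] integral_measure_plus[of ?N M1 f] f PN M by simp
  then show "signed_integral X \<mu> f = (LINT x|M1. f x) - (LINT x|M2. f x)"
    by (simp add: signed_integral_def)
qed

lemma abs_signed_integral_le:
  assumes "integrable (total_variation X \<mu>) f"
  shows "\<bar>signed_integral X \<mu> f\<bar> \<le> (LINT x|total_variation X \<mu>. \<bar>f x\<bar>)"
proof -
  have PN: "integrable (jordan_pos X \<mu>) f" "integrable (jordan_neg X \<mu>) f"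
    using assms by (auto simp: integrable_total_variation_iff)
  have "(LINT x|total_variation X \<mu>. \<bar>f x\<bar>)
      = (LINT x|jordan_pos X \<mu>. \<bar>f x\<bar>) + (LINT x|jordan_neg X \<mu>. \<bar>f x\<bar>)"
    unfolding total_variation_eq using PN by (intro integral_measure_plus) auto
  then show ?thesis
    using integral_abs_bound[of "jordan_pos X \<mu>" f] integral_abs_bound[of "jordan_neg X \<mu>" f]
    unfolding signed_integral_def by linarith
qed

lemma signed_integral_add_fun:
  assumes "integrable (total_variation X \<mu>) f" "integrable (total_variation X \<mu>) g"
  shows "signed_integral X \<mu> (\<lambda>x. f x + g x) = signed_integral X \<mu> f + signed_integral X \<mu> g"
  using assms by (auto simp: integrable_total_variation_iff signed_integral_def)

lemma signed_integral_cmult_fun: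
  assumes "integrable (total_variation X \<mu>) f"
  shows "signed_integral X \<mu> (\<lambda>x. c * f x) = c * signed_integral X \<mu> f"
  using assms by (auto simp: integrable_total_variation_iff signed_integral_def right_diff_distrib)

lemma signed_integral_sum_fun:
  assumes "\<And>i. i \<in> I \<Longrightarrow> integrable (total_variation X \<mu>) (f i)"
  shows "signed_integral X \<mu> (\<lambda>x. \<Sum>i\<in>I. f i x) = (\<Sum>i\<in>I. signed_integral X \<mu> (f i))"
  using assms by (auto simp: integrable_total_variation_iff signed_integral_def sum_subtractf)

lemma signed_integral_const:
  assumes "\<mu> \<in> signed_measures X"
  shows "integrable (total_variation X \<mu>) (\<lambda>_. c)" "signed_integral X \<mu> (\<lambda>_. c) = c * \<mu> (mspace X)"
proof -
  interpret T: finite_measure "total_variation X \<mu>" by (rule finite_measure_total_variation[OF assms])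
  interpret P: finite_measure "jordan_pos X \<mu>" by (rule finite_measure_jordan_pos[OF assms])
  interpret N: finite_measure "jordan_neg X \<mu>" by (rule finite_measure_jordan_neg[OF assms])
  show "integrable (total_variation X \<mu>) (\<lambda>_. c)" by simp
  have "mspace X \<in> sets (mborel X)" using sets.top[of "mborel X"] by simp
  then show "signed_integral X \<mu> (\<lambda>_. c) = c * \<mu> (mspace X)"
    unfolding jordan_decomposition[OF assms \<open>mspace X \<in> _\<close>]
    by (simp add: signed_integral_def algebra_simps)
qed

lemma signed_integral_cong:
  assumes "\<And>x. x \<in> mspace X \<Longrightarrow> f x = g x"
  shows "signed_integral X \<mu> f = signed_integral X \<mu> g"
  unfolding signed_integral_def using assms
  by (metis Bochner_Integration.integral_cong space_jordan_pos space_jordan_neg)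

section \<open>The vector space of signed measures\<close>

lemma signed_measures_measure:
  assumes "finite_measure M" "sets M = sets (mborel X)"
  shows "measure M \<in> signed_measures X"
  using assms finite_measure.finite_measure_UNION[OF assms(1)]
  by (auto simp: signed_measures_def measure_notin_sets)

lemma signed_measures_add:
  "\<mu> \<in> signed_measures X \<Longrightarrow> \<nu> \<in> signed_measures X \<Longrightarrow> (\<lambda>A. \<mu> A + \<nu> A) \<in> signed_measures X"
  by (auto simp: signed_measures_def intro: sums_add)

lemma signed_measures_scale:
  "\<mu> \<in> signed_measures X \<Longrightarrow> (\<lambda>A. c * \<mu> A) \<in> signed_measures X"
  by (auto simp: signed_measures_def intro: sums_mult)

lemma signed_measures_zero: "(\<lambda>A. 0) \<in> signed_measures X"
  by (auto simp: signed_measures_def)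

lemma
  assumes \<mu>: "\<mu> \<in> signed_measures X" and \<nu>: "\<nu> \<in> signed_measures X"
  shows nn_integral_total_variation_add:
     "f \<in> borel_measurable (mborel X) \<Longrightarrow> (\<integral>\<^sup>+x. f x \<partial>total_variation X (\<lambda>A. \<mu> A + \<nu> A))
        \<le> (\<integral>\<^sup>+x. f x \<partial>total_variation X \<mu>) + (\<integral>\<^sup>+x. f x \<partial>total_variation X \<nu>)"
    and signed_integral_add:
     "integrable (total_variation X \<mu>) h \<Longrightarrow> integrable (total_variation X \<nu>) h \<Longrightarrow>
        signed_integral X (\<lambda>A. \<mu> A + \<nu> A) h = signed_integral X \<mu> h + signed_integral X \<nu> h"
proof -
  define M1 where "M1 = measure_plus (jordan_pos X \<mu>) (jordan_pos X \<nu>)"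
  define M2 where "M2 = measure_plus (jordan_neg X \<mu>) (jordan_neg X \<nu>)"
  have M: "finite_measure M1" "finite_measure M2" "sets M1 = sets (mborel X)" "sets M2 = sets (mborel X)"
    unfolding M1_def M2_def using \<mu> \<nu>
    by (auto intro!: finite_measure_measure_plus finite_measure_jordan_pos finite_measure_jordan_neg)
  have meas: "measure (measure_plus K L) A = measure K A + measure L A"
    if "finite_measure K" "finite_measure L" "sets K = sets (mborel X)" "sets L = sets (mborel X)"
      "A \<in> sets (mborel X)" for K L A
  proof (rule measure_eq_emeasure_eq_ennreal)
    show "emeasure (measure_plus K L) A = ennreal (measure K A + measure L A)"
      using that(3-5) by (simp add: emeasure_measure_plus finite_measure.emeasure_eq_measure[OF that(1)]
          finite_measure.emeasure_eq_measure[OF that(2)])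
  qed simp
  have eq: "\<mu> A + \<nu> A = measure M1 A - measure M2 A" if "A \<in> sets (mborel X)" for A
    using jordan_decomposition[OF \<mu> that] jordan_decomposition[OF \<nu> that] that \<mu> \<nu>
    by (simp add: M1_def M2_def meas finite_measure_jordan_pos finite_measure_jordan_neg)
  note s = signed_measures_add[OF \<mu> \<nu>]
  show "(\<integral>\<^sup>+x. f x \<partial>total_variation X (\<lambda>A. \<mu> A + \<nu> A))
        \<le> (\<integral>\<^sup>+x. f x \<partial>total_variation X \<mu>) + (\<integral>\<^sup>+x. f x \<partial>total_variation X \<nu>)"
    if f: "f \<in> borel_measurable (mborel X)"
  proof -
    have f': "f \<in> borel_measurable (jordan_pos X \<mu>)" "f \<in> borel_measurable (jordan_neg X \<mu>)"
      using f by auto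
    show ?thesis
      using nn_integral_total_variation_le[OF s M eq f]
      by (simp add: M1_def M2_def nn_integral_total_variation[OF f]
          nn_integral_measure_plus f' add_ac)
  qed
  have h1: "integrable M1 h" "integrable M2 h"
    if "integrable (total_variation X \<mu>) h" "integrable (total_variation X \<nu>) h"
    using that by (auto simp: M1_def M2_def integrable_measure_plus_iff integrable_total_variation_iff)
  show "signed_integral X (\<lambda>A. \<mu> A + \<nu> A) h = signed_integral X \<mu> h + signed_integral X \<nu> h"
    if h: "integrable (total_variation X \<mu>) h" "integrable (total_variation X \<nu>) h"
    using signed_integral_eq_diff(2)[OF s M eq h1[OF h]] h
    by (simp add: M1_def M2_def integral_measure_plus integrable_total_variation_iff signed_integral_def)
qed

lemma jordan_pos_scale:
  assumes \<mu>: "\<mu> \<in> signed_measures X" and c: "0 \<le> c"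
  shows "jordan_pos X (\<lambda>A. c * \<mu> A) = scale_measure (ennreal c) (jordan_pos X \<mu>)"
proof (rule measure_eqI)
  fix A assume "A \<in> sets (jordan_pos X (\<lambda>A. c * \<mu> A))"
  then have A: "A \<in> sets (mborel X)" by simp
  show "emeasure (jordan_pos X (\<lambda>A. c * \<mu> A)) A = emeasure (scale_measure (ennreal c) (jordan_pos X \<mu>)) A"
    using A c by (simp add: emeasure_jordan_pos[OF signed_measures_scale[OF \<mu>]]
        emeasure_jordan_pos[OF \<mu>] ennreal_mult' SUP_mult_left_ennreal)
qed simp

lemma jordan_neg_scale:
  assumes \<mu>: "\<mu> \<in> signed_measures X" and c: "0 \<le> c"
  shows "jordan_neg X (\<lambda>A. c * \<mu> A) = scale_measure (ennreal c) (jordan_neg X \<mu>)"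
  using jordan_pos_scale[OF uminus_signed_measures[OF \<mu>] c] by (simp add: jordan_neg_def)

lemma total_variation_uminus: "total_variation X (\<lambda>A. - \<mu> A) = total_variation X \<mu>"
proof -
  have "(\<lambda>A. emeasure (jordan_pos X (\<lambda>A. - \<mu> A)) A + emeasure (jordan_neg X (\<lambda>A. - \<mu> A)) A)
     = (\<lambda>A. emeasure (jordan_pos X \<mu>) A + emeasure (jordan_neg X \<mu>) A)"
    by (simp add: jordan_neg_def add.commute fun_eq_iff)
  then show ?thesis unfolding total_variation_def by simp
qed

lemma signed_integral_uminus: "signed_integral X (\<lambda>A. - \<mu> A) f = - signed_integral X \<mu> f"
  by (simp add: signed_integral_def jordan_neg_def)

lemma nn_integral_total_variation_scale:
  assumes \<mu>: "\<mu> \<in> signed_measures X" and f: "f \<in> borel_measurable (mborel X)"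
  shows "(\<integral>\<^sup>+x. f x \<partial>total_variation X (\<lambda>A. c * \<mu> A)) = ennreal \<bar>c\<bar> * (\<integral>\<^sup>+x. f x \<partial>total_variation X \<mu>)"
proof -
  have f': "f \<in> borel_measurable (jordan_pos X \<mu>)" "f \<in> borel_measurable (jordan_neg X \<mu>)" for \<mu>
    using f by auto
  have pos: "(\<integral>\<^sup>+x. f x \<partial>total_variation X (\<lambda>A. c * \<mu> A)) = ennreal c * (\<integral>\<^sup>+x. f x \<partial>total_variation X \<mu>)"
    if "0 \<le> c" for c
    by (simp add: nn_integral_total_variation[OF f] jordan_pos_scale[OF \<mu> that]
        jordan_neg_scale[OF \<mu> that] nn_integral_scale_measure f' distrib_left)
  show ?thesis
  proof (cases "0 \<le> c")
    case False
    then show ?thesis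
      using pos[of "- c"] total_variation_uminus[of X "\<lambda>A. c * \<mu> A"] by simp
  qed (use pos in simp)
qed

lemma integral_scale_measure:
  fixes f :: "'a \<Rightarrow> real"
  assumes f: "integrable M f" and c: "0 \<le> c"
  shows "(LINT x|scale_measure (ennreal c) M. f x) = c * (LINT x|M. f x)"
proof -
  have m: "f \<in> borel_measurable M" "f \<in> borel_measurable (scale_measure (ennreal c) M)"
    using f measurable_cong_sets[OF sets_scale_measure refl, of "ennreal c" M borel] by auto
  have "integrable (scale_measure (ennreal c) M) f"
    using f m by (auto simp: integrable_iff_bounded nn_integral_scale_measure ennreal_mult_less_top)
  then show ?thesis
    using f m c by (simp add: real_lebesgue_integral_def nn_integral_scale_measure enn2real_mult
        right_diff_distrib)
qed

lemma signed_integral_scale: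
  assumes \<mu>: "\<mu> \<in> signed_measures X" and f: "integrable (total_variation X \<mu>) f"
  shows "signed_integral X (\<lambda>A. c * \<mu> A) f = c * signed_integral X \<mu> f"
proof -
  have PN: "integrable (jordan_pos X \<mu>) f" "integrable (jordan_neg X \<mu>) f"
    using f by (auto simp: integrable_total_variation_iff)
  have pos: "signed_integral X (\<lambda>A. c * \<mu> A) f = c * signed_integral X \<mu> f" if "0 \<le> c" for c
    using PN that by (simp add: signed_integral_def jordan_pos_scale[OF \<mu>] jordan_neg_scale[OF \<mu>]
        integral_scale_measure right_diff_distrib)
  show ?thesis
  proof (cases "0 \<le> c")
    case False
    then show ?thesis using pos[of "- c"] signed_integral_uminus[of X "\<lambda>A. c * \<mu> A" f] by simp
  qed (use pos in simp)
qed

text \<open>A point mass is the push-forward of the counting measure on a singleton, and the zero measure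
  the push-forward of the counting measure on the empty set; their difference represents
  \<open>dirac X z\<close>.\<close>

lemma
  assumes z: "z \<in> mspace X"
  shows dirac_signed_measures: "dirac X z \<in> signed_measures X"
    and nn_integral_total_variation_dirac:
      "g \<in> borel_measurable (mborel X) \<Longrightarrow> (\<integral>\<^sup>+x. g x \<partial>total_variation X (dirac X z)) \<le> g z"
    and integrable_dirac: "f \<in> borel_measurable (mborel X) \<Longrightarrow> integrable (total_variation X (dirac X z)) f"
    and signed_integral_dirac: "f \<in> borel_measurable (mborel X) \<Longrightarrow> signed_integral X (dirac X z) f = f z"
proof -
  define M where "M = distr (count_space {z}) (mborel X) (\<lambda>x. x)"
  define Z where "Z = distr (count_space {}) (mborel X) (\<lambda>x. x)"
  have id: "(\<lambda>x. x) \<in> measurable (count_space {z}) (mborel X)"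
     "(\<lambda>x. x) \<in> measurable (count_space {}) (mborel X)" using z by auto
  have e: "emeasure M A = (if z \<in> A then 1 else 0)" "emeasure Z A = 0" if "A \<in> sets (mborel X)" for A
    using that id by (auto simp: M_def Z_def emeasure_distr)
  have "mspace X \<in> sets (mborel X)" using sets.top[of "mborel X"] by simp
  then have M: "finite_measure M" "finite_measure Z" "sets M = sets (mborel X)" "sets Z = sets (mborel X)"
    using e z by (auto intro!: finite_measureI simp: M_def Z_def)
  have d: "dirac X z A = measure M A - measure Z A" if "A \<in> sets (mborel X)" for A
    using e[OF that] that by (simp add: dirac_def measure_def)
  have "dirac X z = measure M"
  proof
    fix A show "dirac X z A = measure M A"
      using e[of A] M(3) by (cases "A \<in> sets (mborel X)") (auto simp: dirac_def measure_def emeasure_notin_sets)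
  qed
  then show s: "dirac X z \<in> signed_measures X" using signed_measures_measure[OF M(1,3)] by simp
  show "(\<integral>\<^sup>+x. g x \<partial>total_variation X (dirac X z)) \<le> g z" if g: "g \<in> borel_measurable (mborel X)"
    using nn_integral_total_variation_le[OF s M d g] g id
    by (simp add: M_def Z_def nn_integral_distr nn_integral_count_space_finite)
  assume f: "f \<in> borel_measurable (mborel X)"
  have int: "integrable M f" "integrable Z f"
    using f id by (auto simp: M_def Z_def integrable_distr_eq integrable_count_space)
  show "integrable (total_variation X (dirac X z)) f"
    using signed_integral_eq_diff(1)[OF s M d int] .
  show "signed_integral X (dirac X z) f = f z"
    using signed_integral_eq_diff(2)[OF s M d int] f id
    by (simp add: M_def Z_def integral_distr lebesgue_integral_count_space_finite)
qed

section \<open>Lipschitz functions\<close>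

definition lipschitz_fun :: "'a metric \<Rightarrow> real \<Rightarrow> ('a \<Rightarrow> real) \<Rightarrow> bool" where
  "lipschitz_fun X C f \<longleftrightarrow> (\<forall>x\<in>mspace X. \<forall>y\<in>mspace X. \<bar>f x - f y\<bar> \<le> C * mdist X x y)"

lemma lip_const_le_1_iff: "lip_const X f \<le> 1 \<longleftrightarrow> lipschitz_fun X 1 f"
  using lip_const_le_iff[of 1 X f] by (simp add: lipschitz_fun_def)

lemma lipschitz_funI:
  assumes "\<And>x y. x \<in> mspace X \<Longrightarrow> y \<in> mspace X \<Longrightarrow> f x \<le> f y + C * mdist X x y"
  shows "lipschitz_fun X C f"
  unfolding lipschitz_fun_def
proof (intro ballI)
  fix x y assume "x \<in> mspace X" "y \<in> mspace X"
  then show "\<bar>f x - f y\<bar> \<le> C * mdist X x y"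
    using assms[of x y] assms[of y x] by (auto simp: mdist_commute abs_le_iff)
qed

lemma lipschitz_funD:
  "lipschitz_fun X C f \<Longrightarrow> x \<in> mspace X \<Longrightarrow> y \<in> mspace X \<Longrightarrow> f x \<le> f y + C * mdist X x y"
  by (force simp: lipschitz_fun_def abs_le_iff)

lemma lipschitz_fun_continuous_map:
  assumes "lipschitz_fun X C f"
  shows "continuous_map (mtopology_of X) euclideanreal f"
proof -
  have "Lipschitz_continuous_map X euclidean_metric f"
    using assms by (auto simp: Lipschitz_continuous_map_def lipschitz_fun_def dist_real_def)
  then show ?thesis using Lipschitz_continuous_imp_continuous_map by force
qed

lemma lipschitz_fun_borel:
  "lipschitz_fun X C f \<Longrightarrow> f \<in> borel_measurable (mborel X)"
  by (intro continuous_map_borel_measurable lipschitz_fun_continuous_map)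

lemma lipschitz_fun_mdist:
  assumes "e \<in> mspace X"
  shows "lipschitz_fun X 1 (\<lambda>x. mdist X x e)"
proof (rule lipschitz_funI)
  fix x y assume "x \<in> mspace X" "y \<in> mspace X"
  then show "mdist X x e \<le> mdist X y e + 1 * mdist X x y"
    using mdist_triangle[of x X y e] assms by simp
qed

lemma lipschitz_fun_min:
  assumes "lipschitz_fun X C f" "lipschitz_fun X C g"
  shows "lipschitz_fun X C (\<lambda>x. min (f x) (g x))"
proof (rule lipschitz_funI)
  fix x y assume "x \<in> mspace X" "y \<in> mspace X"
  then show "min (f x) (g x) \<le> min (f y) (g y) + C * mdist X x y"
    using lipschitz_funD[OF assms(1), of x y] lipschitz_funD[OF assms(2), of x y] by linarith
qed

lemma lipschitz_fun_sum:
  assumes "\<And>i. i \<in> I \<Longrightarrow> lipschitz_fun X (C i) (f i)"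
  shows "lipschitz_fun X (\<Sum>i\<in>I. \<bar>b i\<bar> * C i) (\<lambda>x. \<Sum>i\<in>I. b i * f i x)"
  unfolding lipschitz_fun_def
proof (intro ballI)
  fix x y assume xy: "x \<in> mspace X" "y \<in> mspace X"
  have "\<bar>(\<Sum>i\<in>I. b i * f i x) - (\<Sum>i\<in>I. b i * f i y)\<bar> = \<bar>\<Sum>i\<in>I. b i * (f i x - f i y)\<bar>"
    by (simp add: sum_subtractf right_diff_distrib)
  also have "\<dots> \<le> (\<Sum>i\<in>I. \<bar>b i\<bar> * \<bar>f i x - f i y\<bar>)"
    using sum_abs[of "\<lambda>i. b i * (f i x - f i y)" I] by (simp add: abs_mult)
  also have "\<dots> \<le> (\<Sum>i\<in>I. \<bar>b i\<bar> * (C i * mdist X x y))"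
    using assms xy by (intro sum_mono mult_left_mono) (auto simp: lipschitz_fun_def)
  finally show "\<bar>(\<Sum>i\<in>I. b i * f i x) - (\<Sum>i\<in>I. b i * f i y)\<bar> \<le> (\<Sum>i\<in>I. \<bar>b i\<bar> * C i) * mdist X x y"
    by (simp add: sum_distrib_right mult.assoc)
qed

text \<open>McShane's construction: an infimum of functions with a common Lipschitz constant has this
  Lipschitz constant wherever it is finite.\<close>

lemma inf_convolution_lipschitz:
  assumes S: "S \<subseteq> mspace X" "S \<noteq> {}" and k: "0 \<le> k"
    and low: "\<And>x. x \<in> mspace X \<Longrightarrow> bdd_below ((\<lambda>y. a y + k * mdist X x y) ` S)"
  shows "lipschitz_fun X k (\<lambda>x. INF y\<in>S. a y + k * mdist X x y)"
proof (rule lipschitz_funI)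
  fix x z assume xz: "x \<in> mspace X" "z \<in> mspace X"
  have "(INF y\<in>S. a y + k * mdist X x y) - k * mdist X x z \<le> (INF y\<in>S. a y + k * mdist X z y)"
  proof (rule cINF_greatest[OF S(2)])
    fix y assume y: "y \<in> S"
    have "(INF y\<in>S. a y + k * mdist X x y) \<le> a y + k * mdist X x y"
      using low[OF xz(1)] y by (rule cINF_lower)
    also have "k * mdist X x y \<le> k * (mdist X x z + mdist X z y)"
      using mdist_triangle[of x X z y] xz y S(1) k by (intro mult_left_mono) auto
    finally show "(INF y\<in>S. a y + k * mdist X x y) - k * mdist X x z \<le> a y + k * mdist X z y"
      by (simp add: distrib_left)
  qed
  then show "(INF y\<in>S. a y + k * mdist X x y) \<le> (INF y\<in>S. a y + k * mdist X z y) + k * mdist X x z"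
    by simp
qed

section \<open>The Kantorovich--Rubinstein norm on measures\<close>

lemma moment_measures_signed: "\<mu> \<in> moment_measures X e p \<Longrightarrow> \<mu> \<in> signed_measures X"
  by (simp add: moment_measures_def)

lemma borel_mdist [measurable]:
  "e \<in> mspace X \<Longrightarrow> (\<lambda>x. mdist X x e) \<in> borel_measurable (mborel X)"
  by (rule lipschitz_fun_borel[OF lipschitz_fun_mdist])

lemma moment_measures_add:
  assumes e: "e \<in> mspace X" and "\<mu> \<in> moment_measures X e p" "\<nu> \<in> moment_measures X e p"
  shows "(\<lambda>A. \<mu> A + \<nu> A) \<in> moment_measures X e p"
proof -
  have "(\<lambda>x. ennreal (mdist X x e powr p)) \<in> borel_measurable (mborel X)"
    using e by measurable
  from nn_integral_total_variation_add[OF _ _ this, of \<mu> \<nu>] assms(2,3)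
  show ?thesis
    by (auto simp: moment_measures_def signed_measures_add intro: order_le_less_trans)
qed

lemma moment_measures_scale:
  assumes e: "e \<in> mspace X" and "\<mu> \<in> moment_measures X e p"
  shows "(\<lambda>A. c * \<mu> A) \<in> moment_measures X e p"
proof -
  have "(\<lambda>x. ennreal (mdist X x e powr p)) \<in> borel_measurable (mborel X)"
    using e by measurable
  from nn_integral_total_variation_scale[OF _ this, of \<mu>] assms(2)
  show ?thesis
    by (auto simp: moment_measures_def signed_measures_scale ennreal_mult_less_top)
qed

lemma moment_measures_diff:
  assumes "e \<in> mspace X" "\<mu> \<in> moment_measures X e p" "\<nu> \<in> moment_measures X e p"
  shows "(\<lambda>A. \<mu> A - \<nu> A) \<in> moment_measures X e p"
  using moment_measures_add[OF assms(1,2) moment_measures_scale[OF assms(1,3), of "-1"]] by simp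

lemma moment_measures_zero: "e \<in> mspace X \<Longrightarrow> (\<lambda>A. 0) \<in> moment_measures X e p"
  using nn_integral_total_variation_scale[OF signed_measures_zero, of "\<lambda>x. ennreal (mdist X x e powr p)" X 0]
  by (auto simp: moment_measures_def signed_measures_zero)

lemma moment_measures_dirac:
  assumes e: "e \<in> mspace X" and z: "z \<in> mspace X"
  shows "dirac X z \<in> moment_measures X e p"
proof -
  have "(\<lambda>x. ennreal (mdist X x e powr p)) \<in> borel_measurable (mborel X)"
    using e by measurable
  from nn_integral_total_variation_dirac[OF z this] dirac_signed_measures[OF z]
  show ?thesis
    by (auto simp: moment_measures_def intro: order_le_less_trans)
qed

lemma moment_measures_sum:
  assumes "e \<in> mspace X" "finite I" "\<And>i. i \<in> I \<Longrightarrow> \<mu> i \<in> moment_measures X e p"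
  shows "(\<lambda>A. \<Sum>i\<in>I. \<mu> i A) \<in> moment_measures X e p"
  using assms(2,3)
  by (induction I rule: finite_induct) (auto simp: moment_measures_zero[OF assms(1)] intro: moment_measures_add[OF assms(1)])

lemma moment_measures_subset:
  assumes e: "e \<in> mspace X" and "1 \<le> p" and \<mu>: "\<mu> \<in> moment_measures X e p"
  shows "\<mu> \<in> moment_measures X e 1"
proof -
  interpret finite_measure "total_variation X \<mu>"
    using \<mu> by (intro finite_measure_total_variation moment_measures_signed)
  have m: "(\<lambda>x. ennreal (mdist X x e powr p)) \<in> borel_measurable (total_variation X \<mu>)"
    using e by measurable
  have "(\<integral>\<^sup>+x. ennreal (mdist X x e powr 1) \<partial>total_variation X \<mu>)
      \<le> (\<integral>\<^sup>+x. 1 + ennreal (mdist X x e powr p) \<partial>total_variation X \<mu>)"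
  proof (rule nn_integral_mono)
    fix x
    have "mdist X x e \<le> 1 + mdist X x e powr p"
    proof (cases "mdist X x e \<le> 1")
      case True
      then show ?thesis by (simp add: add_increasing2)
    next
      case False
      then show ?thesis using powr_mono[of 1 p "mdist X x e"] \<open>1 \<le> p\<close> by simp
    qed
    then have "ennreal (mdist X x e) \<le> ennreal (1 + mdist X x e powr p)" by (rule ennreal_leI)
    then show "ennreal (mdist X x e powr 1) \<le> 1 + ennreal (mdist X x e powr p)"
      by (simp add: ennreal_plus)
  qed
  also have "\<dots> = emeasure (total_variation X \<mu>) (mspace X)
      + (\<integral>\<^sup>+x. ennreal (mdist X x e powr p) \<partial>total_variation X \<mu>)"
    using m by (simp add: nn_integral_add)
  also have "\<dots> < \<infinity>"
    using \<mu> emeasure_finite[of "mspace X"]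
    by (simp only: moment_measures_def mem_Collect_eq infinity_ennreal_def ennreal_add_less_top less_top simp_thms)
  finally show ?thesis using \<mu> by (simp add: moment_measures_def)
qed

lemma integrable_mdist:
  assumes e: "e \<in> mspace X" and "\<mu> \<in> moment_measures X e 1"
  shows "integrable (total_variation X \<mu>) (\<lambda>x. mdist X x e)"
proof -
  have "(\<lambda>x. mdist X x e) \<in> borel_measurable (total_variation X \<mu>)"
    using e by measurable
  then show ?thesis using assms by (auto simp: moment_measures_def integrable_iff_bounded)
qed

lemma integrable_lipschitz_fun:
  assumes e: "e \<in> mspace X" and \<mu>: "\<mu> \<in> moment_measures X e 1" and f: "lipschitz_fun X C f"
  shows "integrable (total_variation X \<mu>) f"
proof (rule Bochner_Integration.integrable_bound)
  show "integrable (total_variation X \<mu>) (\<lambda>x. \<bar>f e\<bar> + \<bar>C\<bar> * mdist X x e)"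
    using integrable_mdist[OF e \<mu>] signed_integral_const(1)[OF moment_measures_signed[OF \<mu>]] by simp
  show "f \<in> borel_measurable (total_variation X \<mu>)"
    using lipschitz_fun_borel[OF f] by (simp cong: measurable_cong_sets)
  have "\<bar>f x\<bar> \<le> \<bar>f e\<bar> + \<bar>C\<bar> * mdist X x e" if x: "x \<in> mspace X" for x
  proof -
    have "\<bar>f x - f e\<bar> \<le> C * mdist X x e" using f x e by (simp add: lipschitz_fun_def)
    also have "\<dots> \<le> \<bar>C\<bar> * mdist X x e" by (intro mult_right_mono) auto
    finally show ?thesis by linarith
  qed
  then show "AE x in total_variation X \<mu>. norm (f x) \<le> norm (\<bar>f e\<bar> + \<bar>C\<bar> * mdist X x e)"
    by (intro AE_I2) (fastforce intro: order_trans abs_ge_self)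
qed

definition KR_sup :: "'a metric \<Rightarrow> 'a \<Rightarrow> ('a set \<Rightarrow> real) \<Rightarrow> real" where
  "KR_sup X e \<mu> = (SUP f \<in> {f. f e = 0 \<and> lip_const X f \<le> 1}. signed_integral X \<mu> f)"

lemma KRu_norm_meas_eq: "KRu_norm_meas X e \<mu> = \<bar>\<mu> (mspace X)\<bar> + KR_sup X e \<mu>"
  by (simp add: KRu_norm_meas_def KR_sup_def)

lemma zero_test_function: "(\<lambda>_. 0) \<in> {f. f e = 0 \<and> lip_const X f \<le> 1}"
  by (simp add: lip_const_le_1_iff lipschitz_fun_def)

lemma KR_sup_upper:
  assumes e: "e \<in> mspace X" and \<mu>: "\<mu> \<in> moment_measures X e 1"
    and f: "lipschitz_fun X 1 f" "f e = 0"
  shows "signed_integral X \<mu> f \<le> KR_sup X e \<mu>"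
  unfolding KR_sup_def
proof (rule cSUP_upper)
  show "f \<in> {f. f e = 0 \<and> lip_const X f \<le> 1}" using f by (simp add: lip_const_le_1_iff)
  show "bdd_above (signed_integral X \<mu> ` {f. f e = 0 \<and> lip_const X f \<le> 1})"
  proof (rule bdd_aboveI2)
    fix g assume "g \<in> {f. f e = 0 \<and> lip_const X f \<le> 1}"
    then have g: "lipschitz_fun X 1 g" "g e = 0" by (auto simp: lip_const_le_1_iff)
    note int = integrable_lipschitz_fun[OF e \<mu> g(1)]
    have "signed_integral X \<mu> g \<le> (LINT x|total_variation X \<mu>. \<bar>g x\<bar>)"
      using abs_signed_integral_le[OF int] by simp
    also have "\<dots> \<le> (LINT x|total_variation X \<mu>. mdist X x e)"
    proof (rule integral_mono)
      fix x assume "x \<in> space (total_variation X \<mu>)"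
      then show "\<bar>g x\<bar> \<le> mdist X x e" using g e by (force simp: lipschitz_fun_def)
    qed (use int integrable_mdist[OF e \<mu>] in auto)
    finally show "signed_integral X \<mu> g \<le> (LINT x|total_variation X \<mu>. mdist X x e)" .
  qed
qed

lemma KR_sup_least:
  assumes "\<And>f. lipschitz_fun X 1 f \<Longrightarrow> f e = 0 \<Longrightarrow> signed_integral X \<mu> f \<le> c"
  shows "KR_sup X e \<mu> \<le> c"
  unfolding KR_sup_def
proof (rule cSUP_least)
  show "{f. f e = 0 \<and> lip_const X f \<le> 1} \<noteq> {}"
    by (rule ex_in_conv[THEN iffD1, OF exI, OF zero_test_function])
  fix f assume "f \<in> {f. f e = 0 \<and> lip_const X f \<le> 1}"
  then show "signed_integral X \<mu> f \<le> c" using assms[of f] by (simp add: lip_const_le_1_iff)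
qed

lemma KR_sup_nonneg:
  assumes "e \<in> mspace X" "\<mu> \<in> moment_measures X e 1"
  shows "0 \<le> KR_sup X e \<mu>"
  using KR_sup_upper[OF assms, of "\<lambda>_. 0"] by (simp add: lipschitz_fun_def signed_integral_def)

text \<open>Subtracting the value at the base point and dividing by the Lipschitz constant gives an
  admissible test function; a function with constant 0 has to be treated as constant instead.\<close>

lemma signed_integral_lipschitz_le:
  assumes e: "e \<in> mspace X" and \<mu>: "\<mu> \<in> moment_measures X e 1"
    and f: "lipschitz_fun X C f" and C: "0 \<le> C"
  shows "signed_integral X \<mu> f \<le> C * KR_sup X e \<mu> + f e * \<mu> (mspace X)"
proof -
  note c = signed_integral_const[OF moment_measures_signed[OF \<mu>]]
  define g where "g x = (if C = 0 then 0 else (f x - f e) / C)" for x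
  have g: "lipschitz_fun X 1 g" "g e = 0"
    using f C unfolding lipschitz_fun_def g_def
    by (auto simp: divide_simps mult.commute abs_divide diff_divide_distrib[symmetric])
  have "f x = f e + C * g x" if "x \<in> mspace X" for x
  proof -
    have "\<bar>f x - f e\<bar> \<le> C * mdist X x e" using f that e unfolding lipschitz_fun_def by blast
    then show ?thesis by (cases "C = 0") (auto simp: g_def)
  qed
  then have "signed_integral X \<mu> f = signed_integral X \<mu> (\<lambda>x. f e + C * g x)"
    by (rule signed_integral_cong)
  also have "\<dots> = f e * \<mu> (mspace X) + C * signed_integral X \<mu> g"
    using integrable_lipschitz_fun[OF e \<mu> g(1)] c
    by (simp add: signed_integral_add_fun signed_integral_cmult_fun)
  also have "\<dots> \<le> f e * \<mu> (mspace X) + C * KR_sup X e \<mu>"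
    using KR_sup_upper[OF e \<mu> g] C by (simp add: mult_left_mono)
  finally show ?thesis by simp
qed

lemma lipschitz_fun_uminus: "lipschitz_fun X C f \<Longrightarrow> lipschitz_fun X C (\<lambda>x. - f x)"
  by (simp add: lipschitz_fun_def abs_minus_commute)

lemma signed_integral_uminus_fun: "signed_integral X \<mu> (\<lambda>x. - f x) = - signed_integral X \<mu> f"
  by (simp add: signed_integral_def)

lemma KRu_norm_meas_uminus: "KRu_norm_meas X e (\<lambda>A. - \<mu> A) = KRu_norm_meas X e \<mu>"
proof -
  have "bij_betw (\<lambda>f x. - f x) {f. f e = 0 \<and> lipschitz_fun X 1 f} {f. f e = 0 \<and> lipschitz_fun X 1 f}"
    by (rule bij_betwI[where g = "\<lambda>f x. - f x"]) (auto intro: lipschitz_fun_uminus)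
  then have im: "(\<lambda>f x. - f x) ` {f. f e = 0 \<and> lipschitz_fun X 1 f} = {f. f e = 0 \<and> lipschitz_fun X 1 f}"
    by (simp add: bij_betw_def)
  have "signed_integral X (\<lambda>A. - \<mu> A) = (\<lambda>f. signed_integral X \<mu> (\<lambda>x. - f x))"
    by (simp add: signed_integral_uminus signed_integral_uminus_fun fun_eq_iff)
  then have "KR_sup X e (\<lambda>A. - \<mu> A) = KR_sup X e \<mu>"
    unfolding KR_sup_def lip_const_le_1_iff
    using image_image[of "signed_integral X \<mu>" "\<lambda>f x. - f x" "{f. f e = 0 \<and> lipschitz_fun X 1 f}"] im
    by simp
  then show ?thesis by (simp add: KRu_norm_meas_eq)
qed

lemma KRu_norm_meas_minus_commute:
  "KRu_norm_meas X e (\<lambda>A. \<mu> A - \<nu> A) = KRu_norm_meas X e (\<lambda>A. \<nu> A - \<mu> A)"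
  using KRu_norm_meas_uminus[of X e "\<lambda>A. \<mu> A - \<nu> A"] by simp

lemma KRu_norm_meas_nonneg:
  "e \<in> mspace X \<Longrightarrow> \<mu> \<in> moment_measures X e 1 \<Longrightarrow> 0 \<le> KRu_norm_meas X e \<mu>"
  unfolding KRu_norm_meas_eq by (intro add_nonneg_nonneg KR_sup_nonneg) auto

lemma KRu_norm_meas_triangle:
  assumes e: "e \<in> mspace X" and \<mu>: "\<mu> \<in> moment_measures X e 1" and \<nu>: "\<nu> \<in> moment_measures X e 1"
  shows "KRu_norm_meas X e (\<lambda>A. \<mu> A + \<nu> A) \<le> KRu_norm_meas X e \<mu> + KRu_norm_meas X e \<nu>"
proof -
  have "KR_sup X e (\<lambda>A. \<mu> A + \<nu> A) \<le> KR_sup X e \<mu> + KR_sup X e \<nu>"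
  proof (rule KR_sup_least)
    fix f assume f: "lipschitz_fun X 1 f" "f e = 0"
    have "signed_integral X (\<lambda>A. \<mu> A + \<nu> A) f = signed_integral X \<mu> f + signed_integral X \<nu> f"
      using \<mu> \<nu> f e by (intro signed_integral_add moment_measures_signed integrable_lipschitz_fun)
    then show "signed_integral X (\<lambda>A. \<mu> A + \<nu> A) f \<le> KR_sup X e \<mu> + KR_sup X e \<nu>"
      using KR_sup_upper[OF e \<mu> f] KR_sup_upper[OF e \<nu> f] by simp
  qed
  then show ?thesis by (simp add: KRu_norm_meas_eq)
qed

lemma KRu_norm_meas_diff_triangle:
  assumes e: "e \<in> mspace X" and "\<mu> \<in> moment_measures X e 1" "\<nu> \<in> moment_measures X e 1" "\<rho> \<in> moment_measures X e 1"
  shows "KRu_norm_meas X e (\<lambda>A. \<mu> A - \<rho> A)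
    \<le> KRu_norm_meas X e (\<lambda>A. \<mu> A - \<nu> A) + KRu_norm_meas X e (\<lambda>A. \<nu> A - \<rho> A)"
  using KRu_norm_meas_triangle[OF e moment_measures_diff[OF e assms(2,3)] moment_measures_diff[OF e assms(3,4)]]
  by simp

lemma abs_signed_integral_lipschitz_le:
  assumes e: "e \<in> mspace X" and \<mu>: "\<mu> \<in> moment_measures X e 1"
    and f: "lipschitz_fun X C f" and C: "0 \<le> C"
  shows "\<bar>signed_integral X \<mu> f\<bar> \<le> (C + \<bar>f e\<bar>) * KRu_norm_meas X e \<mu>"
proof -
  have "\<bar>signed_integral X \<mu> f\<bar> \<le> C * KR_sup X e \<mu> + \<bar>f e\<bar> * \<bar>\<mu> (mspace X)\<bar>"
    using signed_integral_lipschitz_le[OF e \<mu> f C]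
      signed_integral_lipschitz_le[OF e \<mu> lipschitz_fun_uminus[OF f] C]
      abs_ge_self[of "f e * \<mu> (mspace X)"] abs_ge_minus_self[of "f e * \<mu> (mspace X)"]
    by (simp add: signed_integral_uminus_fun abs_mult)
  also have "\<dots> \<le> (C + \<bar>f e\<bar>) * (\<bar>\<mu> (mspace X)\<bar> + KR_sup X e \<mu>)"
    using C KR_sup_nonneg[OF e \<mu>] by (simp add: algebra_simps add_nonneg_nonneg)
  finally show ?thesis by (simp add: KRu_norm_meas_eq)
qed

lemma signed_integral_diff:
  assumes e: "e \<in> mspace X" and a: "a \<in> moment_measures X e 1" and b: "b \<in> moment_measures X e 1"
    and f: "lipschitz_fun X C f"
  shows "signed_integral X (\<lambda>A. a A - b A) f = signed_integral X a f - signed_integral X b f"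
proof -
  have "signed_integral X (\<lambda>A. (a A - b A) + b A) f
      = signed_integral X (\<lambda>A. a A - b A) f + signed_integral X b f"
    using a b f e
    by (intro signed_integral_add moment_measures_signed[of _ X e 1] integrable_lipschitz_fun moment_measures_diff)
  then show ?thesis by simp
qed

text \<open>Lipschitz functions separate signed measures: the truncated distances
  \<open>max 0 (1 - n * dist(x, C))\<close> decrease to the indicator function of a closed set \<open>C\<close>, so the
  two Jordan parts agree on closed sets.\<close>

lemma KRu_norm_meas_eq_0D:
  assumes e: "e \<in> mspace X" and \<mu>: "\<mu> \<in> moment_measures X e 1" and 0: "KRu_norm_meas X e \<mu> = 0"
  shows "\<mu> = (\<lambda>A. 0)"
proof -
  interpret X: Metric_space "mspace X" "mdist X" by simp
  note s = moment_measures_signed[OF \<mu>]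
  let ?P = "jordan_pos X \<mu>" and ?N = "jordan_neg X \<mu>"
  interpret P: finite_measure ?P by (rule finite_measure_jordan_pos[OF s])
  interpret N: finite_measure ?N by (rule finite_measure_jordan_neg[OF s])
  have eq: "emeasure ?P C = emeasure ?N C" if C: "closedin (mtopology_of X) C" for C
  proof (cases "C = {}")
    case False
    have CX: "C \<subseteq> mspace X" using C closedin_subset by fastforce
    have CS: "C \<in> sets (mborel X)" by (rule closedin_sets_mborel[OF C])
    define D where "D x = (INF y\<in>C. mdist X x y)" for x
    have bdd: "bdd_below (mdist X x ` C)" for x by (rule bdd_belowI2[where m = 0]) simp
    have D: "lipschitz_fun X 1 D"
      using inf_convolution_lipschitz[OF CX False, of 1 "\<lambda>_. 0"] bdd by (simp add: D_def[abs_def])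
    have D0: "0 \<le> D x" for x unfolding D_def using False by (intro cINF_greatest) auto
    have DC: "D x = 0" if "x \<in> C" for x
      using cINF_lower[OF bdd that, of x] D0[of x] that CX by (auto simp: D_def)
    have Dpos: "0 < D x" if x: "x \<in> mspace X" "x \<notin> C" for x
    proof -
      have "openin (mtopology_of X) (mspace X - C)" using C by (simp add: closedin_def)
      then obtain r where r: "r > 0" "X.mball x r \<subseteq> mspace X - C"
        using x by (auto simp: mtopology_of_def X.openin_mtopology)
      have "r \<le> mdist X x y" if "y \<in> C" for y
        using r(2) that CX x(1) by (meson DiffD2 X.in_mball not_le subsetD)
      then have "r \<le> D x" unfolding D_def using False by (intro cINF_greatest) auto
      then show ?thesis using r(1) by simp
    qed
    define f where "f n x = max 0 (1 - real n * D x)" for n x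
    have flip: "lipschitz_fun X (real n) (f n)" for n
    proof (rule lipschitz_funI)
      fix x y assume "x \<in> mspace X" "y \<in> mspace X"
      then have "D y \<le> D x + mdist X x y"
        using lipschitz_funD[OF D, of y x] by (simp add: mdist_commute)
      then have "real n * D y \<le> real n * D x + real n * mdist X x y"
        using mult_left_mono[of "D y" "D x + mdist X x y" "real n"] by (simp add: distrib_left)
      moreover have "0 \<le> real n * mdist X x y" by simp
      ultimately show "f n x \<le> f n y + real n * mdist X x y"
        unfolding f_def by linarith
    qed
    have fb: "\<bar>f n x\<bar> \<le> 1" for n x using D0[of x] by (auto simp: f_def)
    have flim: "(\<lambda>n. f n x) \<longlonglongrightarrow> indicator C x" if x: "x \<in> mspace X" for x
    proof (cases "x \<in> C")
      case True
      then show ?thesis by (simp add: f_def DC)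
    next
      case False
      obtain n0 where n0: "1 < real n0 * D x" using reals_Archimedean3[OF Dpos[OF x False]] by blast
      have "f n x = 0" if "n0 \<le> n" for n
      proof -
        have "real n0 * D x \<le> real n * D x" using that D0 by (intro mult_right_mono) auto
        then show ?thesis using n0 by (simp add: f_def)
      qed
      then show ?thesis using False by (auto intro!: tendsto_eventually eventually_sequentiallyI)
    qed
    have sig: "signed_integral X \<mu> (f n) = 0" for n
      using abs_signed_integral_lipschitz_le[OF e \<mu> flip] 0 by simp
    have lim: "(\<lambda>n. LINT x|K. f n x) \<longlonglongrightarrow> (LINT x|K. indicator C x)"
      if K: "finite_measure K" "sets K = sets (mborel X)" for K
    proof (rule integral_dominated_convergence[where w = "\<lambda>_. 1"])
      have sp: "space K = mspace X" using sets_eq_imp_space_eq[OF K(2)] by simp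
      show "f n \<in> borel_measurable K" for n
        using lipschitz_fun_borel[OF flip] measurable_cong_sets[OF K(2) refl] by blast
      show "indicator C \<in> borel_measurable K" using CS K(2) by simp
      show "integrable K (\<lambda>_. 1::real)" using finite_measure.integrable_const[OF K(1)] .
      show "AE x in K. (\<lambda>n. f n x) \<longlonglongrightarrow> indicator C x" using flim sp by (intro AE_I2) auto
      show "AE x in K. norm (f n x) \<le> 1" for n using fb by (intro AE_I2) auto
    qed
    have "(LINT x|?P. f n x) = (LINT x|?N. f n x)" for n
      using sig[of n] by (simp add: signed_integral_def)
    then have "(LINT x|?P. indicator C x :: real) = (LINT x|?N. indicator C x)"
      using lim[of ?P] lim[of ?N] P.finite_measure_axioms N.finite_measure_axioms LIMSEQ_unique by simp
    then show ?thesis using CX CS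
      by (simp add: P.emeasure_eq_measure N.emeasure_eq_measure Int_absorb2)
  qed simp
  have gen: "sets (mborel X) = sigma_sets (mspace X) {C. closedin (mtopology_of X) C}"
  proof (rule antisym)
    have "sets (mborel X) = sigma_sets (mspace X) {U. openin (mtopology_of X) U}"
      unfolding mborel_def by (rule sets_measure_of) (auto dest!: openin_subset)
    also have "\<dots> \<subseteq> sigma_sets (mspace X) {C. closedin (mtopology_of X) C}"
    proof (rule sigma_sets_mono, safe)
      fix U assume U: "openin (mtopology_of X) U"
      then have "closedin (mtopology_of X) (mspace X - U)" by (auto simp: closedin_def dest: openin_subset)
         (metis Diff_Diff_Int inf.absorb2 openin_subset topspace_mtopology_of)
      then have "mspace X - (mspace X - U) \<in> sigma_sets (mspace X) {C. closedin (mtopology_of X) C}"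
        by (intro sigma_sets.Compl sigma_sets.Basic) simp
      then show "U \<in> sigma_sets (mspace X) {C. closedin (mtopology_of X) C}"
        using openin_subset[OF U] by (simp add: double_diff)
    qed
    finally show "sets (mborel X) \<subseteq> sigma_sets (mspace X) {C. closedin (mtopology_of X) C}" .
    show "sigma_sets (mspace X) {C. closedin (mtopology_of X) C} \<subseteq> sets (mborel X)"
      using sets.sigma_sets_subset[of "{C. closedin (mtopology_of X) C}" "mborel X"] closedin_sets_mborel
      by auto
  qed
  have "?P = ?N"
  proof (rule measure_eqI_generator_eq[where A = "\<lambda>_. mspace X"])
    show "Int_stable {C. closedin (mtopology_of X) C}" by (auto simp: Int_stable_def)
    show "{C. closedin (mtopology_of X) C} \<subseteq> Pow (mspace X)" by (auto dest!: closedin_subset)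
    show "sets ?P = sigma_sets (mspace X) {C. closedin (mtopology_of X) C}" using gen by simp
    show "sets ?N = sigma_sets (mspace X) {C. closedin (mtopology_of X) C}" using gen by simp
    show "range (\<lambda>_. mspace X) \<subseteq> {C. closedin (mtopology_of X) C}"
      using closedin_topspace[of "mtopology_of X"] by auto
  qed (use eq in auto)
  then show ?thesis
    using jordan_decomposition[OF s] signed_measures_notin_sets[OF s] by (metis ext diff_self)
qed

section \<open>The completion\<close>

lemma KRu_norm_meas_0: "e \<in> mspace X \<Longrightarrow> KRu_norm_meas X e (\<lambda>A. 0) = 0"
proof -
  assume e: "e \<in> mspace X"
  have "KR_sup X e (\<lambda>A. 0) \<le> 0"
    by (rule KR_sup_least) (use signed_integral_uminus[of X "\<lambda>A. 0"] in simp)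
  then show ?thesis
    using KR_sup_nonneg[OF e moment_measures_zero[OF e]] by (simp add: KRu_norm_meas_eq)
qed

lemma KRu_CauchyI:
  assumes e: "e \<in> mspace X" and a: "a \<in> moment_measures X e 1"
    and s: "\<And>n. s n \<in> moment_measures X e 1"
    and lim: "(\<lambda>n. KRu_norm_meas X e (\<lambda>A. a A - s n A)) \<longlonglongrightarrow> 0"
  shows "s \<in> KRu_Cauchy X e"
  unfolding KRu_Cauchy_def
proof (intro CollectI conjI allI impI)
  fix \<epsilon> :: real assume "\<epsilon> > 0"
  then have "\<forall>\<^sub>F n in sequentially. KRu_norm_meas X e (\<lambda>A. a A - s n A) < \<epsilon> / 2"
    using lim by (intro order_tendstoD(2)) auto
  then obtain n0 where n0: "\<And>n. n \<ge> n0 \<Longrightarrow> KRu_norm_meas X e (\<lambda>A. a A - s n A) < \<epsilon> / 2"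
    by (auto simp: eventually_sequentially)
  show "\<exists>n0. \<forall>m\<ge>n0. \<forall>n\<ge>n0. KRu_norm_meas X e (\<lambda>A. s m A - s n A) < \<epsilon>"
  proof (intro exI[of _ n0] allI impI)
    fix m n assume "m \<ge> n0" "n \<ge> n0"
    then show "KRu_norm_meas X e (\<lambda>A. s m A - s n A) < \<epsilon>"
      using KRu_norm_meas_diff_triangle[OF e s[of m] a s[of n]] n0[of m] n0[of n]
        KRu_norm_meas_minus_commute[of X e "s m" a] by simp
  qed
qed (rule s)

lemma KRu_Cauchy_moment: "s \<in> KRu_Cauchy X e \<Longrightarrow> s n \<in> moment_measures X e 1"
  by (simp add: KRu_Cauchy_def)

lemma KRu_embed_iff:
  assumes e: "e \<in> mspace X" and a: "a \<in> moment_measures X e 1"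
  shows "s \<in> KRu_embed X e a \<longleftrightarrow>
    (\<forall>n. s n \<in> moment_measures X e 1) \<and> (\<lambda>n. KRu_norm_meas X e (\<lambda>A. a A - s n A)) \<longlonglongrightarrow> 0"
proof -
  have "(\<lambda>n. a) \<in> KRu_Cauchy X e"
    using a by (intro KRu_CauchyI[OF e a]) (simp_all add: KRu_norm_meas_0[OF e])
  then show ?thesis
    using KRu_CauchyI[OF e a, of s] KRu_Cauchy_moment[of s X e]
    by (auto simp: KRu_embed_def KRu_rel_def Image_def)
qed

lemma KRu_embed_self:
  assumes "e \<in> mspace X" "a \<in> moment_measures X e 1"
  shows "(\<lambda>n. a) \<in> KRu_embed X e a"
  using assms by (simp add: KRu_embed_iff KRu_norm_meas_0)

lemma KRu_dist_null_trans:
  assumes e: "e \<in> mspace X" and M: "\<And>n. u n \<in> moment_measures X e 1"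
      "\<And>n. v n \<in> moment_measures X e 1" "\<And>n. r n \<in> moment_measures X e 1"
    and lim: "(\<lambda>n. KRu_norm_meas X e (\<lambda>A. u n A - v n A)) \<longlonglongrightarrow> 0"
      "(\<lambda>n. KRu_norm_meas X e (\<lambda>A. v n A - r n A)) \<longlonglongrightarrow> 0"
  shows "(\<lambda>n. KRu_norm_meas X e (\<lambda>A. u n A - r n A)) \<longlonglongrightarrow> 0"
proof (rule tendsto_sandwich[OF always_eventually always_eventually tendsto_const])
  show "\<forall>n. 0 \<le> KRu_norm_meas X e (\<lambda>A. u n A - r n A)"
    using M by (intro allI KRu_norm_meas_nonneg[OF e] moment_measures_diff[OF e])
  show "\<forall>n. KRu_norm_meas X e (\<lambda>A. u n A - r n A)
      \<le> KRu_norm_meas X e (\<lambda>A. u n A - v n A) + KRu_norm_meas X e (\<lambda>A. v n A - r n A)"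
    using M by (intro allI KRu_norm_meas_diff_triangle[OF e])
qed (use tendsto_add[OF lim] in simp)

text \<open>This recognises the class of a measure from any of its representatives, which is how
  differences of classes are computed.\<close>

lemma KRu_rel_Image_eq_embed:
  assumes e: "e \<in> mspace X" and a: "a \<in> moment_measures X e 1" and s: "s \<in> KRu_embed X e a"
  shows "KRu_rel X e `` {s} = KRu_embed X e a"
proof -
  let ?d = "\<lambda>u v. KRu_norm_meas X e (\<lambda>A. u A - v A)"
  have sM: "\<And>n. s n \<in> moment_measures X e 1" and sl: "(\<lambda>n. ?d a (s n)) \<longlonglongrightarrow> 0"
    using s by (auto simp: KRu_embed_iff[OF e a])
  have sC: "s \<in> KRu_Cauchy X e" by (rule KRu_CauchyI[OF e a sM sl])
  show ?thesis
  proof (intro set_eqI iffI)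
    fix r assume "r \<in> KRu_rel X e `` {s}"
    then have r: "r \<in> KRu_Cauchy X e" "(\<lambda>n. ?d (s n) (r n)) \<longlonglongrightarrow> 0"
      by (auto simp: KRu_rel_def)
    then show "r \<in> KRu_embed X e a"
      using KRu_dist_null_trans[OF e a sM _ sl r(2)] KRu_Cauchy_moment[OF r(1)]
      by (simp add: KRu_embed_iff[OF e a])
  next
    fix r assume "r \<in> KRu_embed X e a"
    then have rM: "\<And>n. r n \<in> moment_measures X e 1" and rl: "(\<lambda>n. ?d a (r n)) \<longlonglongrightarrow> 0"
      by (auto simp: KRu_embed_iff[OF e a])
    have "(\<lambda>n. ?d (s n) a) \<longlonglongrightarrow> 0"
      using sl by (simp add: KRu_norm_meas_minus_commute[of X e _ a])
    then have "(\<lambda>n. ?d (s n) (r n)) \<longlonglongrightarrow> 0"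
      by (rule KRu_dist_null_trans[OF e sM a rM _ rl])
    then show "r \<in> KRu_rel X e `` {s}"
      using sC KRu_CauchyI[OF e a rM rl] by (simp add: KRu_rel_def)
  qed
qed

lemma KRu_embed_in_KRu:
  assumes "e \<in> mspace X" "a \<in> moment_measures X e 1"
  shows "KRu_embed X e a \<in> KRu X e"
  unfolding KRu_def KRu_embed_def using assms
  by (intro quotientI KRu_CauchyI[OF assms]) (simp_all add: KRu_norm_meas_0)

lemma KRu_embed_inj:
  assumes e: "e \<in> mspace X" and a: "a \<in> moment_measures X e 1" and b: "b \<in> moment_measures X e 1"
    and eq: "KRu_embed X e a = KRu_embed X e b"
  shows "a = b"
proof -
  have "(\<lambda>n. b) \<in> KRu_embed X e a" unfolding eq by (rule KRu_embed_self[OF e b])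
  then have "(\<lambda>n::nat. KRu_norm_meas X e (\<lambda>A. a A - b A)) \<longlonglongrightarrow> 0"
    by (simp add: KRu_embed_iff[OF e a])
  then have "KRu_norm_meas X e (\<lambda>A. a A - b A) = 0" by (simp add: LIMSEQ_const_iff)
  from KRu_norm_meas_eq_0D[OF e moment_measures_diff[OF e a b] this]
  show ?thesis by (simp add: fun_eq_iff)
qed

lemma KRu_diff_embed:
  assumes e: "e \<in> mspace X" and a: "a \<in> moment_measures X e 1" and b: "b \<in> moment_measures X e 1"
  shows "KRu_diff X e (KRu_embed X e a) (KRu_embed X e b) = KRu_embed X e (\<lambda>A. a A - b A)"
proof -
  let ?d = "\<lambda>u v. KRu_norm_meas X e (\<lambda>A. u A - v A)"
  note ab = moment_measures_diff[OF e a b]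
  have cls: "KRu_rel X e `` {\<lambda>n A. s n A - t n A} = KRu_embed X e (\<lambda>A. a A - b A)"
    if s: "s \<in> KRu_embed X e a" and t: "t \<in> KRu_embed X e b" for s t
  proof (rule KRu_rel_Image_eq_embed[OF e ab])
    have sM: "\<And>n. s n \<in> moment_measures X e 1" and sl: "(\<lambda>n. ?d a (s n)) \<longlonglongrightarrow> 0"
      using s by (auto simp: KRu_embed_iff[OF e a])
    have tM: "\<And>n. t n \<in> moment_measures X e 1" and tl: "(\<lambda>n. ?d b (t n)) \<longlonglongrightarrow> 0"
      using t by (auto simp: KRu_embed_iff[OF e b])
    have "(\<lambda>n. KRu_norm_meas X e (\<lambda>A. a A - b A - (s n A - t n A))) \<longlonglongrightarrow> 0"
    proof (rule tendsto_sandwich[OF always_eventually always_eventually tendsto_const])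
      show "\<forall>n. 0 \<le> KRu_norm_meas X e (\<lambda>A. a A - b A - (s n A - t n A))"
        using sM tM a b by (intro allI KRu_norm_meas_nonneg[OF e] moment_measures_diff[OF e])
      show "\<forall>n. KRu_norm_meas X e (\<lambda>A. a A - b A - (s n A - t n A)) \<le> ?d a (s n) + ?d b (t n)"
        using KRu_norm_meas_triangle[OF e moment_measures_diff[OF e a sM] moment_measures_diff[OF e tM b]]
          KRu_norm_meas_minus_commute[of X e _ b] by (simp add: algebra_simps)
    qed (use tendsto_add[OF sl tl] in simp)
    then show "(\<lambda>n A. s n A - t n A) \<in> KRu_embed X e (\<lambda>A. a A - b A)"
      using sM tM by (simp add: KRu_embed_iff[OF e ab] moment_measures_diff[OF e])
  qed
  show ?thesis
    unfolding KRu_diff_def using cls KRu_embed_self[OF e a] KRu_embed_self[OF e b] by auto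
qed

text \<open>Elements at which the moment term is finite are thus translates of classes of measures: a
  representative of \<open>u\<close> minus the constant \<open>b\<close> represents the difference, so it tends to \<open>\<nu>\<close>.\<close>

lemma KRu_eq_embed_of_diff:
  assumes e: "e \<in> mspace X" and u: "u \<in> KRu X e" and b: "b \<in> moment_measures X e 1"
    and \<nu>: "\<nu> \<in> moment_measures X e 1"
    and eq: "KRu_diff X e u (KRu_embed X e b) = KRu_embed X e \<nu>"
  shows "u = KRu_embed X e (\<lambda>A. \<nu> A + b A)"
proof -
  obtain s where s: "s \<in> KRu_Cauchy X e" "u = KRu_rel X e `` {s}"
    using u by (auto simp: KRu_def quotient_def)
  note sM = KRu_Cauchy_moment[OF s(1)]
  have refl: "(r, r) \<in> KRu_rel X e" if "r \<in> KRu_Cauchy X e" for r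
    using that by (simp add: KRu_rel_def KRu_norm_meas_0[OF e])
  let ?r = "\<lambda>n A. s n A - b A"
  have "?r \<in> KRu_Cauchy X e"
    using s(1) b by (simp add: KRu_Cauchy_def moment_measures_diff[OF e])
  moreover have "s \<in> u" using s refl by simp
  ultimately have "?r \<in> KRu_diff X e u (KRu_embed X e b)"
    unfolding KRu_diff_def using KRu_embed_self[OF e b] refl[of ?r] by fastforce
  then have lim: "(\<lambda>n. KRu_norm_meas X e (\<lambda>A. \<nu> A - (s n A - b A))) \<longlonglongrightarrow> 0"
    unfolding eq by (simp add: KRu_embed_iff[OF e \<nu>])
  have \<nu>b: "(\<lambda>A. \<nu> A + b A) \<in> moment_measures X e 1" by (rule moment_measures_add[OF e \<nu> b])
  have "s \<in> KRu_embed X e (\<lambda>A. \<nu> A + b A)"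
    using lim sM by (simp add: KRu_embed_iff[OF e \<nu>b] algebra_simps)
  then show ?thesis using s(2) KRu_rel_Image_eq_embed[OF e \<nu>b] by simp
qed

text \<open>A functional that is Lipschitz at \<open>a\<close> in the norm converges along every representative of the
  class of \<open>a\<close>, and the constant representative identifies the limit.\<close>

lemma KRu_extend_embed:
  assumes e: "e \<in> mspace X" and a: "a \<in> moment_measures X e 1"
    and F: "\<And>b. b \<in> moment_measures X e 1 \<Longrightarrow> \<bar>F a - F b\<bar> \<le> D * KRu_norm_meas X e (\<lambda>A. a A - b A)"
  shows "KRu_extend F (KRu_embed X e a) = F a"
  unfolding KRu_extend_def
proof (rule the_equality)
  show "\<forall>s\<in>KRu_embed X e a. (\<lambda>n. F (s n)) \<longlonglongrightarrow> F a"
  proof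
    fix s assume "s \<in> KRu_embed X e a"
    then have s: "\<And>n. s n \<in> moment_measures X e 1"
       "(\<lambda>n. KRu_norm_meas X e (\<lambda>A. a A - s n A)) \<longlonglongrightarrow> 0"
      by (auto simp: KRu_embed_iff[OF e a])
    have "(\<lambda>n. F (s n) - F a) \<longlonglongrightarrow> 0"
    proof (rule Lim_null_comparison)
      show "\<forall>\<^sub>F n in sequentially. norm (F (s n) - F a) \<le> D * KRu_norm_meas X e (\<lambda>A. a A - s n A)"
        using F[OF s(1)] by (intro always_eventually) (simp add: abs_minus_commute)
      show "(\<lambda>n. D * KRu_norm_meas X e (\<lambda>A. a A - s n A)) \<longlonglongrightarrow> 0"
        using tendsto_mult_left[OF s(2), of D] by simp
    qed
    then show "(\<lambda>n. F (s n)) \<longlonglongrightarrow> F a" by (simp add: LIM_zero_iff)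
  qed
next
  fix r assume "\<forall>s\<in>KRu_embed X e a. (\<lambda>n. F (s n)) \<longlonglongrightarrow> r"
  from bspec[OF this KRu_embed_self[OF e a]] have "(\<lambda>n::nat. F a) \<longlonglongrightarrow> r" .
  then show "r = F a" by (simp add: LIMSEQ_const_iff)
qed

lemma KRu_norm_embed:
  assumes e: "e \<in> mspace X" and a: "a \<in> moment_measures X e 1"
  shows "KRu_norm X e (KRu_embed X e a) = KRu_norm_meas X e a"
  unfolding KRu_norm_def
proof (rule KRu_extend_embed[OF e a, of _ 1])
  fix b assume b: "b \<in> moment_measures X e 1"
  show "\<bar>KRu_norm_meas X e a - KRu_norm_meas X e b\<bar> \<le> 1 * KRu_norm_meas X e (\<lambda>A. a A - b A)"
    using KRu_norm_meas_triangle[OF e moment_measures_diff[OF e a b] b]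
      KRu_norm_meas_triangle[OF e moment_measures_diff[OF e b a] a]
      KRu_norm_meas_minus_commute[of X e a b] by simp
qed

lemma KRu_mass_embed:
  assumes e: "e \<in> mspace X" and a: "a \<in> moment_measures X e 1"
  shows "KRu_mass X (KRu_embed X e a) = a (mspace X)"
  unfolding KRu_mass_def
proof (rule KRu_extend_embed[OF e a, of _ 1])
  fix b assume b: "b \<in> moment_measures X e 1"
  show "\<bar>a (mspace X) - b (mspace X)\<bar> \<le> 1 * KRu_norm_meas X e (\<lambda>A. a A - b A)"
    using KR_sup_nonneg[OF e moment_measures_diff[OF e a b]] by (simp add: KRu_norm_meas_eq)
qed

lemma KRu_pairing_embed:
  assumes e: "e \<in> mspace X" and a: "a \<in> moment_measures X e 1"
    and f: "lipschitz_fun X C f" and C: "0 \<le> C"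
  shows "KRu_pairing X (KRu_embed X e a) f = signed_integral X a f"
  unfolding KRu_pairing_def
proof (rule KRu_extend_embed[OF e a])
  fix b assume b: "b \<in> moment_measures X e 1"
  show "\<bar>signed_integral X a f - signed_integral X b f\<bar>
      \<le> (C + \<bar>f e\<bar>) * KRu_norm_meas X e (\<lambda>A. a A - b A)"
    using abs_signed_integral_lipschitz_le[OF e moment_measures_diff[OF e a b] f C]
    by (simp add: signed_integral_diff[OF e a b f])
qed

text \<open>The measure that represents the class is unique because the embedding is injective.\<close>

lemma moment_penalty_embed:
  assumes e: "e \<in> mspace X" and p: "1 \<le> p" and \<nu>: "\<nu> \<in> moment_measures X e p"
  shows "moment_penalty X e p (KRu_embed X e \<nu>)
    = (\<integral>\<^sup>+x. ennreal (1 + mdist X x e powr p) \<partial>total_variation X \<nu>)"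
proof -
  have "(THE \<rho>. \<rho> \<in> moment_measures X e p \<and> KRu_embed X e \<nu> = KRu_embed X e \<rho>) = \<nu>"
    using \<nu> KRu_embed_inj[OF e] moment_measures_subset[OF e p] by (intro the_equality) metis+
  then show ?thesis using \<nu> by (auto simp: moment_penalty_def)
qed

lemma KRu_embed_of_finite_penalty:
  assumes "moment_penalty X e p u \<noteq> \<infinity>"
  obtains \<nu> where "\<nu> \<in> moment_measures X e p" "u = KRu_embed X e \<nu>"
  using assms by (auto simp: moment_penalty_def split: if_splits)

section \<open>Atoms of the regulariser\<close>

definition moment_weight :: "'a metric \<Rightarrow> 'a \<Rightarrow> real \<Rightarrow> 'a \<Rightarrow> real" where
  "moment_weight X e p x = 1 + mdist X x e powr p"

definition regularizer :: "'a metric \<Rightarrow> 'a \<Rightarrow> real \<Rightarrow> real \<Rightarrow> real \<Rightarrow> ('a set \<Rightarrow> real) \<Rightarrow> real" where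
  "regularizer X e p \<alpha> \<beta> \<nu> = \<alpha> * KRu_norm_meas X e \<nu>
     + \<beta> * (LINT x|total_variation X \<nu>. moment_weight X e p x)"

text \<open>The triple \<open>(m, x, y)\<close> stands for the measure \<open>\<delta>\<^sub>x - \<delta>\<^sub>y + m \<delta>\<^sub>e\<close>. The three families are the
  dipoles \<open>\<delta>\<^sub>x - \<delta>\<^sub>y\<close> and the measures \<open>\<delta>\<^sub>x\<close> and \<open>-\<delta>\<^sub>y\<close>; writing all of them as a dipole with a
  correction at the base point gives uniform formulas and the form of the minimiser.\<close>

definition atom_set :: "'a metric \<Rightarrow> 'a \<Rightarrow> (real \<times> 'a \<times> 'a) set" where
  "atom_set X e = {0} \<times> mspace X \<times> mspace X \<union> {1} \<times> mspace X \<times> {e} \<union> {-1} \<times> {e} \<times> mspace X"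

definition atom_measure :: "'a metric \<Rightarrow> 'a \<Rightarrow> real \<times> 'a \<times> 'a \<Rightarrow> 'a set \<Rightarrow> real" where
  "atom_measure X e = (\<lambda>(m, x, y) A. dirac X x A - dirac X y A + m * dirac X e A)"

definition atom_pairing :: "'a \<Rightarrow> ('a \<Rightarrow> real) \<Rightarrow> real \<times> 'a \<times> 'a \<Rightarrow> real" where
  "atom_pairing e f = (\<lambda>(m, x, y). f x - f y + m * f e)"

text \<open>An upper bound for the regulariser on the atom. For \<open>m = 1\<close> or \<open>m = -1\<close> one of the two points
  is the base point, whose weight 1 is cancelled by \<open>\<bar>m\<bar>\<close>.\<close>

definition atom_cost :: "'a metric \<Rightarrow> 'a \<Rightarrow> real \<Rightarrow> real \<Rightarrow> real \<Rightarrow> real \<times> 'a \<times> 'a \<Rightarrow> real" where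
  "atom_cost X e p \<alpha> \<beta> = (\<lambda>(m, x, y). \<alpha> * (\<bar>m\<bar> + mdist X x y)
     + \<beta> * (moment_weight X e p x + moment_weight X e p y - \<bar>m\<bar>))"

lemma moment_weight_ge_1: "1 \<le> moment_weight X e p x"
  by (simp add: moment_weight_def)

lemma moment_weight_nonneg: "0 \<le> moment_weight X e p x"
  by (simp add: moment_weight_def)

lemma moment_weight_base: "e \<in> mspace X \<Longrightarrow> moment_weight X e p e = 1"
  by (simp add: moment_weight_def)

lemma borel_moment_weight:
  "e \<in> mspace X \<Longrightarrow> moment_weight X e p \<in> borel_measurable (mborel X)"
  unfolding moment_weight_def by measurable

lemma integrable_moment_weight:
  assumes e: "e \<in> mspace X" and \<nu>: "\<nu> \<in> moment_measures X e p"
  shows "integrable (total_variation X \<nu>) (moment_weight X e p)"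
proof -
  have "(\<lambda>x. mdist X x e powr p) \<in> borel_measurable (total_variation X \<nu>)"
    using e by measurable
  then have "integrable (total_variation X \<nu>) (\<lambda>x. mdist X x e powr p)"
    using \<nu> by (auto simp: moment_measures_def integrable_iff_bounded)
  then show ?thesis
    unfolding moment_weight_def
    using signed_integral_const(1)[OF moment_measures_signed[OF \<nu>], of 1] by simp
qed

lemma nn_integral_moment_weight:
  assumes "e \<in> mspace X" "\<nu> \<in> moment_measures X e p"
  shows "(\<integral>\<^sup>+x. ennreal (moment_weight X e p x) \<partial>total_variation X \<nu>)
    = ennreal (LINT x|total_variation X \<nu>. moment_weight X e p x)"
  using integrable_moment_weight[OF assms]
  by (intro nn_integral_eq_integral AE_I2 moment_weight_nonneg)

lemma integral_moment_weight_nonneg: "0 \<le> (LINT x|total_variation X \<nu>. moment_weight X e p x)"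
  by (intro integral_nonneg_AE AE_I2 moment_weight_nonneg)

lemma regularizer_nonneg:
  assumes "e \<in> mspace X" "1 \<le> p" "0 \<le> \<alpha>" "0 \<le> \<beta>" "\<nu> \<in> moment_measures X e p"
  shows "0 \<le> regularizer X e p \<alpha> \<beta> \<nu>"
  unfolding regularizer_def using assms
  by (intro add_nonneg_nonneg mult_nonneg_nonneg KRu_norm_meas_nonneg moment_measures_subset
      integral_moment_weight_nonneg)

text \<open>Weak duality. The inequalities for the atoms say exactly that the function \<open>h\<close>
  below exists: it is \<open>s * \<alpha>\<close>-Lipschitz, bounded by \<open>s * \<alpha>\<close> at the base point and within
  \<open>s * \<beta> * (1 + dist(x, e)\<^sup>p)\<close> of \<open>\<psi>\<close>.  The norm controls the integral of \<open>h\<close>, the moment term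
  that of \<open>\<psi> - h\<close>, so no optimal transport plan is needed.\<close>

lemma signed_integral_le_regularizer:
  assumes e: "e \<in> mspace X" and p: "1 \<le> p" and \<alpha>: "0 \<le> \<alpha>" and \<beta>: "0 \<le> \<beta>" and s: "0 \<le> s"
    and \<nu>: "\<nu> \<in> moment_measures X e p" and \<psi>: "lipschitz_fun X C \<psi>"
    and atoms: "\<And>a. a \<in> atom_set X e \<Longrightarrow> atom_pairing e \<psi> a \<le> s * atom_cost X e p \<alpha> \<beta> a"
  shows "signed_integral X \<nu> \<psi> \<le> s * regularizer X e p \<alpha> \<beta> \<nu>"
proof -
  note \<nu>1 = moment_measures_subset[OF e p \<nu>]
  define k where "k = s * \<alpha>"
  define q where "q x = s * \<beta> * moment_weight X e p x" for x
  have k: "0 \<le> k" using s \<alpha> by (simp add: k_def)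
  have q: "0 \<le> q x" for x
    using s \<beta> moment_weight_nonneg[of X e p x] by (simp add: q_def)
  \<comment> \<open>The hypothesis spelled out for the three families of atoms.\<close>
  have dip: "\<psi> x - \<psi> y \<le> k * mdist X x y + q x + q y" if "x \<in> mspace X" "y \<in> mspace X" for x y
    using atoms[of "(0, x, y)"] that
    by (simp add: atom_set_def atom_pairing_def atom_cost_def k_def q_def algebra_simps)
  have pos: "\<psi> x \<le> k * (1 + mdist X x e) + q x" if "x \<in> mspace X" for x
    using atoms[of "(1, x, e)"] that e
    by (simp add: atom_set_def atom_pairing_def atom_cost_def k_def q_def moment_weight_base algebra_simps)
  have neg: "- \<psi> x \<le> k * (1 + mdist X e x) + q x" if "x \<in> mspace X" for x
    using atoms[of "(-1, e, x)"] that e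
    by (simp add: atom_set_def atom_pairing_def atom_cost_def k_def q_def moment_weight_base algebra_simps)
  define g where "g x = (INF y\<in>mspace X. (\<psi> y + q y) + k * mdist X x y)" for x
  define h where "h x = min (g x) (k * (1 + mdist X x e))" for x
  have low: "\<psi> x - q x \<le> (\<psi> y + q y) + k * mdist X x y" if "x \<in> mspace X" "y \<in> mspace X" for x y
    using dip[OF that] by simp
  have bdd: "bdd_below ((\<lambda>y. (\<psi> y + q y) + k * mdist X x y) ` mspace X)" if "x \<in> mspace X" for x
    using low[OF that] by (rule bdd_belowI2)
  have ne: "mspace X \<noteq> {}" using e by blast
  have "lipschitz_fun X k g"
    unfolding g_def[abs_def] by (rule inf_convolution_lipschitz[OF _ ne k bdd]) auto
  moreover have "lipschitz_fun X k (\<lambda>x. k * (1 + mdist X x e))"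
  proof (rule lipschitz_funI)
    fix x y assume "x \<in> mspace X" "y \<in> mspace X"
    then have "k * mdist X x e \<le> k * (mdist X y e + mdist X x y)"
      using lipschitz_funD[OF lipschitz_fun_mdist[OF e], of x y] k by (intro mult_left_mono) auto
    then show "k * (1 + mdist X x e) \<le> k * (1 + mdist X y e) + k * mdist X x y"
      by (simp add: algebra_simps)
  qed
  ultimately have h: "lipschitz_fun X k h"
    unfolding h_def[abs_def] by (rule lipschitz_fun_min)
  have gl: "\<psi> x - q x \<le> g x" if "x \<in> mspace X" for x
    unfolding g_def using low[OF that] ne by (intro cINF_greatest)
  have gu: "g x \<le> \<psi> x + q x" if "x \<in> mspace X" for x
  proof -
    have "mdist X x x = 0" using that by simp
    then show ?thesis using cINF_lower[OF bdd[OF that] that] by (simp add: g_def)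
  qed
  have close: "\<bar>\<psi> x - h x\<bar> \<le> q x" if "x \<in> mspace X" for x
    using gl[OF that] gu[OF that] pos[OF that] by (auto simp: h_def abs_le_iff min_def)
  have "- k \<le> g e"
    unfolding g_def using neg by (intro cINF_greatest[OF ne]) (fastforce simp: algebra_simps)
  moreover have "mdist X e e = 0" using e by simp
  ultimately have he: "\<bar>h e\<bar> \<le> k" using k by (auto simp: h_def abs_le_iff min_def)
  have diff: "lipschitz_fun X (C + k) (\<lambda>x. \<psi> x - h x)"
  proof (rule lipschitz_funI)
    fix x y assume xy: "x \<in> mspace X" "y \<in> mspace X"
    show "\<psi> x - h x \<le> \<psi> y - h y + (C + k) * mdist X x y"
      using lipschitz_funD[OF \<psi> xy] lipschitz_funD[OF h xy(2,1)]
      by (simp add: mdist_commute[of X y x] algebra_simps)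
  qed
  note int = integrable_lipschitz_fun[OF e \<nu>1]
  have "signed_integral X \<nu> \<psi> = signed_integral X \<nu> (\<lambda>x. h x + (\<psi> x - h x))" by simp
  also have "\<dots> = signed_integral X \<nu> h + signed_integral X \<nu> (\<lambda>x. \<psi> x - h x)"
    by (rule signed_integral_add_fun[OF int[OF h] int[OF diff]])
  also have "signed_integral X \<nu> h \<le> k * KR_sup X e \<nu> + k * \<bar>\<nu> (mspace X)\<bar>"
  proof -
    have "h e * \<nu> (mspace X) \<le> \<bar>h e\<bar> * \<bar>\<nu> (mspace X)\<bar>"
      using abs_ge_self[of "h e * \<nu> (mspace X)"] by (simp add: abs_mult)
    also have "\<dots> \<le> k * \<bar>\<nu> (mspace X)\<bar>" using he by (intro mult_right_mono) auto
    finally show ?thesis using signed_integral_lipschitz_le[OF e \<nu>1 h k] by simp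
  qed
  also have "signed_integral X \<nu> (\<lambda>x. \<psi> x - h x) \<le> (LINT x|total_variation X \<nu>. \<bar>\<psi> x - h x\<bar>)"
    using abs_signed_integral_le[OF int[OF diff]] by simp
  also have "\<dots> \<le> (LINT x|total_variation X \<nu>. q x)"
  proof (rule integral_mono)
    show "integrable (total_variation X \<nu>) (\<lambda>x. \<bar>\<psi> x - h x\<bar>)" using int[OF diff] by simp
    show "integrable (total_variation X \<nu>) q"
      unfolding q_def[abs_def] using integrable_moment_weight[OF e \<nu>] by simp
    show "\<bar>\<psi> x - h x\<bar> \<le> q x" if "x \<in> space (total_variation X \<nu>)" for x
      using close that by simp
  qed
  also have "\<dots> = s * \<beta> * (LINT x|total_variation X \<nu>. moment_weight X e p x)"
    by (simp add: q_def)
  finally show ?thesis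
    by (simp add: regularizer_def KRu_norm_meas_eq k_def algebra_simps)
qed

lemma nn_integral_total_variation_sum:
  assumes J: "finite J" "\<And>j. j \<in> J \<Longrightarrow> 0 \<le> t j" "\<And>j. j \<in> J \<Longrightarrow> \<mu> j \<in> signed_measures X"
    and f: "f \<in> borel_measurable (mborel X)"
  shows "(\<integral>\<^sup>+x. f x \<partial>total_variation X (\<lambda>A. \<Sum>j\<in>J. t j * \<mu> j A))
     \<le> (\<Sum>j\<in>J. ennreal (t j) * (\<integral>\<^sup>+x. f x \<partial>total_variation X (\<mu> j)))
     \<and> (\<lambda>A. \<Sum>j\<in>J. t j * \<mu> j A) \<in> signed_measures X"
  using J
proof (induction J rule: finite_induct)
  case empty
  then show ?case
    using nn_integral_total_variation_scale[OF signed_measures_zero f, of 0] signed_measures_zero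
    by simp
next
  case (insert j J)
  let ?\<nu> = "\<lambda>A. \<Sum>j\<in>J. t j * \<mu> j A"
  have IH: "(\<integral>\<^sup>+x. f x \<partial>total_variation X ?\<nu>) \<le> (\<Sum>j\<in>J. ennreal (t j) * (\<integral>\<^sup>+x. f x \<partial>total_variation X (\<mu> j)))"
     "?\<nu> \<in> signed_measures X" using insert by auto
  have j: "(\<lambda>A. t j * \<mu> j A) \<in> signed_measures X" using insert by (intro signed_measures_scale) auto
  show ?case
    using nn_integral_total_variation_add[OF j IH(2) f] IH insert signed_measures_add[OF j IH(2)]
      nn_integral_total_variation_scale[of "\<mu> j" X f "t j", OF _ f]
    by (auto intro: order_trans[OF _ add_left_mono])
qed

lemma atom_measure_moment_measures:
  assumes e: "e \<in> mspace X" and a: "a \<in> atom_set X e"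
  shows "atom_measure X e a \<in> moment_measures X e p"
proof -
  obtain m x y where a': "a = (m, x, y)" "x \<in> mspace X" "y \<in> mspace X"
    using a e by (auto simp: atom_set_def)
  then show ?thesis
    unfolding atom_measure_def a'(1) case_prod_conv
    by (intro moment_measures_add[OF e] moment_measures_diff[OF e] moment_measures_scale[OF e]
        moment_measures_dirac[OF e] e)
qed

lemma signed_integral_atom_measure:
  assumes e: "e \<in> mspace X" and a: "a \<in> atom_set X e" and f: "lipschitz_fun X C f"
  shows "signed_integral X (atom_measure X e a) f = atom_pairing e f a"
proof -
  obtain m x y where a': "a = (m, x, y)" "x \<in> mspace X" "y \<in> mspace X"
    using a e by (auto simp: atom_set_def)
  note b = lipschitz_fun_borel[OF f]
  note dm = moment_measures_dirac[OF e, of _ 1]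
  have "signed_integral X (\<lambda>A. (dirac X x A - dirac X y A) + m * dirac X e A) f
      = signed_integral X (\<lambda>A. dirac X x A - dirac X y A) f + signed_integral X (\<lambda>A. m * dirac X e A) f"
    using a' e by (intro signed_integral_add moment_measures_signed[of _ X e 1]
        integrable_lipschitz_fun[OF e _ f] moment_measures_diff moment_measures_scale dm)
  also have "\<dots> = f x - f y + m * f e"
    using a' e by (simp add: signed_integral_diff[OF e dm dm f] signed_integral_dirac[OF _ b]
        signed_integral_scale[OF dirac_signed_measures integrable_dirac[OF _ b]])
  finally show ?thesis by (simp add: atom_measure_def atom_pairing_def a'(1))
qed

lemma nn_integral_atom_measure_le:
  assumes e: "e \<in> mspace X" and a: "(m, x, y) \<in> atom_set X e"
  shows "(\<integral>\<^sup>+z. ennreal (moment_weight X e p z) \<partial>total_variation X (atom_measure X e (m, x, y)))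
    \<le> ennreal (moment_weight X e p x + moment_weight X e p y - \<bar>m\<bar>)"
proof -
  let ?I = "\<lambda>\<mu>. \<integral>\<^sup>+z. ennreal (moment_weight X e p z) \<partial>total_variation X \<mu>"
  have b: "(\<lambda>z. ennreal (moment_weight X e p z)) \<in> borel_measurable (mborel X)"
    using borel_moment_weight[OF e] by simp
  have d: "?I (dirac X z) \<le> ennreal (moment_weight X e p z)"
      "?I (\<lambda>A. - dirac X z A) \<le> ennreal (moment_weight X e p z)" if "z \<in> mspace X" for z
    using nn_integral_total_variation_dirac[OF that b] by (simp_all add: total_variation_uminus)
  consider "m = 0" "x \<in> mspace X" "y \<in> mspace X" | "m = 1" "y = e" "x \<in> mspace X" | "m = -1" "x = e" "y \<in> mspace X"
    using a by (auto simp: atom_set_def)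
  then show ?thesis
  proof cases
    case 1
    have "?I (\<lambda>A. dirac X x A + (- dirac X y A)) \<le> ?I (dirac X x) + ?I (\<lambda>A. - dirac X y A)"
      using 1 by (intro nn_integral_total_variation_add b dirac_signed_measures uminus_signed_measures)
    also have "\<dots> \<le> ennreal (moment_weight X e p x) + ennreal (moment_weight X e p y)"
      using 1 d by (intro add_mono) auto
    also have "\<dots> = ennreal (moment_weight X e p x + moment_weight X e p y)"
      using moment_weight_ge_1[of X e p x] moment_weight_ge_1[of X e p y]
      by (intro ennreal_plus[symmetric]) auto
    finally show ?thesis using 1 by (simp add: atom_measure_def)
  next
    case 2
    then show ?thesis using d[of x] e by (simp add: atom_measure_def moment_weight_base)
  next
    case 3
    then show ?thesis using d[of y] e by (simp add: atom_measure_def moment_weight_base)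
  qed
qed

lemma atom_cost_pos:
  assumes "0 \<le> \<alpha>" "0 < \<beta>" "\<bar>m\<bar> \<le> 1"
  shows "0 < atom_cost X e p \<alpha> \<beta> (m, x, y)"
proof -
  have "0 < \<beta> * (moment_weight X e p x + moment_weight X e p y - \<bar>m\<bar>)"
    using assms moment_weight_ge_1[of X e p x] moment_weight_ge_1[of X e p y]
    by (intro mult_pos_pos) auto
  moreover have "0 \<le> \<alpha> * (\<bar>m\<bar> + mdist X x y)" using assms by simp
  ultimately show ?thesis unfolding atom_cost_def case_prod_conv by linarith
qed

lemma atom_cost_pos_atom_set:
  "0 \<le> \<alpha> \<Longrightarrow> 0 < \<beta> \<Longrightarrow> a \<in> atom_set X e \<Longrightarrow> 0 < atom_cost X e p \<alpha> \<beta> a"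
  by (auto simp: atom_set_def intro!: atom_cost_pos)

text \<open>The Kantorovich--Rubinstein part of the bound comes from testing with a 1-Lipschitz function
  that vanishes at \<open>e\<close>, for which an atom contributes \<open>f x - f y\<close>; the moment part is subadditivity
  of the total variation.\<close>

lemma
  assumes e: "e \<in> mspace X" and p: "1 \<le> p" and \<alpha>: "0 \<le> \<alpha>" and \<beta>: "0 < \<beta>"
    and J: "finite J" and t: "\<And>j. j \<in> J \<Longrightarrow> 0 \<le> t j" and a: "\<And>j. j \<in> J \<Longrightarrow> a j \<in> atom_set X e"
  defines "\<nu> \<equiv> \<lambda>A. \<Sum>j\<in>J. t j * atom_measure X e (a j) A"
  shows atomic_moment_measures: "\<nu> \<in> moment_measures X e p"
    and signed_integral_atomic:
      "lipschitz_fun X C f \<Longrightarrow> signed_integral X \<nu> f = (\<Sum>j\<in>J. t j * atom_pairing e f (a j))"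
    and regularizer_atomic_le: "regularizer X e p \<alpha> \<beta> \<nu> \<le> (\<Sum>j\<in>J. t j * atom_cost X e p \<alpha> \<beta> (a j))"
proof -
  note am = atom_measure_moment_measures[OF e]
  show \<nu>: "\<nu> \<in> moment_measures X e p"
    unfolding \<nu>_def using a by (intro moment_measures_sum[OF e J] moment_measures_scale[OF e] am)
  note \<nu>1 = moment_measures_subset[OF e p \<nu>]
  have scale: "signed_integral X (\<lambda>A. c * \<mu> A) f = c * signed_integral X \<mu> f"
    if "\<mu> \<in> moment_measures X e 1" "lipschitz_fun X C f" for c \<mu> C f
    using that by (intro signed_integral_scale moment_measures_signed[of _ X e 1] integrable_lipschitz_fun[OF e])
  show sig: "signed_integral X \<nu> f = (\<Sum>j\<in>J. t j * atom_pairing e f (a j))"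
    if f: "lipschitz_fun X C f" for f C
    unfolding \<nu>_def using J t a
  proof (induction J rule: finite_induct)
    case empty
    then show ?case using signed_integral_uminus[of X "\<lambda>A. 0" f] by simp
  next
    case (insert j J)
    have j: "(\<lambda>A. t j * atom_measure X e (a j) A) \<in> moment_measures X e 1"
      using insert by (intro moment_measures_scale[OF e] am) auto
    have J': "(\<lambda>A. \<Sum>j\<in>J. t j * atom_measure X e (a j) A) \<in> moment_measures X e 1"
      using insert by (intro moment_measures_sum[OF e] moment_measures_scale[OF e] am) auto
    have "signed_integral X (\<lambda>A. t j * atom_measure X e (a j) A + (\<Sum>j\<in>J. t j * atom_measure X e (a j) A)) f
      = signed_integral X (\<lambda>A. t j * atom_measure X e (a j) A) f
        + signed_integral X (\<lambda>A. \<Sum>j\<in>J. t j * atom_measure X e (a j) A) f"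
      using j J' by (intro signed_integral_add moment_measures_signed[of _ X e 1] integrable_lipschitz_fun[OF e _ f])
    then show ?case
      using insert scale[of "atom_measure X e (a j)" C f "t j"] am[of "a j" 1] f
        signed_integral_atom_measure[OF e _ f, of "a j"] by simp
  qed
  define m where "m j = fst (a j)" for j
  define x where "x j = fst (snd (a j))" for j
  define y where "y j = snd (snd (a j))" for j
  have aj: "a j = (m j, x j, y j)" for j by (simp add: m_def x_def y_def)
  have xy: "x j \<in> mspace X" "y j \<in> mspace X" if "j \<in> J" for j
    using a[OF that] e unfolding aj by (auto simp: atom_set_def)
  have top: "mspace X \<in> sets (mborel X)" using sets.top[of "mborel X"] by simp
  have "\<bar>\<nu> (mspace X)\<bar> = \<bar>\<Sum>j\<in>J. t j * m j\<bar>"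
    unfolding \<nu>_def using xy e top
    by (intro arg_cong[where f = abs] sum.cong refl) (auto simp: aj atom_measure_def dirac_def)
  also have "\<dots> \<le> (\<Sum>j\<in>J. t j * \<bar>m j\<bar>)"
    using sum_abs[of "\<lambda>j. t j * m j" J] t by (simp add: abs_mult)
  finally have mass: "\<bar>\<nu> (mspace X)\<bar> \<le> (\<Sum>j\<in>J. t j * \<bar>m j\<bar>)" .
  have kr: "KR_sup X e \<nu> \<le> (\<Sum>j\<in>J. t j * mdist X (x j) (y j))"
  proof (rule KR_sup_least)
    fix f assume f: "lipschitz_fun X 1 f" "f e = 0"
    have "signed_integral X \<nu> f = (\<Sum>j\<in>J. t j * (f (x j) - f (y j)))"
      unfolding sig[OF f(1)] by (simp add: aj atom_pairing_def f(2))
    also have "\<dots> \<le> (\<Sum>j\<in>J. t j * mdist X (x j) (y j))"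
    proof (intro sum_mono mult_left_mono t)
      fix j assume "j \<in> J"
      then show "f (x j) - f (y j) \<le> mdist X (x j) (y j)"
        using lipschitz_funD[OF f(1) xy] by fastforce
    qed
    finally show "signed_integral X \<nu> f \<le> (\<Sum>j\<in>J. t j * mdist X (x j) (y j))" .
  qed
  let ?w = "moment_weight X e p"
  have w: "0 \<le> ?w (x j) + ?w (y j) - \<bar>m j\<bar>" if "j \<in> J" for j
    using a[OF that] moment_weight_ge_1[of X e p "x j"] moment_weight_ge_1[of X e p "y j"]
    unfolding aj by (auto simp: atom_set_def)
  have wb: "(\<lambda>z. ennreal (?w z)) \<in> borel_measurable (mborel X)"
    using borel_moment_weight[OF e] by simp
  have "ennreal (LINT z|total_variation X \<nu>. ?w z) = (\<integral>\<^sup>+z. ennreal (?w z) \<partial>total_variation X \<nu>)"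
    by (rule nn_integral_moment_weight[OF e \<nu>, symmetric])
  also have "\<dots> \<le> (\<Sum>j\<in>J. ennreal (t j) * (\<integral>\<^sup>+z. ennreal (?w z) \<partial>total_variation X (atom_measure X e (a j))))"
    unfolding \<nu>_def
    using nn_integral_total_variation_sum[of J t "\<lambda>j. atom_measure X e (a j)" X, OF J t _ wb]
      moment_measures_signed[OF am[OF a, of _ 1]] by blast
  also have "\<dots> \<le> (\<Sum>j\<in>J. ennreal (t j) * ennreal (?w (x j) + ?w (y j) - \<bar>m j\<bar>))"
    using a nn_integral_atom_measure_le[OF e] unfolding aj by (intro sum_mono mult_left_mono) auto
  also have "\<dots> = ennreal (\<Sum>j\<in>J. t j * (?w (x j) + ?w (y j) - \<bar>m j\<bar>))"
    using t w by (subst sum_ennreal[symmetric]) (auto simp: ennreal_mult intro!: sum.cong)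
  finally have tv: "(LINT z|total_variation X \<nu>. ?w z) \<le> (\<Sum>j\<in>J. t j * (?w (x j) + ?w (y j) - \<bar>m j\<bar>))"
    using t w by (subst (asm) ennreal_le_iff) (auto intro!: sum_nonneg mult_nonneg_nonneg)
  have "regularizer X e p \<alpha> \<beta> \<nu> \<le> \<alpha> * ((\<Sum>j\<in>J. t j * \<bar>m j\<bar>) + (\<Sum>j\<in>J. t j * mdist X (x j) (y j)))
      + \<beta> * (\<Sum>j\<in>J. t j * (?w (x j) + ?w (y j) - \<bar>m j\<bar>))"
    unfolding regularizer_def KRu_norm_meas_eq
    using mass kr tv \<alpha> \<beta> by (intro add_mono mult_left_mono) auto
  also have "\<dots> = (\<Sum>j\<in>J. t j * atom_cost X e p \<alpha> \<beta> (a j))"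
    unfolding sum_distrib_left sum.distrib[symmetric]
    by (intro sum.cong refl) (simp add: aj atom_cost_def algebra_simps)
  finally show "regularizer X e p \<alpha> \<beta> \<nu> \<le> (\<Sum>j\<in>J. t j * atom_cost X e p \<alpha> \<beta> (a j))" .
qed

section \<open>Compactness of the moment vectors of atoms\<close>

lemma open_fun_contains_small:
  fixes U :: "('i \<Rightarrow> real) set"
  assumes "open U" "(\<lambda>_. 0) \<in> U" "finite I"
  shows "\<exists>\<epsilon>>0. \<forall>v. (\<forall>i\<in>I. \<bar>v i\<bar> < \<epsilon>) \<longrightarrow> (\<forall>i. i \<notin> I \<longrightarrow> v i = 0) \<longrightarrow> v \<in> U"
proof -
  have "openin (product_topology (\<lambda>_. euclideanreal) UNIV) U"
    using assms(1) by (simp add: euclidean_product_topology)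
  from product_topology_open_contains_basis[OF this assms(2)]
  obtain Y where Y: "\<And>i. open (Y i)" "\<And>i. 0 \<in> Y i" "PiE UNIV Y \<subseteq> U" by (auto simp: PiE_iff)
  have "\<exists>\<epsilon>>0. ball 0 \<epsilon> \<subseteq> Y i" for i using Y(1,2) openE by meson
  then obtain \<delta> where \<delta>: "\<And>i. 0 < \<delta> i" "\<And>i. ball 0 (\<delta> i) \<subseteq> Y i" by metis
  define \<epsilon> where "\<epsilon> = Min (insert 1 (\<delta> ` I))"
  have "0 < \<epsilon>" using assms(3) \<delta>(1) by (simp add: \<epsilon>_def)
  moreover have "v \<in> U" if v: "\<forall>i\<in>I. \<bar>v i\<bar> < \<epsilon>" "\<forall>i. i \<notin> I \<longrightarrow> v i = 0" for v
  proof -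
    have "v i \<in> Y i" for i
    proof (cases "i \<in> I")
      case True
      then have "\<epsilon> \<le> \<delta> i" unfolding \<epsilon>_def using assms(3) by (intro Min_le) auto
      then have "v i \<in> ball 0 (\<delta> i)" using v(1) True by (force simp: dist_real_def)
      then show ?thesis using \<delta>(2) by blast
    qed (use v Y in simp)
    then show ?thesis using Y(3) by auto
  qed
  ultimately show ?thesis by blast
qed

text \<open>With \<open>M = max u v\<close> the left-hand side is at most \<open>(A + 2 * C) * M\<close> for \<open>M \<ge> 1\<close>, and \<open>R\<close> is the
  value of \<open>M\<close> beyond which \<open>c * M\<^sup>p\<close> is larger.\<close>

lemma superlinear_dominates_linear:
  fixes p c A C :: real
  assumes p: "1 < p" and c: "0 < c" and A: "0 \<le> A" and C: "0 \<le> C"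
  shows "\<exists>R. \<forall>u v. 0 \<le> u \<longrightarrow> 0 \<le> v \<longrightarrow> R < max u v \<longrightarrow> A + C * (u + v) < c * (u powr p + v powr p)"
proof (intro exI allI impI)
  define K where "K = (A + 2 * C) / c"
  define R where "R = max 1 (K powr (1 / (p - 1)))"
  fix u v :: real assume uv: "0 \<le> u" "0 \<le> v" "max 1 (((A + 2 * C) / c) powr (1 / (p - 1))) < max u v"
  define M where "M = max u v"
  have M: "1 < M" "K powr (1 / (p - 1)) < M" using uv(3) by (auto simp: M_def K_def)
  have K: "0 \<le> K" using A C c by (simp add: K_def)
  have "K = (K powr (1 / (p - 1))) powr (p - 1)" using p K by (simp add: powr_powr)
  also have "\<dots> < M powr (p - 1)" using M p by (intro powr_less_mono2) auto
  finally have "A + 2 * C < c * M powr (p - 1)" using c by (simp add: K_def pos_divide_less_eq mult.commute)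
  then have "(A + 2 * C) * M < c * M powr (p - 1) * M" using M by (intro mult_strict_right_mono) auto
  also have "\<dots> = c * M powr p" using M by (simp add: powr_diff)
  also have "\<dots> \<le> c * (u powr p + v powr p)"
    using c by (intro mult_left_mono) (auto simp: M_def max_def)
  finally have *: "(A + 2 * C) * M < c * (u powr p + v powr p)" .
  have "C * (u + v) \<le> C * (2 * M)" using C by (intro mult_left_mono) (auto simp: M_def)
  moreover have "A \<le> A * M" using A M mult_left_mono[of 1 M A] by simp
  ultimately show "A + C * (u + v) < c * (u powr p + v powr p)" using * by (simp add: distrib_right)
qed

text \<open>The moment vector of an atom per unit of cost, extended by 0 off the index set as the
  convexity results require.\<close>

definition atom_direction ::
  "'a metric \<Rightarrow> 'a \<Rightarrow> real \<Rightarrow> real \<Rightarrow> real \<Rightarrow> 'i set \<Rightarrow> ('i \<Rightarrow> 'a \<Rightarrow> real) \<Rightarrow> real \<times> 'a \<times> 'a \<Rightarrow> 'i \<Rightarrow> real"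
  where "atom_direction X e p \<alpha> \<beta> I \<phi> a =
    (\<lambda>i. if i \<in> I then atom_pairing e (\<phi> i) a / atom_cost X e p \<alpha> \<beta> a else 0)"

lemma continuous_map_atom_direction:
  assumes e: "e \<in> mspace X" and p: "0 < p" and \<alpha>: "0 \<le> \<alpha>" and \<beta>: "0 < \<beta>" and m: "\<bar>m\<bar> \<le> 1"
    and \<phi>: "\<And>i. i \<in> I \<Longrightarrow> lipschitz_fun X (C i) (\<phi> i)"
  shows "continuous_map (prod_topology (mtopology_of X) (mtopology_of X)) euclidean
    (\<lambda>z. atom_direction X e p \<alpha> \<beta> I \<phi> (m, z))"
proof -
  let ?P = "prod_topology (mtopology_of X) (mtopology_of X)"
  have f: "continuous_map ?P (mtopology_of X) fst" and s: "continuous_map ?P (mtopology_of X) snd"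
    by (rule continuous_map_fst, rule continuous_map_snd)
  have const: "continuous_map ?P (mtopology_of X) (\<lambda>_. e)" using e by simp
  \<comment> \<open>Truncation at 0 makes the power continuous on the whole line.\<close>
  have pow: "continuous_on UNIV (\<lambda>r::real. max 0 r powr p)"
    using p by (intro continuous_on_powr' continuous_intros) auto
  have w: "continuous_map ?P euclideanreal (\<lambda>z. moment_weight X e p (g z))"
    if "continuous_map ?P (mtopology_of X) g" for g
  proof -
    have "continuous_map ?P euclideanreal ((\<lambda>r. max 0 r powr p) \<circ> (\<lambda>z. mdist X (g z) e))"
      using that const pow by (intro continuous_map_compose[OF continuous_map_mdist]) auto
    then have "continuous_map ?P euclideanreal (\<lambda>z. mdist X (g z) e powr p)"
      by (simp add: o_def max_absorb2)
    then show ?thesis unfolding moment_weight_def by (intro continuous_map_add) auto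
  qed
  have cost: "continuous_map ?P euclideanreal (\<lambda>z. atom_cost X e p \<alpha> \<beta> (m, z))"
    unfolding atom_cost_def case_prod_beta fst_conv snd_conv
    by (intro continuous_map_add continuous_map_diff continuous_map_real_mult continuous_map_mdist
        f s w continuous_map_canonical_const)
  have \<phi>c: "continuous_map ?P euclideanreal (\<lambda>z. \<phi> i (g z))"
    if "i \<in> I" "continuous_map ?P (mtopology_of X) g" for i g
    using continuous_map_compose[OF that(2) lipschitz_fun_continuous_map[OF \<phi>[OF that(1)]]]
    by (simp add: o_def)
  have "continuous_map ?P euclideanreal (\<lambda>z. atom_direction X e p \<alpha> \<beta> I \<phi> (m, z) i)" for i
  proof (cases "i \<in> I")
    case True
    have "continuous_map ?P euclideanreal (\<lambda>z. atom_pairing e (\<phi> i) (m, z))"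
      unfolding atom_pairing_def case_prod_beta fst_conv snd_conv
      by (intro continuous_map_add continuous_map_diff \<phi>c[OF True] f s continuous_map_canonical_const)
    moreover have "atom_cost X e p \<alpha> \<beta> (m, z) \<noteq> 0" for z
      using atom_cost_pos[OF \<alpha> \<beta> m, of X e p "fst z" "snd z"] by simp
    ultimately show ?thesis
      using True cost by (simp add: atom_direction_def continuous_map_real_divide)
  qed (simp add: atom_direction_def)
  then have "continuous_map ?P (product_topology (\<lambda>_. euclideanreal) UNIV)
      (\<lambda>z. atom_direction X e p \<alpha> \<beta> I \<phi> (m, z))"
    by (intro continuous_map_coordinatewise_then_product) auto
  then show ?thesis by (simp add: euclidean_product_topology)
qed

text \<open>Since \<open>p > 1\<close>, the cost of an atom far away outweighs its pairing with any Lipschitz function,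
  so directions can only accumulate at 0 or at directions of atoms.\<close>

lemma compact_directions_family:
  fixes X :: "'a metric" and \<phi> :: "'i \<Rightarrow> 'a \<Rightarrow> real"
  assumes e: "e \<in> mspace X" and p: "1 < p" and \<alpha>: "0 \<le> \<alpha>" and \<beta>: "0 < \<beta>" and m: "\<bar>m\<bar> \<le> 1"
    and I: "finite I" and \<phi>: "\<And>i. i \<in> I \<Longrightarrow> lipschitz_fun X (C i) (\<phi> i)"
    and S: "S \<subseteq> mspace X \<times> mspace X"
      "\<And>R. compactin (prod_topology (mtopology_of X) (mtopology_of X)) (S \<inter> (mcball_of X e R \<times> mcball_of X e R))"
  shows "compact (insert (\<lambda>_. 0) ((\<lambda>z. atom_direction X e p \<alpha> \<beta> I \<phi> (m, z)) ` S))"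
proof (rule compact_insert_limit)
  let ?dir = "\<lambda>z. atom_direction X e p \<alpha> \<beta> I \<phi> (m, z)"
  let ?B = "\<lambda>R. mcball_of X e R"
  fix U :: "('i \<Rightarrow> real) set" assume U: "open U" "(\<lambda>_. 0) \<in> U"
  obtain \<epsilon> where \<epsilon>: "\<epsilon> > 0"
    "\<And>v. \<forall>i\<in>I. \<bar>v i\<bar> < \<epsilon> \<Longrightarrow> \<forall>i. i \<notin> I \<longrightarrow> v i = 0 \<Longrightarrow> v \<in> U"
    using open_fun_contains_small[OF U I] by blast
  define A where "A = (\<Sum>i\<in>I. \<bar>\<phi> i e\<bar>)"
  define D where "D = (\<Sum>i\<in>I. \<bar>C i\<bar>)"
  have AD: "0 \<le> A" "0 \<le> D" by (auto simp: A_def D_def sum_nonneg)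
  obtain R where R: "\<And>u v. 0 \<le> u \<Longrightarrow> 0 \<le> v \<Longrightarrow> R < max u v \<Longrightarrow>
      A + D * (u + v) < (\<epsilon> * \<beta>) * (u powr p + v powr p)"
    using superlinear_dominates_linear[OF p _ AD, of "\<epsilon> * \<beta>"] \<epsilon>(1) \<beta> by auto
  have "?dir z \<in> U" if z: "z \<in> S" "z \<notin> ?B R \<times> ?B R" for z
  proof (rule \<epsilon>(2))
    obtain x y where xy: "z = (x, y)" "x \<in> mspace X" "y \<in> mspace X" using z(1) S(1) by auto
    define u where "u = mdist X x e"
    define v where "v = mdist X y e"
    have "R < max u v" using z(2) xy e by (auto simp: u_def v_def mdist_commute)
    then have lt: "A + D * (u + v) < (\<epsilon> * \<beta>) * (u powr p + v powr p)"
      by (intro R) (auto simp: u_def v_def)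
    have cost: "\<beta> * (u powr p + v powr p) \<le> atom_cost X e p \<alpha> \<beta> (m, x, y)"
    proof -
      have "0 \<le> \<alpha> * (\<bar>m\<bar> + mdist X x y)" using \<alpha> by simp
      moreover have "\<beta> * (u powr p + v powr p) \<le> \<beta> * (moment_weight X e p x + moment_weight X e p y - \<bar>m\<bar>)"
        using \<beta> m by (intro mult_left_mono) (auto simp: moment_weight_def u_def v_def)
      ultimately show ?thesis by (simp add: atom_cost_def)
    qed
    show "\<forall>i\<in>I. \<bar>?dir z i\<bar> < \<epsilon>"
    proof
      fix i assume i: "i \<in> I"
      have "\<bar>\<phi> i x - \<phi> i y\<bar> \<le> C i * mdist X x y"
        using \<phi>[OF i] xy by (simp add: lipschitz_fun_def)
      also have "\<dots> \<le> \<bar>C i\<bar> * mdist X x y" by (intro mult_right_mono) auto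
      also have "\<dots> \<le> D * (u + v)"
      proof (rule mult_mono)
        show "\<bar>C i\<bar> \<le> D" unfolding D_def using i I by (intro member_le_sum) auto
        show "mdist X x y \<le> u + v"
          using mdist_triangle[of x X e y] xy e by (simp add: u_def v_def mdist_commute[of X e y])
      qed (use AD in auto)
      finally have 1: "\<bar>\<phi> i x - \<phi> i y\<bar> \<le> D * (u + v)" .
      have "\<bar>m * \<phi> i e\<bar> \<le> 1 * \<bar>\<phi> i e\<bar>" unfolding abs_mult using m by (intro mult_right_mono) auto
      also have "\<dots> \<le> A" unfolding A_def using i I member_le_sum[of i I "\<lambda>i. \<bar>\<phi> i e\<bar>"] by auto
      finally have "\<bar>atom_pairing e (\<phi> i) (m, x, y)\<bar> \<le> A + D * (u + v)"
        using 1 by (simp add: atom_pairing_def)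
      also have "\<dots> < \<epsilon> * (\<beta> * (u powr p + v powr p))" using lt by (simp add: mult.assoc)
      also have "\<dots> \<le> \<epsilon> * atom_cost X e p \<alpha> \<beta> (m, x, y)" using cost \<epsilon>(1) by (intro mult_left_mono) auto
      finally show "\<bar>?dir z i\<bar> < \<epsilon>"
        using i xy(1) atom_cost_pos[OF \<alpha> \<beta> m, of X e p x y]
        by (simp add: atom_direction_def pos_divide_less_eq)
    qed
    show "\<forall>i. i \<notin> I \<longrightarrow> ?dir z i = 0" by (simp add: atom_direction_def)
  qed
  then have "?dir ` S \<subseteq> U \<union> ?dir ` (S \<inter> (?B R \<times> ?B R))" by blast
  moreover have "continuous_map (prod_topology (mtopology_of X) (mtopology_of X)) euclidean ?dir"
    by (rule continuous_map_atom_direction[OF e _ \<alpha> \<beta> m \<phi>]) (use p in auto)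
  then have "compact (?dir ` (S \<inter> (?B R \<times> ?B R)))"
    using image_compactin[OF S(2)] by (metis compactin_euclidean_iff)
  ultimately show "\<exists>K. compact K \<and> K \<subseteq> ?dir ` S \<and> ?dir ` S \<subseteq> U \<union> K" by blast
qed

lemma compact_atom_directions:
  assumes e: "e \<in> mspace X" and p: "1 < p" and \<alpha>: "0 \<le> \<alpha>" and \<beta>: "0 < \<beta>"
    and I: "finite I" and \<phi>: "\<And>i. i \<in> I \<Longrightarrow> lipschitz_fun X (C i) (\<phi> i)"
    and balls: "\<And>R. compactin (mtopology_of X) (mcball_of X e R)"
  shows "compact (insert (\<lambda>_. 0) (atom_direction X e p \<alpha> \<beta> I \<phi> ` atom_set X e))"
proof -
  let ?B = "\<lambda>R. mcball_of X e R"
  let ?T = "mtopology_of X"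
  let ?K = "\<lambda>m S. insert (\<lambda>_. 0) ((\<lambda>z. atom_direction X e p \<alpha> \<beta> I \<phi> (m, z)) ` S)"
  note fam = compact_directions_family[OF e p \<alpha> \<beta> _ I \<phi>]
  \<comment> \<open>For a negative radius the ball is empty and does not contain \<open>e\<close>.\<close>
  have ee: "mdist X e e = 0" using e by simp
  have sing: "compactin ?T {e}" "compactin ?T {}" using e by auto
  have "compact (?K 0 (mspace X \<times> mspace X))"
  proof (rule fam)
    have "mspace X \<times> mspace X \<inter> ?B R \<times> ?B R = ?B R \<times> ?B R" for R by auto
    then show "compactin (prod_topology ?T ?T) (mspace X \<times> mspace X \<inter> ?B R \<times> ?B R)" for R
      using balls[of R] by (simp add: compactin_Times)
  qed auto
  moreover have "compact (?K 1 (mspace X \<times> {e}))"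
  proof (rule fam)
    have "mspace X \<times> {e} \<inter> ?B R \<times> ?B R = ?B R \<times> (if 0 \<le> R then {e} else {})" for R using e by (auto simp: ee)
    then show "compactin (prod_topology ?T ?T) (mspace X \<times> {e} \<inter> ?B R \<times> ?B R)" for R
      using balls[of R] sing by (simp add: compactin_Times)
  qed (use e in auto)
  moreover have "compact (?K (-1) ({e} \<times> mspace X))"
  proof (rule fam)
    have "{e} \<times> mspace X \<inter> ?B R \<times> ?B R = (if 0 \<le> R then {e} else {}) \<times> ?B R" for R using e by (auto simp: ee)
    then show "compactin (prod_topology ?T ?T) ({e} \<times> mspace X \<inter> ?B R \<times> ?B R)" for R
      using balls[of R] sing by (simp add: compactin_Times)
  qed (use e in auto)
  ultimately have "compact (?K 0 (mspace X \<times> mspace X) \<union> ?K 1 (mspace X \<times> {e}) \<union> ?K (-1) ({e} \<times> mspace X))"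
    by (intro compact_Un)
  also have "?K 0 (mspace X \<times> mspace X) \<union> ?K 1 (mspace X \<times> {e}) \<union> ?K (-1) ({e} \<times> mspace X)
      = insert (\<lambda>_. 0) (atom_direction X e p \<alpha> \<beta> I \<phi> ` atom_set X e)"
    unfolding atom_set_def by (auto simp: image_iff)
  finally show ?thesis .
qed

section \<open>Moment vectors of measures and of atomic measures\<close>

definition moment_hull ::
  "'a metric \<Rightarrow> 'a \<Rightarrow> real \<Rightarrow> real \<Rightarrow> real \<Rightarrow> nat \<Rightarrow> (nat \<Rightarrow> 'a \<Rightarrow> real) \<Rightarrow> (nat \<Rightarrow> real) set" where
  "moment_hull X e p \<alpha> \<beta> N \<phi> = subconvex_combinations N
     (insert (\<lambda>_. 0) (atom_direction X e p \<alpha> \<beta> {1..N} \<phi> ` atom_set X e))"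

text \<open>The separating functional \<open>b\<close> attains its maximum \<open>s\<close> over the hull, so \<open>\<psi> = \<Sum>\<^sub>i b\<^sub>i \<phi>\<^sub>i\<close> pairs with
  every atom to at most \<open>s\<close> times its cost, and weak duality contradicts the separation.\<close>

lemma moments_in_hull:
  assumes e: "e \<in> mspace X" and p: "1 < p" and \<alpha>: "0 \<le> \<alpha>" and \<beta>: "0 < \<beta>"
    and \<phi>: "\<And>i. i \<in> {1..N} \<Longrightarrow> lipschitz_fun X (C i) (\<phi> i)"
    and balls: "\<And>R. compactin (mtopology_of X) (mcball_of X e R)"
    and \<nu>: "\<nu> \<in> moment_measures X e p"
  shows "\<exists>d\<in>moment_hull X e p \<alpha> \<beta> N \<phi>. \<forall>i\<in>{1..N}.
     signed_integral X \<nu> (\<phi> i) = regularizer X e p \<alpha> \<beta> \<nu> * d i"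
proof (rule ccontr)
  let ?I = "{1..N}"
  define K where "K = insert (\<lambda>_. 0) (atom_direction X e p \<alpha> \<beta> ?I \<phi> ` atom_set X e)"
  define T where "T = subconvex_combinations N K"
  define r where "r = regularizer X e p \<alpha> \<beta> \<nu>"
  define z where "z i = (if i \<in> ?I then signed_integral X \<nu> (\<phi> i) else 0)" for i
  have p1: "1 \<le> p" and \<beta>0: "0 \<le> \<beta>" using p \<beta> by auto
  have r: "0 \<le> r" unfolding r_def by (rule regularizer_nonneg[OF e p1 \<alpha> \<beta>0 \<nu>])
  have supp: "v i = 0" if "v \<in> K" "i \<notin> ?I" for v i
    using that by (auto simp: K_def atom_direction_def)
  have ne: "K \<noteq> {}" by (simp add: K_def)
  have cK: "compact K" unfolding K_def by (rule compact_atom_directions[OF e p \<alpha> \<beta> _ \<phi> balls]) auto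
  have cT: "compact T" unfolding T_def by (rule compact_subconvex_combinations[OF cK ne])
  have KT: "v \<in> T" if "v \<in> K" for v
  proof -
    have "(\<lambda>i. \<Sum>a\<in>{()}. 1 * v i) \<in> subconvex_combinations N K"
      by (rule finite_combination_in_subconvex_combinations[where I = ?I]) (use that ne supp in auto)
    then show ?thesis by (simp add: T_def)
  qed
  have 0: "(\<lambda>_. 0) \<in> T" by (rule KT) (simp add: K_def)
  have suppT: "v i = 0" if v: "v \<in> T" and i: "i \<notin> ?I" for v i
  proof -
    obtain t k where "\<forall>j<N. 0 \<le> t j \<and> k j \<in> K" "v = (\<lambda>i. \<Sum>j<N. t j * k j i)"
      using v unfolding T_def subconvex_combinations_def by blast
    then show ?thesis using supp[OF _ i] by (auto intro!: sum.neutral)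
  qed
  have conv: "(\<lambda>i. (1 - u) * c i + u * d i) \<in> T"
    if "c \<in> T" "d \<in> T" "0 \<le> u" "u \<le> 1" for c d u
    unfolding T_def
    by (rule subconvex_combinations_convex[where I = ?I]) (use that ne supp in \<open>auto simp: T_def\<close>)
  assume n: "\<not> ?thesis"
  let ?S = "(\<lambda>d i. r * d i) ` T"
  have Sz: "z \<notin> ?S"
  proof
    assume "z \<in> ?S"
    then obtain d where d: "d \<in> T" "z = (\<lambda>i. r * d i)" by auto
    have "signed_integral X \<nu> (\<phi> i) = r * d i" if "i \<in> ?I" for i
      using that fun_cong[OF d(2), of i] by (simp add: z_def)
    then show False using n d(1) unfolding T_def K_def r_def moment_hull_def by blast
  qed
  have Sc: "compact ?S"
  proof (rule compact_continuous_image[OF _ cT])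
    have "continuous_on T (\<lambda>d. d i)" for i
      by (rule continuous_on_product_then_coordinatewise[OF continuous_on_id])
    then show "continuous_on T (\<lambda>d i. r * d i)"
      by (intro continuous_on_coordinatewise_then_product continuous_on_mult continuous_on_const)
  qed
  have Sne: "?S \<noteq> {}" using 0 by blast
  have Sconv: "(\<lambda>i. (1 - u) * c i + u * d i) \<in> ?S" if cd: "c \<in> ?S" "d \<in> ?S" and u: "0 \<le> u" "u \<le> 1" for c d u
  proof -
    obtain c' d' where "c' \<in> T" "d' \<in> T" "c = (\<lambda>i. r * c' i)" "d = (\<lambda>i. r * d' i)" using cd by blast
    then show ?thesis
      using conv[OF _ _ u, of c' d']
      by (intro image_eqI[where x = "\<lambda>i. (1 - u) * c' i + u * d' i"]) (auto simp: algebra_simps)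
  qed
  have Ssupp: "v i = 0" if "v \<in> insert z ?S" "i \<notin> ?I" for v i
    using that suppT by (auto simp: z_def)
  have "\<exists>b. \<forall>d\<in>?S. (\<Sum>i\<in>?I. b i * d i) < (\<Sum>i\<in>?I. b i * z i)"
  proof (rule separate_point_compact_convex[OF _ Sc Sne _ _ Sz])
    show "(\<lambda>i. (1 - u) * c i + u * d i) \<in> ?S" if "c \<in> ?S" "d \<in> ?S" "0 \<le> u" "u \<le> 1" for c d u
      using that by (rule Sconv)
    show "v i = 0" if "v \<in> insert z ?S" "i \<notin> ?I" for v i
      using that by (rule Ssupp)
  qed simp
  then obtain b where b: "\<forall>d\<in>?S. (\<Sum>i\<in>?I. b i * d i) < (\<Sum>i\<in>?I. b i * z i)" ..
  have cb: "continuous_on T (\<lambda>d. \<Sum>i\<in>?I. b i * d i)"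
    by (intro continuous_on_sum continuous_on_mult continuous_on_const
        continuous_on_product_then_coordinatewise[OF continuous_on_id])
  obtain d0 where d0: "d0 \<in> T" "\<And>d. d \<in> T \<Longrightarrow> (\<Sum>i\<in>?I. b i * d i) \<le> (\<Sum>i\<in>?I. b i * d0 i)"
    using continuous_attains_sup[OF cT _ cb] 0 by blast
  define s where "s = (\<Sum>i\<in>?I. b i * d0 i)"
  have s: "0 \<le> s" using d0(2)[OF 0] by (simp add: s_def)
  define \<psi> where "\<psi> x = (\<Sum>i\<in>?I. b i * \<phi> i x)" for x
  have \<psi>: "lipschitz_fun X (\<Sum>i\<in>?I. \<bar>b i\<bar> * C i) \<psi>"
    unfolding \<psi>_def[abs_def] by (rule lipschitz_fun_sum[OF \<phi>])
  have int: "integrable (total_variation X \<nu>) (\<phi> i)" if "i \<in> ?I" for i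
    by (rule integrable_lipschitz_fun[OF e moment_measures_subset[OF e p1 \<nu>] \<phi>[OF that]])
  have "signed_integral X \<nu> \<psi> \<le> s * regularizer X e p \<alpha> \<beta> \<nu>"
  proof (rule signed_integral_le_regularizer[OF e p1 \<alpha> \<beta>0 s \<nu> \<psi>])
    fix a assume a: "a \<in> atom_set X e"
    have cost: "0 < atom_cost X e p \<alpha> \<beta> a" by (rule atom_cost_pos_atom_set[OF \<alpha> \<beta> a])
    have "(\<Sum>i\<in>?I. b i * atom_direction X e p \<alpha> \<beta> ?I \<phi> a i) \<le> s"
      unfolding s_def using a by (intro d0(2) KT) (simp add: K_def)
    moreover have "(\<Sum>i\<in>?I. b i * atom_direction X e p \<alpha> \<beta> ?I \<phi> a i)
        = (\<Sum>i\<in>?I. b i * atom_pairing e (\<phi> i) a) / atom_cost X e p \<alpha> \<beta> a"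
      by (simp add: atom_direction_def sum_divide_distrib)
    moreover have "(\<Sum>i\<in>?I. b i * atom_pairing e (\<phi> i) a) = atom_pairing e \<psi> a"
      by (simp add: atom_pairing_def \<psi>_def case_prod_beta sum.distrib sum_subtractf sum_distrib_left algebra_simps)
    ultimately show "atom_pairing e \<psi> a \<le> s * atom_cost X e p \<alpha> \<beta> a"
      using cost by (simp add: pos_divide_le_eq)
  qed
  also have "signed_integral X \<nu> \<psi> = (\<Sum>i\<in>?I. b i * z i)"
  proof -
    have "signed_integral X \<nu> \<psi> = (\<Sum>i\<in>?I. signed_integral X \<nu> (\<lambda>x. b i * \<phi> i x))"
      unfolding \<psi>_def[abs_def] using int by (intro signed_integral_sum_fun) auto
    also have "\<dots> = (\<Sum>i\<in>?I. b i * z i)"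
      by (intro sum.cong refl) (simp add: signed_integral_cmult_fun[OF int] z_def)
    finally show ?thesis .
  qed
  finally have "(\<Sum>i\<in>?I. b i * z i) \<le> s * r" by (simp add: r_def)
  moreover have "(\<Sum>i\<in>?I. b i * (r * d0 i)) < (\<Sum>i\<in>?I. b i * z i)" using bspec[OF b imageI[OF d0(1)]] by simp
  moreover have "(\<Sum>i\<in>?I. b i * (r * d0 i)) = s * r"
    by (simp add: s_def sum_distrib_left sum_distrib_right algebra_simps)
  ultimately show False by simp
qed

text \<open>The weights of a combination of directions are divided by the costs of the atoms; a term that
  uses the point 0 of the hull is realised by the weight 0 on an arbitrary atom.\<close>

lemma hull_realized_by_atoms:
  assumes e: "e \<in> mspace X" and \<alpha>: "0 \<le> \<alpha>" and \<beta>: "0 < \<beta>"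
    and d: "d \<in> moment_hull X e p \<alpha> \<beta> N \<phi>" and r: "0 \<le> r"
  shows "\<exists>t a. (\<forall>j\<in>{1..N}. 0 \<le> t j \<and> a j \<in> atom_set X e) \<and>
     (\<Sum>j = 1..N. t j * atom_cost X e p \<alpha> \<beta> (a j)) \<le> r \<and>
     (\<forall>i\<in>{1..N}. (\<Sum>j = 1..N. t j * atom_pairing e (\<phi> i) (a j)) = r * d i)"
proof -
  let ?dir = "atom_direction X e p \<alpha> \<beta> {1..N} \<phi>"
  let ?c = "atom_cost X e p \<alpha> \<beta>"
  obtain s k where sk: "\<forall>j<N. 0 \<le> s j \<and> k j \<in> insert (\<lambda>_. 0) (?dir ` atom_set X e)"
    "(\<Sum>j<N. s j) \<le> 1" "d = (\<lambda>i. \<Sum>j<N. s j * k j i)"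
    using d unfolding moment_hull_def subconvex_combinations_def by blast
  have "\<exists>q b. 0 \<le> q \<and> b \<in> atom_set X e \<and> q * ?c b \<le> s j \<and> (\<forall>i\<in>{1..N}. q * atom_pairing e (\<phi> i) b = s j * k j i)"
    if j: "j < N" for j
  proof (cases "k j = (\<lambda>_. 0)")
    case True
    have "(0, e, e) \<in> atom_set X e" using e by (simp add: atom_set_def)
    then show ?thesis using True sk(1) j by (intro exI[of _ 0] exI[of _ "(0, e, e)"]) auto
  next
    case False
    then obtain b where b: "b \<in> atom_set X e" "k j = ?dir b" using sk(1) j by auto
    have "0 < ?c b" by (rule atom_cost_pos_atom_set[OF \<alpha> \<beta> b(1)])
    then show ?thesis
      using b sk(1) j by (intro exI[of _ "s j / ?c b"] exI[of _ b]) (auto simp: atom_direction_def)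
  qed
  then obtain q b where qb: "\<And>j. j < N \<Longrightarrow> 0 \<le> q j \<and> b j \<in> atom_set X e \<and> q j * ?c (b j) \<le> s j \<and>
      (\<forall>i\<in>{1..N}. q j * atom_pairing e (\<phi> i) (b j) = s j * k j i)"
    by metis
  have shift: "(\<Sum>j = 1..N. f (j - 1)) = (\<Sum>j<N. f j)" for f :: "nat \<Rightarrow> real"
    by (rule sum.reindex_bij_witness[where i = Suc and j = "\<lambda>j. j - 1"]) auto
  show ?thesis
  proof (intro exI[of _ "\<lambda>j. r * q (j - 1)"] exI[of _ "\<lambda>j. b (j - 1)"] conjI ballI)
    fix j assume "j \<in> {1..N}"
    then have "j - 1 < N" by auto
    then show "0 \<le> r * q (j - 1)" "b (j - 1) \<in> atom_set X e" using qb r by auto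
  next
    have "(\<Sum>j = 1..N. r * q (j - 1) * ?c (b (j - 1))) = r * (\<Sum>j<N. q j * ?c (b j))"
      using shift[of "\<lambda>j. r * q j * ?c (b j)"] by (simp add: sum_distrib_left mult.assoc)
    also have "\<dots> \<le> r * (\<Sum>j<N. s j)" using qb r by (intro mult_left_mono sum_mono) auto
    also have "\<dots> \<le> r" using sk(2) r mult_left_mono[of "\<Sum>j<N. s j" 1 r] by simp
    finally show "(\<Sum>j = 1..N. r * q (j - 1) * ?c (b (j - 1))) \<le> r" .
  next
    fix i assume i: "i \<in> {1..N}"
    have "(\<Sum>j = 1..N. r * q (j - 1) * atom_pairing e (\<phi> i) (b (j - 1)))
        = r * (\<Sum>j<N. q j * atom_pairing e (\<phi> i) (b j))"
      using shift[of "\<lambda>j. r * q j * atom_pairing e (\<phi> i) (b j)"] by (simp add: sum_distrib_left mult.assoc)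
    also have "\<dots> = r * d i" using qb i by (simp add: sk(3))
    finally show "(\<Sum>j = 1..N. r * q (j - 1) * atom_pairing e (\<phi> i) (b (j - 1))) = r * d i" .
  qed
qed

text \<open>A value \<open>r\<close> larger than \<open>F 0 - l\<close> loses against \<open>r = 0\<close>, so the search can be restricted to a
  compact set.\<close>

lemma cone_minimum_exists:
  fixes F :: "('i \<Rightarrow> real) \<Rightarrow> real"
  assumes T: "compact T" "T \<noteq> {}" and F: "continuous_on UNIV F" "\<And>w. l \<le> F w"
  shows "\<exists>r0\<ge>0. \<exists>d0\<in>T. \<forall>r\<ge>0. \<forall>d\<in>T. F (\<lambda>i. r0 * d0 i) + r0 \<le> F (\<lambda>i. r * d i) + r"
proof -
  define B where "B = F (\<lambda>_. 0) - l"
  have B: "0 \<le> B" using F(2) by (simp add: B_def)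
  define G where "G = (\<lambda>z. F (\<lambda>i. fst z * snd z i) + fst z)"
  have "continuous_on ({0..B} \<times> T) (\<lambda>z i. fst z * snd z i)"
    by (intro continuous_on_coordinatewise_then_product continuous_on_mult continuous_on_fst continuous_on_id
        continuous_on_product_then_coordinatewise[OF continuous_on_snd[OF continuous_on_id]])
  then have "continuous_on ({0..B} \<times> T) G"
    unfolding G_def by (intro continuous_on_add continuous_on_fst continuous_on_id
        continuous_on_compose2[OF F(1)]) auto
  moreover have "compact ({0..B} \<times> T)" "{0..B} \<times> T \<noteq> {}" using T B by (auto intro: compact_Times)
  ultimately obtain z where z: "z \<in> {0..B} \<times> T" "\<And>z'. z' \<in> {0..B} \<times> T \<Longrightarrow> G z \<le> G z'"
    using continuous_attains_inf[of "{0..B} \<times> T" G] by blast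
  have "G z \<le> F (\<lambda>i. r * d i) + r" if rd: "0 \<le> r" "d \<in> T" for r d
  proof (cases "r \<le> B")
    case True
    then show ?thesis using z(2)[of "(r, d)"] rd by (simp add: G_def)
  next
    case False
    have "G z \<le> G (0, d)" using z(2) rd B by simp
    also have "\<dots> = l + B" by (simp add: G_def B_def)
    also have "\<dots> \<le> F (\<lambda>i. r * d i) + r" using F(2)[of "\<lambda>i. r * d i"] False by linarith
    finally show ?thesis .
  qed
  then show ?thesis
    using z(1) by (intro exI[of _ "fst z"] conjI bexI[of _ "snd z"]) (auto simp: G_def)
qed

lemma continuous_coercive_bounded_below:
  fixes f :: "real \<Rightarrow> real"
  assumes "continuous_on UNIV f" "filterlim f at_top at_infinity"
  shows "\<exists>l. \<forall>t. l \<le> f t"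
proof -
  have "\<forall>\<^sub>F t in at_infinity. 0 \<le> f t" using assms(2) by (simp add: filterlim_at_top)
  then obtain b where b: "\<And>t. b \<le> norm t \<Longrightarrow> 0 \<le> f t" by (auto simp: eventually_at_infinity)
  have "continuous_on {-\<bar>b\<bar>..\<bar>b\<bar>} f" "{-\<bar>b\<bar>..\<bar>b\<bar>} \<noteq> {}"
    using continuous_on_subset[OF assms(1)] by auto
  then obtain t0 where t0: "\<forall>t\<in>{-\<bar>b\<bar>..\<bar>b\<bar>}. f t0 \<le> f t"
    using continuous_attains_inf[OF compact_Icc, of "-\<bar>b\<bar>" "\<bar>b\<bar>" f] by blast
  have "min 0 (f t0) \<le> f t" for t
    using bspec[OF t0, of t] b[of t] by (cases "\<bar>t\<bar> \<le> \<bar>b\<bar>") (auto simp: abs_le_iff min_le_iff_disj)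
  then show ?thesis by blast
qed

section \<open>The representer theorem\<close>

lemma Lipschitz_continuous_map_real_iff:
  "Lipschitz_continuous_map X euclidean_metric f \<longleftrightarrow> (\<exists>C\<ge>0. lipschitz_fun X C f)" (is "?L \<longleftrightarrow> ?R")
proof
  assume ?L
  then obtain B where B: "\<And>x y. x \<in> mspace X \<Longrightarrow> y \<in> mspace X \<Longrightarrow> \<bar>f x - f y\<bar> \<le> B * mdist X x y"
    by (auto simp: Lipschitz_continuous_map_def dist_real_def)
  have "lipschitz_fun X \<bar>B\<bar> f"
    unfolding lipschitz_fun_def
  proof (intro ballI)
    fix x y assume "x \<in> mspace X" "y \<in> mspace X"
    then have "\<bar>f x - f y\<bar> \<le> B * mdist X x y" by (rule B)
    also have "\<dots> \<le> \<bar>B\<bar> * mdist X x y" by (intro mult_right_mono) auto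
    finally show "\<bar>f x - f y\<bar> \<le> \<bar>B\<bar> * mdist X x y" .
  qed
  then show ?R by (intro exI[of _ "\<bar>B\<bar>"]) simp
qed (auto simp: Lipschitz_continuous_map_def lipschitz_fun_def dist_real_def)

lemma objective_embed:
  fixes \<Theta> :: "('v::real_inner) metric"
  assumes e: "e \<in> mspace \<Theta>" and p: "1 \<le> p" and \<beta>: "0 < \<beta>"
    and \<nu>: "\<nu> \<in> moment_measures \<Theta> e p" and \<mu>: "\<mu> \<in> moment_measures \<Theta> e p"
    and \<phi>: "\<And>i. i \<in> {1..N} \<Longrightarrow> lipschitz_fun \<Theta> (C i) (\<lambda>\<theta>. \<sigma> (\<theta> \<bullet> x i)) \<and> 0 \<le> C i"
  shows "objective \<Theta> e \<sigma> L N x y p \<alpha> \<beta> \<mu> (KRu_embed \<Theta> e (\<lambda>A. \<nu> A + \<mu> A))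
    = ereal (1 / real N * (\<Sum>i = 1..N. L (y i) (signed_integral \<Theta> \<nu> (\<lambda>\<theta>. \<sigma> (\<theta> \<bullet> x i))
          + signed_integral \<Theta> \<mu> (\<lambda>\<theta>. \<sigma> (\<theta> \<bullet> x i)))) + regularizer \<Theta> e p \<alpha> \<beta> \<nu>)"
proof -
  note \<nu>1 = moment_measures_subset[OF e p \<nu>] and \<mu>1 = moment_measures_subset[OF e p \<mu>]
  note s1 = moment_measures_add[OF e \<nu>1 \<mu>1]
  have diff: "KRu_diff \<Theta> e (KRu_embed \<Theta> e (\<lambda>A. \<nu> A + \<mu> A)) (KRu_embed \<Theta> e \<mu>) = KRu_embed \<Theta> e \<nu>"
    using KRu_diff_embed[OF e s1 \<mu>1] by simp
  have net: "network \<Theta> \<sigma> (KRu_embed \<Theta> e (\<lambda>A. \<nu> A + \<mu> A)) (x i)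
      = signed_integral \<Theta> \<nu> (\<lambda>\<theta>. \<sigma> (\<theta> \<bullet> x i)) + signed_integral \<Theta> \<mu> (\<lambda>\<theta>. \<sigma> (\<theta> \<bullet> x i))"
    if i: "i \<in> {1..N}" for i
  proof -
    have L: "lipschitz_fun \<Theta> (C i) (\<lambda>\<theta>. \<sigma> (\<theta> \<bullet> x i))" "0 \<le> C i" using \<phi>[OF i] by auto
    show ?thesis
      unfolding network_def KRu_pairing_embed[OF e s1 L] using \<nu>1 \<mu>1
      by (intro signed_integral_add moment_measures_signed[of _ \<Theta> e 1] integrable_lipschitz_fun[OF e _ L(1)])
  qed
  have pen: "moment_penalty \<Theta> e p (KRu_embed \<Theta> e \<nu>) = ennreal (LINT z|total_variation \<Theta> \<nu>. moment_weight \<Theta> e p z)"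
    unfolding moment_penalty_embed[OF e p \<nu>] nn_integral_moment_weight[OF e \<nu>, symmetric]
    by (simp add: moment_weight_def)
  show ?thesis
    unfolding objective_def diff pen KRu_norm_embed[OF e \<nu>1]
    using \<beta> integral_moment_weight_nonneg[of \<Theta> \<nu> e p]
    by (simp add: net regularizer_def)
qed

lemma objective_eq_infinity_or_embed:
  assumes e: "e \<in> mspace \<Theta>" and p: "1 \<le> p" and \<beta>: "0 < \<beta>"
    and \<mu>: "\<mu> \<in> moment_measures \<Theta> e p" and u: "u \<in> KRu \<Theta> e"
    and fin: "objective \<Theta> e \<sigma> L N x y p \<alpha> \<beta> \<mu> u \<noteq> \<infinity>"
  obtains \<nu> where "\<nu> \<in> moment_measures \<Theta> e p" "u = KRu_embed \<Theta> e (\<lambda>A. \<nu> A + \<mu> A)"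
proof -
  have "moment_penalty \<Theta> e p (KRu_diff \<Theta> e u (KRu_embed \<Theta> e \<mu>)) \<noteq> \<infinity>"
    using fin \<beta> by (auto simp: objective_def)
  then obtain \<nu> where \<nu>: "\<nu> \<in> moment_measures \<Theta> e p" "KRu_diff \<Theta> e u (KRu_embed \<Theta> e \<mu>) = KRu_embed \<Theta> e \<nu>"
    by (rule KRu_embed_of_finite_penalty)
  have "u = KRu_embed \<Theta> e (\<lambda>A. \<nu> A + \<mu> A)"
    using moment_measures_subset[OF e p] \<mu> \<nu> by (intro KRu_eq_embed_of_diff[OF e u])
  then show ?thesis using that \<nu>(1) by blast
qed

text \<open>The minimum over \<open>r \<ge> 0\<close> and \<open>d \<in> T\<close> bounds the objective of every measure from below, and the
  atomic measure that realises it attains it. The mass of that measure is the sum of the corrections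
  at the base point, since dipoles have mass 0.\<close>

theorem theorem6p7:
  fixes \<Theta> :: "(real ^ 'n) metric"
    and e :: "real ^ 'n"
    and \<sigma> loss :: "real \<Rightarrow> real"
    and L :: "real \<Rightarrow> real \<Rightarrow> real"
    and p \<alpha> \<beta> :: real
    and N :: nat
    and x :: "nat \<Rightarrow> real ^ 'n"
    and y :: "nat \<Rightarrow> real"
    and \<mu>s :: "(real ^ 'n) set \<Rightarrow> real"
  assumes "e \<in> mspace \<Theta>"
    and "mcomplete_of \<Theta>"
    and "separable_space (mtopology_of \<Theta>)"
    and "locally_compact_space (mtopology_of \<Theta>)"
    and "geodesic_metric \<Theta>"
    and "\<exists>C. C-lipschitz_on UNIV \<sigma>"
    and "\<And>z :: real ^ 'n. Lipschitz_continuous_map \<Theta> euclidean_metric (\<lambda>\<theta>. \<sigma> (\<theta> \<bullet> z))"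
    and "1 < p" and "0 \<le> \<alpha>" and "0 < \<beta>" and "1 \<le> N"
    and "\<mu>s \<in> moment_measures \<Theta> e p"
    and "\<And>t w. L t w = loss (t - w)"
    and "convex_on UNIV loss"
    and "filterlim loss at_top at_infinity"
    and "lower_semicontinuous loss"
  shows "\<exists>\<mu>min \<in> KRu \<Theta> e.
      objective \<Theta> e \<sigma> L N x y p \<alpha> \<beta> \<mu>s \<mu>min
        = (INF \<mu> \<in> KRu \<Theta> e. objective \<Theta> e \<sigma> L N x y p \<alpha> \<beta> \<mu>s \<mu>) \<and>
      (\<exists>(\<theta> :: nat \<Rightarrow> real ^ 'n) (\<eta> :: nat \<Rightarrow> real ^ 'n) (c :: nat \<Rightarrow> real).
        (\<forall>i\<in>{1..N}. \<theta> i \<in> mspace \<Theta> \<and> \<eta> i \<in> mspace \<Theta>) \<and>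
        \<mu>min = KRu_embed \<Theta> e (\<lambda>A.
          (\<Sum>i = 1..N. c i * (dirac \<Theta> (\<theta> i) A - dirac \<Theta> (\<eta> i) A))
          + KRu_mass \<Theta> (KRu_diff \<Theta> e \<mu>min (KRu_embed \<Theta> e \<mu>s)) * dirac \<Theta> e A
          + \<mu>s A))"
proof -
  note e = assms(1) and p = assms(8) and \<alpha> = assms(9) and \<beta> = assms(10) and \<mu>s = assms(12)
  have p1: "1 \<le> p" using p by simp
  have balls: "compactin (mtopology_of \<Theta>) (mcball_of \<Theta> e R)" for R
    by (rule hopf_rinow_compactin_mcball[OF assms(2,4,5,1)])
  define \<phi> where "\<phi> i \<theta> = \<sigma> (\<theta> \<bullet> x i)" for i \<theta>
  have "\<exists>C\<ge>0. lipschitz_fun \<Theta> C (\<phi> i)" for i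
    using assms(7)[of "x i"] unfolding Lipschitz_continuous_map_real_iff \<phi>_def[abs_def] .
  then obtain C where C: "\<And>i. 0 \<le> C i" "\<And>i. lipschitz_fun \<Theta> (C i) (\<phi> i)" by metis
  define J where "J = objective \<Theta> e \<sigma> L N x y p \<alpha> \<beta> \<mu>s"
  define R where "R = regularizer \<Theta> e p \<alpha> \<beta>"
  define F where "F w = 1 / real N * (\<Sum>i = 1..N. loss (y i - (w i + signed_integral \<Theta> \<mu>s (\<phi> i))))"
    for w :: "nat \<Rightarrow> real"
  have J: "J (KRu_embed \<Theta> e (\<lambda>A. \<nu> A + \<mu>s A)) = ereal (F (\<lambda>i. signed_integral \<Theta> \<nu> (\<phi> i)) + R \<nu>)"
    if "\<nu> \<in> moment_measures \<Theta> e p" for \<nu>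
    using objective_embed[OF e p1 \<beta> that \<mu>s, of N C \<sigma> x L y \<alpha>] C
    by (simp add: J_def R_def F_def \<phi>_def[abs_def] assms(13))
  have Fcong: "F v = F w" if "\<And>i. i \<in> {1..N} \<Longrightarrow> v i = w i" for v w
    using that by (simp add: F_def)
  have loss: "continuous_on UNIV loss" using convex_on_continuous[OF open_UNIV assms(14)] .
  have Fc: "continuous_on UNIV F"
    unfolding F_def by (intro continuous_on_mult continuous_on_sum continuous_on_const
        continuous_on_compose2[OF loss] continuous_on_diff continuous_on_add continuous_on_product_coordinates) auto
  obtain l where l: "\<And>t. l \<le> loss t" using continuous_coercive_bounded_below[OF loss assms(15)] by blast
  have Fl: "l \<le> F w" for w
  proof -
    have "real N * l \<le> (\<Sum>i = 1..N. loss (y i - (w i + signed_integral \<Theta> \<mu>s (\<phi> i))))"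
      using sum_mono[of "{1..N}" "\<lambda>_. l"] l by simp
    then show ?thesis using \<open>1 \<le> N\<close> by (simp add: F_def field_simps)
  qed
  define T where "T = moment_hull \<Theta> e p \<alpha> \<beta> N \<phi>"
  have "compact T"
    unfolding T_def moment_hull_def
    by (rule compact_subconvex_combinations[OF compact_atom_directions[OF e p \<alpha> \<beta> _ C(2) balls]]) auto
  moreover have "T \<noteq> {}"
    using moments_in_hull[where \<phi> = \<phi> and C = C and N = N, OF e p \<alpha> \<beta> C(2) balls \<mu>s] unfolding T_def by blast
  ultimately obtain r d where rd: "0 \<le> r" "d \<in> T"
    and min: "\<And>r' d'. 0 \<le> r' \<Longrightarrow> d' \<in> T \<Longrightarrow> F (\<lambda>i. r * d i) + r \<le> F (\<lambda>i. r' * d' i) + r'"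
    using cone_minimum_exists[OF _ _ Fc Fl] by metis
  from hull_realized_by_atoms[OF e \<alpha> \<beta> rd(2)[unfolded T_def] rd(1)]
  obtain t a where ta0: "\<forall>j\<in>{1..N}. 0 \<le> t j \<and> a j \<in> atom_set \<Theta> e"
      "\<forall>i\<in>{1..N}. (\<Sum>j = 1..N. t j * atom_pairing e (\<phi> i) (a j)) = r * d i"
    and cost: "(\<Sum>j = 1..N. t j * atom_cost \<Theta> e p \<alpha> \<beta> (a j)) \<le> r"
    by (elim exE conjE)
  have ta: "\<And>j. j \<in> {1..N} \<Longrightarrow> 0 \<le> t j" "\<And>j. j \<in> {1..N} \<Longrightarrow> a j \<in> atom_set \<Theta> e"
    "\<And>i. i \<in> {1..N} \<Longrightarrow> (\<Sum>j = 1..N. t j * atom_pairing e (\<phi> i) (a j)) = r * d i"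
    using ta0 by blast+
  define \<nu> where "\<nu> A = (\<Sum>j = 1..N. t j * atom_measure \<Theta> e (a j) A)" for A
  have \<nu>: "\<nu> \<in> moment_measures \<Theta> e p"
    unfolding \<nu>_def[abs_def] by (rule atomic_moment_measures[OF e p1 \<alpha> \<beta>]) (use ta in auto)
  have \<nu>R: "R \<nu> \<le> r"
    unfolding \<nu>_def[abs_def] R_def
    by (rule order_trans[OF regularizer_atomic_le[OF e p1 \<alpha> \<beta>] cost]) (use ta in auto)
  have \<nu>s: "signed_integral \<Theta> \<nu> (\<phi> i) = r * d i" if "i \<in> {1..N}" for i
    unfolding \<nu>_def[abs_def] ta(3)[OF that, symmetric]
    by (rule signed_integral_atomic[OF e p1 \<alpha> \<beta> _ _ _ C(2)]) (use ta in auto)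
  define \<mu> where "\<mu> = KRu_embed \<Theta> e (\<lambda>A. \<nu> A + \<mu>s A)"
  note \<nu>1 = moment_measures_subset[OF e p1 \<nu>] and \<mu>s1 = moment_measures_subset[OF e p1 \<mu>s]
  note sum1 = moment_measures_add[OF e \<nu>1 \<mu>s1]
  have \<mu>K: "\<mu> \<in> KRu \<Theta> e" unfolding \<mu>_def by (rule KRu_embed_in_KRu[OF e sum1])
  have "J \<mu> \<le> J u" if u: "u \<in> KRu \<Theta> e" for u
  proof (cases "J u = \<infinity>")
    case False
    then obtain \<rho> where \<rho>: "\<rho> \<in> moment_measures \<Theta> e p" "u = KRu_embed \<Theta> e (\<lambda>A. \<rho> A + \<mu>s A)"
      using objective_eq_infinity_or_embed[OF e p1 \<beta> \<mu>s u] unfolding J_def by metis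
    obtain d' where d': "d' \<in> T" "\<forall>i\<in>{1..N}. signed_integral \<Theta> \<rho> (\<phi> i) = R \<rho> * d' i"
      using moments_in_hull[where \<phi> = \<phi> and C = C and N = N, OF e p \<alpha> \<beta> C(2) balls \<rho>(1)]
      unfolding T_def R_def by (elim bexE)
    have R0: "0 \<le> R \<rho>" unfolding R_def using \<beta> by (intro regularizer_nonneg[OF e p1 \<alpha> _ \<rho>(1)]) simp
    have "F (\<lambda>i. signed_integral \<Theta> \<nu> (\<phi> i)) + R \<nu> \<le> F (\<lambda>i. r * d i) + r"
      using Fcong[of "\<lambda>i. signed_integral \<Theta> \<nu> (\<phi> i)" "\<lambda>i. r * d i"] \<nu>s \<nu>R by simp
    also have "\<dots> \<le> F (\<lambda>i. R \<rho> * d' i) + R \<rho>" by (rule min[OF R0 d'(1)])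
    also have "\<dots> = F (\<lambda>i. signed_integral \<Theta> \<rho> (\<phi> i)) + R \<rho>"
      using Fcong[of "\<lambda>i. signed_integral \<Theta> \<rho> (\<phi> i)" "\<lambda>i. R \<rho> * d' i"] d'(2) by simp
    finally show ?thesis unfolding \<mu>_def \<rho>(2) J[OF \<nu>] J[OF \<rho>(1)] by simp
  qed simp
  then have opt: "J \<mu> = (INF u \<in> KRu \<Theta> e. J u)"
    using \<mu>K by (intro antisym INF_greatest INF_lower)
  have diff: "KRu_diff \<Theta> e \<mu> (KRu_embed \<Theta> e \<mu>s) = KRu_embed \<Theta> e \<nu>"
    using KRu_diff_embed[OF e sum1 \<mu>s1] unfolding \<mu>_def by simp
  define m where "m j = fst (a j)" for j
  define \<theta> where "\<theta> j = fst (snd (a j))" for j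
  define \<eta> where "\<eta> j = snd (snd (a j))" for j
  have aj: "a j = (m j, \<theta> j, \<eta> j)" for j by (simp add: m_def \<theta>_def \<eta>_def)
  have pts: "\<theta> j \<in> mspace \<Theta> \<and> \<eta> j \<in> mspace \<Theta>" if "j \<in> {1..N}" for j
    using ta(2)[OF that] e unfolding aj by (auto simp: atom_set_def)
  have \<nu>A: "\<nu> A = (\<Sum>j = 1..N. t j * (dirac \<Theta> (\<theta> j) A - dirac \<Theta> (\<eta> j) A))
      + (\<Sum>j = 1..N. t j * m j) * dirac \<Theta> e A" for A
    unfolding \<nu>_def aj atom_measure_def case_prod_conv sum_distrib_right sum.distrib[symmetric]
    by (intro sum.cong refl) (simp add: algebra_simps)
  have top: "mspace \<Theta> \<in> sets (mborel \<Theta>)" using sets.top[of "mborel \<Theta>"] by simp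
  have "(\<Sum>j = 1..N. t j * (dirac \<Theta> (\<theta> j) (mspace \<Theta>) - dirac \<Theta> (\<eta> j) (mspace \<Theta>))) = 0"
    using pts top by (intro sum.neutral) (auto simp: dirac_def)
  then have mass: "KRu_mass \<Theta> (KRu_diff \<Theta> e \<mu> (KRu_embed \<Theta> e \<mu>s)) = (\<Sum>j = 1..N. t j * m j)"
    unfolding diff KRu_mass_embed[OF e \<nu>1] \<nu>A using e top by (simp add: dirac_def)
  have "\<mu> = KRu_embed \<Theta> e (\<lambda>A. (\<Sum>i = 1..N. t i * (dirac \<Theta> (\<theta> i) A - dirac \<Theta> (\<eta> i) A))
          + KRu_mass \<Theta> (KRu_diff \<Theta> e \<mu> (KRu_embed \<Theta> e \<mu>s)) * dirac \<Theta> e A + \<mu>s A)"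
    unfolding mass \<nu>A[symmetric] by (fact \<mu>_def)
  then show ?thesis
    using \<mu>K opt pts unfolding J_def by (intro bexI[of _ \<mu>] conjI exI[of _ \<theta>] exI[of _ \<eta>] exI[of _ t]) auto
qed

end
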